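(* Let $n\ge 3$ and let $E=V\oplus W$ be a contact path geometry with vanishing contact torsion on a contact manifold $(M,H)$ of dimension $2n-1$. Then its secondary contact torsion vanishes if and only if $W=\mathrm{Ch}(\partial(U,W))$.
   Context: $(M,H)$ is a contact manifold of dimension $2n-1$, $n\ge 3$; each $H_x$ carries the conformal symplectic structure given by restricting $d\theta$ for local contact one-forms $\theta$. $\pi:\mathbb{P}(H)\to M$ is the projectivization; a point $L\in\mathbb{P}(H)$ is a line $L\subset H_{\pi(L)}$, and $L^{\perp}\subset H_{\pi(L)}$ is its skew complement. Define subbundles of $T\mathbb{P}(H)$ by $V=\ker\pi_*$, $E_L=\{v:\pi_*(v)\in L\}$, $E^{\perp}_L=\{v:\pi_*(v)\in L^{\perp}\}$, $\mathcal{H}_L=\{v:\pi_*(v)\in H_{\pi(L)}\}$, and $U\subset V$ by $U_L=\mathrm{Hom}(L,L^{\perp}/L)\subset \mathrm{Hom}(L,H_{\pi(L)}/L)\simeq T_L(\mathbb{P}(H_{\pi(L)}))=V_L$. A contact path geometry is a line subbundle $W\subset E$ with $E=V\oplus W$ (it may be given only on an open subset of $\mathbb{P}(H)$; then $\mathbb{P}(H)$ is to be replaced by that open subset throughout). $\partial(U,W)$ is the subbundle of $T\mathbb{P}(H)$ (in fact of $E^\perp$) spanned by sections of $U$, sections of $W$, and brackets $[A,X]$, $A\in\Gamma(U)$, $X\in\Gamma(W)$. The contact torsion $\Pi\in\Gamma((\mathcal{H}/E^{\perp})\otimes S^2(W^* )\otimes U^* )$ is $\Pi(X,X',A)=[X,[X',A]]\bmod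 E^{\perp}$ for sections $X,X'$ of $W$ and $A$ of $U$. If $\Pi=0$, the secondary contact torsion is the section of $S^2(W^* )\otimes U^*\otimes(E^{\perp}/\partial(U,W))$ given by $(X,X',A)\mapsto[X,[X',A]]\bmod\partial(U,W)$. For a smooth distribution $C$ on a manifold $N$, the characteristic system at $x\in N$ is $\mathrm{Ch}_x(C)=\{v\in C_x: i(v)d\omega\in\mathrm{Ann}(C)\ \text{at } x\text{ for all local sections }\omega\text{ of }\mathrm{Ann}(C)\}$. *)

theory Defs
  imports "HOL-Analysis.Analysis" "HOL-Library.Function_Algebras"
begin

text \<open>Real-valued functions form a real vector space under pointwise operations. Tangent vectors
  are realised below as functionals on functions, so that the library notions
  \<^const>\<open>span\<close>, \<^const>\<open>dim\<close>, \<^const>\<open>independent\<close>, ... apply to them.\<close>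

instantiation "fun" :: (type, real_vector) real_vector
begin

definition scaleR_fun_def: "c *\<^sub>R f = (\<lambda>x. c *\<^sub>R f x)"

instance
  by standard (auto simp: scaleR_fun_def fun_eq_iff algebra_simps)

end


section \<open>Smooth manifolds\<close>

primrec times_differentiable_on ::
  "nat \<Rightarrow> 'e::real_normed_vector set \<Rightarrow> ('e \<Rightarrow> 'b::real_normed_vector) \<Rightarrow> bool" where
  "times_differentiable_on 0 S f \<longleftrightarrow> continuous_on S f"
| "times_differentiable_on (Suc k) S f \<longleftrightarrow>
     (\<forall>x\<in>S. f differentiable (at x)) \<and>
     (\<forall>v. times_differentiable_on k S (\<lambda>x. frechet_derivative f (at x) v))"

text \<open>Intended for open \<open>S\<close> only.\<close>
definition smooth_on :: "'e::real_normed_vector set \<Rightarrow> ('e \<Rightarrow> 'b::real_normed_vector) \<Rightarrow> bool" where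
  "smooth_on S f \<longleftrightarrow> (\<forall>k. times_differentiable_on k S f)"

text \<open>A chart is a pair of its domain and its coordinate map. A manifold is given by an atlas
  (not necessarily maximal); its underlying point set is the union of the chart domains.\<close>
type_synonym ('a, 'e) chart = "'a set \<times> ('a \<Rightarrow> 'e)"

definition carrier_of :: "('a, 'e) chart set \<Rightarrow> 'a set" where
  "carrier_of A = \<Union> (fst ` A)"

definition atlas_topology :: "('a, 'e::euclidean_space) chart set \<Rightarrow> 'a topology" where
  "atlas_topology A = topology_generated_by {U \<inter> \<phi> -` G |U \<phi> G. (U, \<phi>) \<in> A \<and> open G}"

definition smooth_manifold :: "('a, 'e::euclidean_space) chart set \<Rightarrow> bool" where
  "smooth_manifold A \<longleftrightarrow>
     (\<forall>(U, \<phi>) \<in> A. inj_on \<phi> U \<and> open (\<phi> ` U)) \<and>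
     (\<forall>(U, \<phi>) \<in> A. \<forall>(U', \<phi>') \<in> A.
        open (\<phi> ` (U \<inter> U')) \<and> smooth_on (\<phi> ` (U \<inter> U')) (\<phi>' \<circ> inv_into U \<phi>)) \<and>
     Hausdorff_space (atlas_topology A) \<and> second_countable (atlas_topology A)"

definition smooth_fun :: "('a, 'e::euclidean_space) chart set \<Rightarrow> 'a set \<Rightarrow> ('a \<Rightarrow> real) \<Rightarrow> bool" where
  "smooth_fun A S f \<longleftrightarrow>
     openin (atlas_topology A) S \<and>
     (\<forall>(U, \<phi>) \<in> A. smooth_on (\<phi> ` (S \<inter> U)) (f \<circ> inv_into U \<phi>))"

definition smooth_near :: "('a, 'e::euclidean_space) chart set \<Rightarrow> 'a \<Rightarrow> ('a \<Rightarrow> real) \<Rightarrow> bool" where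
  "smooth_near A p f \<longleftrightarrow> (\<exists>S. p \<in> S \<and> smooth_fun A S f)"

text \<open>Tangent vectors at \<open>p\<close> are the derivations at \<open>p\<close> of functions that are smooth near \<open>p\<close>.
  All functions are total, so a derivation is made to vanish on functions that are not smooth
  near \<open>p\<close>; otherwise it would not be determined by its values on germs of smooth functions.\<close>
type_synonym 'a tvec = "('a \<Rightarrow> real) \<Rightarrow> real"

definition tangent :: "('a, 'e::euclidean_space) chart set \<Rightarrow> 'a \<Rightarrow> 'a tvec set" where
  "tangent A p = {D.
     (\<forall>f. \<not> smooth_near A p f \<longrightarrow> D f = 0) \<and>
     (\<forall>f g. smooth_near A p f \<longrightarrow> smooth_near A p g \<longrightarrow>
        D (\<lambda>q. f q + g q) = D f + D g \<and> D (\<lambda>q. f q * g q) = f p * D g + g p * D f) \<and>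
     (\<forall>c f. smooth_near A p f \<longrightarrow> D (\<lambda>q. c * f q) = c * D f)}"

definition pushforward ::
  "('b, 'e::euclidean_space) chart set \<Rightarrow> ('a \<Rightarrow> 'b) \<Rightarrow> 'a \<Rightarrow> 'a tvec \<Rightarrow> 'b tvec" where
  "pushforward A F p v = (\<lambda>g. if smooth_near A (F p) g then v (g \<circ> F) else 0)"

definition velocity :: "('a, 'e::euclidean_space) chart set \<Rightarrow> (real \<Rightarrow> 'a) \<Rightarrow> 'a tvec" where
  "velocity A \<gamma> = (\<lambda>f. if smooth_near A (\<gamma> 0) f then deriv (\<lambda>t. f (\<gamma> t)) 0 else 0)"

definition vector_field ::
  "('a, 'e::euclidean_space) chart set \<Rightarrow> 'a set \<Rightarrow> ('a \<Rightarrow> 'a tvec) \<Rightarrow> bool" where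
  "vector_field A S X \<longleftrightarrow>
     openin (atlas_topology A) S \<and> (\<forall>p\<in>S. X p \<in> tangent A p) \<and>
     (\<forall>T f. T \<subseteq> S \<longrightarrow> smooth_fun A T f \<longrightarrow> smooth_fun A T (\<lambda>p. X p f))"

definition bracket ::
  "('a, 'e::euclidean_space) chart set \<Rightarrow> ('a \<Rightarrow> 'a tvec) \<Rightarrow> ('a \<Rightarrow> 'a tvec) \<Rightarrow> 'a \<Rightarrow> 'a tvec" where
  "bracket A X Y p =
     (\<lambda>f. if smooth_near A p f then X p (\<lambda>q. Y q f) - Y p (\<lambda>q. X q f) else 0)"

definition one_form ::
  "('a, 'e::euclidean_space) chart set \<Rightarrow> 'a set \<Rightarrow> ('a \<Rightarrow> 'a tvec \<Rightarrow> real) \<Rightarrow> bool" where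
  "one_form A S \<omega> \<longleftrightarrow>
     openin (atlas_topology A) S \<and>
     (\<forall>p\<in>S. \<forall>u\<in>tangent A p. \<forall>v\<in>tangent A p. \<forall>a b.
        \<omega> p (a *\<^sub>R u + b *\<^sub>R v) = a * \<omega> p u + b * \<omega> p v) \<and>
     (\<forall>T X. T \<subseteq> S \<longrightarrow> vector_field A T X \<longrightarrow> smooth_fun A T (\<lambda>p. \<omega> p (X p)))"

text \<open>\<open>d\<omega>(X, Y) = X(\<omega>(Y)) - Y(\<omega>(X)) - \<omega>([X, Y])\<close>, evaluated on vectors \<open>u\<close>, \<open>v\<close> at \<open>p\<close> by means
  of arbitrary local extensions (the value does not depend on them).\<close>
definition ext_deriv ::
  "('a, 'e::euclidean_space) chart set \<Rightarrow> ('a \<Rightarrow> 'a tvec \<Rightarrow> real) \<Rightarrow> 'a \<Rightarrow> 'a tvec \<Rightarrow> 'a tvec \<Rightarrow> real" where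
  "ext_deriv A \<omega> p u v = (THE r. \<exists>S X Y. p \<in> S \<and> vector_field A S X \<and> vector_field A S Y \<and>
     X p = u \<and> Y p = v \<and>
     r = X p (\<lambda>q. \<omega> q (Y q)) - Y p (\<lambda>q. \<omega> q (X q)) - \<omega> p (bracket A X Y p))"

section \<open>Distributions\<close>

definition section_of ::
  "('a, 'e::euclidean_space) chart set \<Rightarrow> 'a set \<Rightarrow> ('a \<Rightarrow> 'a tvec set) \<Rightarrow> ('a \<Rightarrow> 'a tvec) \<Rightarrow> bool" where
  "section_of A S C X \<longleftrightarrow> vector_field A S X \<and> (\<forall>p\<in>S. X p \<in> C p)"

definition local_frame ::
  "('a, 'e::euclidean_space) chart set \<Rightarrow> 'a set \<Rightarrow> ('a \<Rightarrow> 'a tvec set) \<Rightarrow> 'i set \<Rightarrow>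
    ('i \<Rightarrow> 'a \<Rightarrow> 'a tvec) \<Rightarrow> bool" where
  "local_frame A S C I e \<longleftrightarrow>
     (\<forall>i\<in>I. section_of A S C (e i)) \<and>
     (\<forall>p\<in>S. inj_on (\<lambda>i. e i p) I \<and> independent ((\<lambda>i. e i p) ` I) \<and>
        span ((\<lambda>i. e i p) ` I) = C p)"

definition subbundle ::
  "('a, 'e::euclidean_space) chart set \<Rightarrow> 'a set \<Rightarrow> ('a \<Rightarrow> 'a tvec set) \<Rightarrow> nat \<Rightarrow> bool" where
  "subbundle A S C k \<longleftrightarrow>
     (\<forall>p\<in>S. \<exists>T e. p \<in> T \<and> T \<subseteq> S \<and> openin (atlas_topology A) T \<and> local_frame A T C {..<k} e)"

text \<open>The characteristic system of a distribution \<open>C\<close> on the open submanifold \<open>N\<close>.\<close>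
definition characteristic ::
  "('a, 'e::euclidean_space) chart set \<Rightarrow> 'a set \<Rightarrow> ('a \<Rightarrow> 'a tvec set) \<Rightarrow> 'a \<Rightarrow> 'a tvec set" where
  "characteristic A N C p = {v \<in> C p. \<forall>S \<omega>. p \<in> S \<longrightarrow> S \<subseteq> N \<longrightarrow> one_form A S \<omega> \<longrightarrow>
     (\<forall>q\<in>S. \<forall>w\<in>C q. \<omega> q w = 0) \<longrightarrow> (\<forall>w\<in>C p. ext_deriv A \<omega> p v w = 0)}"

section \<open>Contact manifolds\<close>

definition contact_form ::
  "('a, 'e::euclidean_space) chart set \<Rightarrow> ('a \<Rightarrow> 'a tvec set) \<Rightarrow> 'a set \<Rightarrow> ('a \<Rightarrow> 'a tvec \<Rightarrow> real) \<Rightarrow> bool"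
  where
  "contact_form A H S \<theta> \<longleftrightarrow>
     one_form A S \<theta> \<and>
     (\<forall>x\<in>S. H x = {v \<in> tangent A x. \<theta> x v = 0} \<and> H x \<noteq> tangent A x \<and>
        (\<forall>v\<in>H x. (\<forall>w\<in>H x. ext_deriv A \<theta> x v w = 0) \<longrightarrow> v = 0))"

text \<open>The contact distribution need not be co-orientable.\<close>
definition contact_manifold ::
  "nat \<Rightarrow> ('a, 'e::euclidean_space) chart set \<Rightarrow> ('a \<Rightarrow> 'a tvec set) \<Rightarrow> bool" where
  "contact_manifold n A H \<longleftrightarrow>
     smooth_manifold A \<and> DIM('e) = 2 * n - 1 \<and>
     (\<forall>x\<in>carrier_of A. \<exists>S \<theta>. x \<in> S \<and> contact_form A H S \<theta>)"

text \<open>Two local contact forms differ by a nonvanishing factor and thus give the same complement.\<close>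
definition skew_complement ::
  "('a, 'e::euclidean_space) chart set \<Rightarrow> ('a \<Rightarrow> 'a tvec set) \<Rightarrow> 'a \<Rightarrow> 'a tvec set \<Rightarrow> 'a tvec set" where
  "skew_complement A H x L =
     {v \<in> H x. \<forall>S \<theta>. x \<in> S \<longrightarrow> contact_form A H S \<theta> \<longrightarrow> (\<forall>w\<in>L. ext_deriv A \<theta> x v w = 0)}"

section \<open>The projectivized contact distribution\<close>

text \<open>A point of \<open>\<P>(H)\<close> is a pair \<open>(x, L)\<close> of a point \<open>x\<close> and a line \<open>L \<subseteq> H x\<close>; \<^const>\<open>fst\<close> is the
  projection to the base.\<close>
type_synonym 'a lpoint = "'a \<times> 'a tvec set"

definition proj_space ::
  "('a, 'e::euclidean_space) chart set \<Rightarrow> ('a \<Rightarrow> 'a tvec set) \<Rightarrow> 'a lpoint set" where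
  "proj_space A H = {(x, L). x \<in> carrier_of A \<and> subspace L \<and> L \<subseteq> H x \<and> dim L = 1}"

text \<open>Affine coordinates on \<open>\<P>(H)\<close>: a chart \<open>\<phi>\<close> of the base and a local frame of \<open>H\<close> consisting of
  \<open>e None\<close> and \<open>e (Some b)\<close>, with \<open>b\<close> in the standard basis of the model space \<open>'f\<close> of the fibre
  (so \<open>DIM('f) + 1\<close> must be the rank of \<open>H\<close>), assign to \<open>(u, z)\<close> the line spanned by
  \<open>e None + \<Sum>b. z\<^sub>b e (Some b)\<close> over \<open>\<phi>\<inverse>(u)\<close>.\<close>
definition proj_param ::
  "('a, 'e::euclidean_space) chart \<Rightarrow> ('f::euclidean_space option \<Rightarrow> 'a \<Rightarrow> 'a tvec) \<Rightarrow>
    'e \<times> 'f \<Rightarrow> 'a lpoint" where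
  "proj_param c e = (\<lambda>(u, z). let x = inv_into (fst c) (snd c) u in
     (x, span {e None x + (\<Sum>b\<in>Basis. (z \<bullet> b) *\<^sub>R e (Some b) x)}))"

definition proj_atlas ::
  "('a, 'e::euclidean_space) chart set \<Rightarrow> ('a \<Rightarrow> 'a tvec set) \<Rightarrow>
    ('a lpoint, 'e \<times> 'f::euclidean_space) chart set" where
  "proj_atlas A H =
     {(proj_param c e ` (snd c ` S \<times> UNIV), inv_into (snd c ` S \<times> UNIV) (proj_param c e)) |c e S.
        c \<in> A \<and> S \<subseteq> fst c \<and> openin (atlas_topology A) S \<and>
        local_frame A S H (insert None (Some ` (Basis :: 'f set))) e}"

text \<open>The canonical subbundles of \<open>T\<P>(H)\<close>. Here and below, \<open>A\<close> is the atlas of the base and \<open>B\<close>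
  that of \<open>\<P>(H)\<close>.\<close>

definition V_bundle ::
  "('a, 'e::euclidean_space) chart set \<Rightarrow> ('a lpoint, 'g::euclidean_space) chart set \<Rightarrow>
    'a lpoint \<Rightarrow> 'a lpoint tvec set" where
  "V_bundle A B p = {v \<in> tangent B p. pushforward A fst p v = 0}"

definition E_bundle ::
  "('a, 'e::euclidean_space) chart set \<Rightarrow> ('a lpoint, 'g::euclidean_space) chart set \<Rightarrow>
    'a lpoint \<Rightarrow> 'a lpoint tvec set" where
  "E_bundle A B p = {v \<in> tangent B p. pushforward A fst p v \<in> snd p}"

definition Eperp_bundle ::
  "('a, 'e::euclidean_space) chart set \<Rightarrow> ('a \<Rightarrow> 'a tvec set) \<Rightarrow>
    ('a lpoint, 'g::euclidean_space) chart set \<Rightarrow> 'a lpoint \<Rightarrow> 'a lpoint tvec set" where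
  "Eperp_bundle A H B p =
     {v \<in> tangent B p. pushforward A fst p v \<in> skew_complement A H (fst p) (snd p)}"

text \<open>The isomorphism \<open>Hom(L, H\<^sub>x/L) \<cong> T\<^sub>L\<P>(H\<^sub>x) = V\<^sub>L\<close> sends the class of a linear \<open>h : L \<rightarrow> H\<^sub>x\<close> to
  the velocity at \<open>t = 0\<close> of the curve of lines \<open>{l + t h(l). l \<in> L}\<close>, which depends only on
  \<open>h\<close> modulo \<open>L\<close>. Elements of \<open>Hom(L, L\<^sup>\<bottom>/L)\<close> are given by lifts \<open>h : L \<rightarrow> L\<^sup>\<bottom>\<close>.\<close>

definition hom_to_vertical ::
  "('a lpoint, 'g::euclidean_space) chart set \<Rightarrow> 'a lpoint \<Rightarrow> ('a tvec \<Rightarrow> 'a tvec) \<Rightarrow> 'a lpoint tvec" where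
  "hom_to_vertical B p h = velocity B (\<lambda>t. (fst p, (\<lambda>l. l + t *\<^sub>R h l) ` snd p))"

definition U_bundle ::
  "('a, 'e::euclidean_space) chart set \<Rightarrow> ('a \<Rightarrow> 'a tvec set) \<Rightarrow>
    ('a lpoint, 'g::euclidean_space) chart set \<Rightarrow> 'a lpoint \<Rightarrow> 'a lpoint tvec set" where
  "U_bundle A H B p =
     {hom_to_vertical B p h |h. linear h \<and> h ` snd p \<subseteq> skew_complement A H (fst p) (snd p)}"

section \<open>Contact path geometries and their torsions\<close>

text \<open>The line field \<open>W\<close> is given on an open subset \<open>N\<close> of \<open>\<P>(H)\<close>.\<close>
definition contact_path_geometry ::
  "('a, 'e::euclidean_space) chart set \<Rightarrow> ('a \<Rightarrow> 'a tvec set) \<Rightarrow> ('a lpoint, 'g::euclidean_space) chart set \<Rightarrow>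
    'a lpoint set \<Rightarrow> ('a lpoint \<Rightarrow> 'a lpoint tvec set) \<Rightarrow> bool" where
  "contact_path_geometry A H B N W \<longleftrightarrow>
     N \<subseteq> proj_space A H \<and> openin (atlas_topology B) N \<and> subbundle B N W 1 \<and>
     (\<forall>p\<in>N. W p \<subseteq> E_bundle A B p \<and> V_bundle A B p \<inter> W p = {0} \<and>
        E_bundle A B p = {v + w |v w. v \<in> V_bundle A B p \<and> w \<in> W p})"

text \<open>\<open>\<partial>(U, W)\<close>\<close>
definition bracket_span ::
  "('a, 'e::euclidean_space) chart set \<Rightarrow> 'a set \<Rightarrow> ('a \<Rightarrow> 'a tvec set) \<Rightarrow> ('a \<Rightarrow> 'a tvec set) \<Rightarrow>
    'a \<Rightarrow> 'a tvec set" where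
  "bracket_span B N U W p = span (
     {Y p |Y S. p \<in> S \<and> S \<subseteq> N \<and> section_of B S U Y} \<union>
     {X p |X S. p \<in> S \<and> S \<subseteq> N \<and> section_of B S W X} \<union>
     {bracket B Y X p |Y X S. p \<in> S \<and> S \<subseteq> N \<and> section_of B S U Y \<and> section_of B S W X})"

definition residue_class :: "'v::ab_group_add set \<Rightarrow> 'v \<Rightarrow> 'v set" where
  "residue_class C v = (\<lambda>c. v + c) ` C"

text \<open>The map \<open>(X, X', Y) \<mapsto> [X, [X', Y]] mod C\<close> on sections \<open>X\<close>, \<open>X'\<close> of \<open>W\<close> and \<open>Y\<close> of \<open>U\<close>. The
  contact torsion is the case \<open>C = E\<^sup>\<bottom>\<close>, the secondary contact torsion the case \<open>C = \<partial>(U, W)\<close>.\<close>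
definition double_bracket_mod ::
  "('a, 'e::euclidean_space) chart set \<Rightarrow> ('a \<Rightarrow> 'a tvec set) \<Rightarrow>
    ('a \<Rightarrow> 'a tvec) \<Rightarrow> ('a \<Rightarrow> 'a tvec) \<Rightarrow> ('a \<Rightarrow> 'a tvec) \<Rightarrow> 'a \<Rightarrow> 'a tvec set" where
  "double_bracket_mod B C X X' Y p = residue_class (C p) (bracket B X (bracket B X' Y) p)"

text \<open>\<open>C p\<close> is the zero element of the quotient by \<open>C p\<close>.\<close>
definition double_bracket_vanishes ::
  "('a, 'e::euclidean_space) chart set \<Rightarrow> 'a set \<Rightarrow> ('a \<Rightarrow> 'a tvec set) \<Rightarrow> ('a \<Rightarrow> 'a tvec set) \<Rightarrow>
    ('a \<Rightarrow> 'a tvec set) \<Rightarrow> bool" where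
  "double_bracket_vanishes B N U W C \<longleftrightarrow>
     (\<forall>S X X' Y. S \<subseteq> N \<longrightarrow> section_of B S W X \<longrightarrow> section_of B S W X' \<longrightarrow> section_of B S U Y \<longrightarrow>
        (\<forall>p\<in>S. double_bracket_mod B C X X' Y p = C p))"

definition contact_torsion_vanishes ::
  "('a, 'e::euclidean_space) chart set \<Rightarrow> ('a \<Rightarrow> 'a tvec set) \<Rightarrow>
    ('a lpoint, 'g::euclidean_space) chart set \<Rightarrow> 'a lpoint set \<Rightarrow>
    ('a lpoint \<Rightarrow> 'a lpoint tvec set) \<Rightarrow> bool" where
  "contact_torsion_vanishes A H B N W \<longleftrightarrow>
     double_bracket_vanishes B N (U_bundle A H B) W (Eperp_bundle A H B)"

definition secondary_contact_torsion_vanishes ::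
  "('a, 'e::euclidean_space) chart set \<Rightarrow> ('a \<Rightarrow> 'a tvec set) \<Rightarrow>
    ('a lpoint, 'g::euclidean_space) chart set \<Rightarrow> 'a lpoint set \<Rightarrow>
    ('a lpoint \<Rightarrow> 'a lpoint tvec set) \<Rightarrow> bool" where
  "secondary_contact_torsion_vanishes A H B N W \<longleftrightarrow>
     double_bracket_vanishes B N (U_bundle A H B) W (bracket_span B N (U_bundle A H B) W)"

end

theory Submission
  imports Defs
begin

text \<open>Write \<open>D\<close> for \<open>\<partial>(U, W)\<close>. For sections \<open>X\<close>, \<open>Y\<close> of \<open>D\<close> and a one-form \<open>\<omega>\<close> annihilating \<open>D\<close> one has
  \<open>d\<omega>(X, Y) = - \<omega>([X, Y])\<close>, and \<open>d\<omega>\<close> is tensorial. So a line bundle \<open>W\<close> inside \<open>D\<close> lies in \<open>Ch(D)\<close> as soon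
  as its brackets with the sections that span \<open>D\<close> have values in \<open>D\<close>. For sections of \<open>U\<close> this
  is the definition of \<open>D\<close>, for sections of \<open>W\<close> it is clear since \<open>W\<close> has rank one, and for \<open>[U, W]\<close> it is the
  vanishing of the secondary contact torsion (\<open>line_bundle_le_characteristic\<close>).

  The rest uses one-forms annihilating \<open>D\<close>. Let \<open>\<theta>\<close> be a contact form on the base and \<open>l\<close> a local section of the
  tautological line bundle. The forms \<open>\<pi>\<^sup>*\<theta>\<close> and \<open>\<alpha> = d\<theta>(l, \<pi>\<^sub>* _)\<close> on \<open>\<P>(H)\<close> cut out \<open>E\<^sup>\<bottom>\<close>, which contains \<open>D\<close>
  because \<open>\<pi>\<^sub>*[Y, X]\<close> is, modulo \<open>L\<close>, the value on \<open>\<pi>\<^sub>*X\<close> of the homomorphism \<open>L \<rightarrow> L\<^sup>\<bottom>/L\<close> that is the section \<open>Y\<close>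
  of \<open>U\<close> (\<open>bracket_U_W_components\<close>). For a frame \<open>X\<close> of \<open>W\<close> the contraction \<open>\<beta> = i(X) d\<alpha>\<close> is a third form, and
  \<open>\<beta>([Y, X']) = - \<alpha>([X, [Y, X']])\<close> is the contact torsion; so if that vanishes, \<open>\<beta>\<close> annihilates \<open>D\<close>, and \<open>D\<close> is exactly
  the kernel of \<open>\<beta>\<close> in \<open>E\<^sup>\<bottom>\<close> (\<open>contraction_annihilates_bracket_span\<close>, \<open>contraction_kernel_le_bracket_span\<close>).

  \<^item> If \<open>W \<subseteq> Ch(D)\<close>, then \<open>\<beta>([X, [X', Y]]) = - d\<beta>(X, [X', Y]) = 0\<close>, and \<open>[X, [X', Y]]\<close> lies in \<open>E\<^sup>\<bottom>\<close> by vanishing contact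
    torsion. Hence it lies in \<open>D\<close>, and the secondary torsion vanishes (\<open>double_bracket_in_bracket_span\<close>).

  \<^item> \<open>Ch(D) \<subseteq> W\<close> holds whenever the contact torsion vanishes (\<open>characteristic_le_W\<close>). Let \<open>v\<close> be characteristic.
    Testing \<open>d(\<pi>\<^sup>*\<theta>)\<close> on \<open>v\<close> and \<open>[Y, X]\<close> gives \<open>d\<theta>(\<pi>\<^sub>*v, h) = 0\<close> for all \<open>h\<close> in \<open>L\<^sup>\<bottom>\<close>, so \<open>\<pi>\<^sub>*v \<in> L\<close> by
    nondegeneracy. After subtracting a multiple of \<open>X\<close> one may take \<open>v\<close> vertical, \<open>v\<close> being given by a homomorphism
    \<open>k : L \<rightarrow> H/L\<close>. Then \<open>d\<alpha>(v, w) = d\<theta>(k(l), \<pi>\<^sub>*w)\<close>, and testing this on \<open>X\<close> and \<open>[Y, X]\<close> gives \<open>k(l) \<in> L\<close>, so \<open>v = 0\<close>.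

  These computations are carried out in affine coordinates \<open>(u, z)\<close> on \<open>\<P>(H)\<close>. What makes coordinates
  available is that derivations are directional derivatives, by Hadamard's lemma, and that the affine charts of
  \<open>\<P>(H)\<close> form a smooth atlas.\<close>

section \<open>Smooth maps between Euclidean spaces\<close>

lemma linear_euclidean_sum:
  fixes f :: "'e::euclidean_space \<Rightarrow> 'b::real_vector"
  assumes "linear f"
  shows "f w = (\<Sum>b\<in>Basis. (w \<bullet> b) *\<^sub>R f b)"
proof -
  have "f w = f (\<Sum>b\<in>Basis. (w \<bullet> b) *\<^sub>R b)" by (simp only: euclidean_representation)
  then show ?thesis by (simp only: linear_sum[OF assms] linear_cmul[OF assms])
qed

lemma frechet_derivative_eqI:
  assumes "(f has_derivative f') (at x)"
  shows "frechet_derivative f (at x) = f'"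
  using assms frechet_derivative_at by metis

lemma frechet_derivative_cong_open:
  assumes "open S" "x \<in> S" "\<And>y. y \<in> S \<Longrightarrow> f y = g y"
  shows "frechet_derivative f (at x) = frechet_derivative g (at x)"
proof -
  have "(f has_derivative F) (at x) \<longleftrightarrow> (g has_derivative F) (at x)" for F
    using has_derivative_transform_within_open[of f F x UNIV S g]
      has_derivative_transform_within_open[of g F x UNIV S f] assms by auto
  then show ?thesis by (simp add: frechet_derivative_def)
qed

lemma differentiable_cong_open:
  assumes "open S" "x \<in> S" "\<And>y. y \<in> S \<Longrightarrow> f y = g y" "f differentiable (at x)"
  shows "g differentiable (at x)"
  using assms has_derivative_transform_within_open[of f _ x UNIV S g]
  unfolding differentiable_def by metis

lemma times_differentiable_on_cong:
  assumes "open S" "\<And>y. y \<in> S \<Longrightarrow> f y = g y" "times_differentiable_on k S f"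
  shows "times_differentiable_on k S g"
  using assms
proof (induction k arbitrary: f g)
  case 0 then show ?case using continuous_on_cong by fastforce
next
  case (Suc k)
  have "times_differentiable_on k S (\<lambda>x. frechet_derivative g (at x) v)" for v
    by (rule Suc.IH[of "\<lambda>x. frechet_derivative f (at x) v"])
       (use Suc.prems frechet_derivative_cong_open[of S _ f g] in auto)
  moreover have "\<forall>x\<in>S. g differentiable (at x)"
    using Suc.prems differentiable_cong_open by (metis times_differentiable_on.simps(2))
  ultimately show ?case by simp
qed

lemma times_differentiable_on_subset:
  "times_differentiable_on k S f \<Longrightarrow> T \<subseteq> S \<Longrightarrow> times_differentiable_on k T f"
proof (induction k arbitrary: f)
  case 0 then show ?case using continuous_on_subset by auto
qed auto

lemma times_differentiable_on_local:
  assumes "\<And>x. x \<in> S \<Longrightarrow> \<exists>T. open T \<and> x \<in> T \<and> times_differentiable_on k T f"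
  shows "times_differentiable_on k S f"
  using assms
proof (induction k arbitrary: f)
  case 0
  then show ?case
    by (metis continuous_at_imp_continuous_on continuous_on_eq_continuous_at times_differentiable_on.simps(1))
next
  case (Suc k)
  have "times_differentiable_on k S (\<lambda>x. frechet_derivative f (at x) v)" for v
    by (rule Suc.IH) (use Suc.prems in fastforce)
  moreover have "\<forall>x\<in>S. f differentiable (at x)"
    using Suc.prems by fastforce
  ultimately show ?case by simp
qed

text \<open>Any derivative may be used in place of the chosen \<open>frechet_derivative\<close>.\<close>

lemma times_differentiable_on_SucI:
  assumes "open S" "\<And>x. x \<in> S \<Longrightarrow> (f has_derivative f' x) (at x)"
    "\<And>v. times_differentiable_on k S (\<lambda>x. f' x v)"
  shows "times_differentiable_on (Suc k) S f"
proof -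
  have "times_differentiable_on k S (\<lambda>x. frechet_derivative f (at x) v)" for v
    by (rule times_differentiable_on_cong[OF assms(1) _ assms(3)])
       (simp add: frechet_derivative_eqI[OF assms(2)])
  then show ?thesis using assms(2) by (auto simp: differentiable_def)
qed

lemma times_differentiable_on_Suc_has_derivative:
  "times_differentiable_on (Suc k) S f \<Longrightarrow> x \<in> S \<Longrightarrow>
    (f has_derivative frechet_derivative f (at x)) (at x)"
  using frechet_derivative_works by auto

lemma times_differentiable_on_pred:
  "times_differentiable_on (Suc k) S f \<Longrightarrow> times_differentiable_on k S f"
proof (induction k arbitrary: f)
  case 0
  then show ?case
    by (auto intro!: continuous_at_imp_continuous_on differentiable_imp_continuous_within)
qed auto

lemma times_differentiable_on_SucD:
  "times_differentiable_on (Suc k) S f \<Longrightarrow> times_differentiable_on k S (\<lambda>x. frechet_derivative f (at x) v)"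
  by simp

lemma times_differentiable_on_const:
  "open S \<Longrightarrow> times_differentiable_on k S (\<lambda>x. c)"
proof (induction k arbitrary: c)
  case (Suc k) then show ?case
    by (intro times_differentiable_on_SucI[where f'="\<lambda>_ _. 0"]) auto
qed simp

lemma times_differentiable_on_bounded_linear_id:
  assumes "open S" "bounded_linear h"
  shows "times_differentiable_on k S h"
proof (cases k)
  case 0 then show ?thesis using assms by (simp add: linear_continuous_on)
next
  case (Suc k)
  show ?thesis unfolding Suc
    by (rule times_differentiable_on_SucI[OF assms(1) bounded_linear_imp_has_derivative[OF assms(2)]])
       (rule times_differentiable_on_const[OF assms(1)])
qed

lemma times_differentiable_on_add:
  assumes "open S" "times_differentiable_on k S f" "times_differentiable_on k S g"
  shows "times_differentiable_on k S (\<lambda>x. f x + g x)"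
  using assms
proof (induction k arbitrary: f g)
  case 0 then show ?case by (auto intro: continuous_intros)
next
  case (Suc k)
  show ?case
    by (rule times_differentiable_on_SucI[OF Suc.prems(1)
          has_derivative_add[OF Suc.prems(2,3)[THEN times_differentiable_on_Suc_has_derivative]]])
       (use Suc in auto)
qed

lemma (in bounded_bilinear) times_differentiable_on:
  assumes "open S" "times_differentiable_on k S f" "times_differentiable_on k S g"
  shows "times_differentiable_on k S (\<lambda>x. prod (f x) (g x))"
  using assms
proof (induction k arbitrary: f g)
  case 0 then show ?case by (auto intro: continuous_on)
next
  case (Suc k)
  show ?case
    by (rule times_differentiable_on_SucI[OF Suc.prems(1)
          FDERIV[OF Suc.prems(2,3)[THEN times_differentiable_on_Suc_has_derivative]]])
       (use Suc.prems in \<open>auto intro!: times_differentiable_on_add Suc.IH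
          simp: times_differentiable_on_pred simp del: times_differentiable_on.simps(2)
          dest: times_differentiable_on_SucD\<close>)
qed

lemma times_differentiable_on_sum:
  assumes "open S" "\<And>i. i \<in> I \<Longrightarrow> times_differentiable_on k S (f i)"
  shows "times_differentiable_on k S (\<lambda>x. \<Sum>i\<in>I. f i x)"
  using assms
  by (induction I rule: infinite_finite_induct)
     (auto intro!: times_differentiable_on_add times_differentiable_on_const)

lemma times_differentiable_on_inverse:
  fixes f :: "'e::real_normed_vector \<Rightarrow> real"
  assumes "open S" "times_differentiable_on k S f" "\<And>x. x \<in> S \<Longrightarrow> f x \<noteq> 0"
  shows "times_differentiable_on k S (\<lambda>x. inverse (f x))"
  using assms
proof (induction k arbitrary: f)
  case 0 then show ?case by (auto intro: continuous_intros)
next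
  case (Suc k)
  have d: "((\<lambda>x. inverse (f x)) has_derivative
      (\<lambda>v. - (inverse (f x) * frechet_derivative f (at x) v * inverse (f x)))) (at x)" if "x \<in> S" for x
    by (rule Deriv.has_derivative_inverse[OF Suc.prems(3)[OF that]
        times_differentiable_on_Suc_has_derivative[OF Suc.prems(2) that]])
  note mult = bounded_bilinear.times_differentiable_on[OF bounded_bilinear_mult Suc.prems(1)]
  have i: "times_differentiable_on k S (\<lambda>x. inverse (f x))"
    by (rule Suc.IH[OF Suc.prems(1) times_differentiable_on_pred[OF Suc.prems(2)] Suc.prems(3)])
  have "times_differentiable_on k S (\<lambda>x. (-1) * (inverse (f x) * frechet_derivative f (at x) v * inverse (f x)))" for v
    by (intro mult i times_differentiable_on_const Suc.prems(1) times_differentiable_on_SucD[OF Suc.prems(2)])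
  then show ?case by (intro times_differentiable_on_SucI[OF Suc.prems(1) d]) auto
qed

lemma times_differentiable_on_compose:
  fixes f :: "'e::real_normed_vector \<Rightarrow> 'b::euclidean_space" and g :: "'b \<Rightarrow> 'c::real_normed_vector"
  assumes "open S" "open T" "times_differentiable_on k S f" "times_differentiable_on k T g" "f ` S \<subseteq> T"
  shows "times_differentiable_on k S (\<lambda>x. g (f x))"
  using assms
proof (induction k arbitrary: g)
  case 0 then show ?case by (auto intro: continuous_on_compose2)
next
  case (Suc k)
  let ?f' = "\<lambda>x. frechet_derivative f (at x)" and ?g' = "\<lambda>y. frechet_derivative g (at y)"
  have df: "(f has_derivative ?f' x) (at x)" if "x \<in> S" for x
    using times_differentiable_on_Suc_has_derivative[OF Suc.prems(3) that] .
  have dg: "(g has_derivative ?g' y) (at y)" if "y \<in> T" for y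
    using times_differentiable_on_Suc_has_derivative[OF Suc.prems(4) that] .
  have d: "((\<lambda>x. g (f x)) has_derivative (\<lambda>v. \<Sum>b\<in>Basis. (?f' x v \<bullet> b) *\<^sub>R ?g' (f x) b)) (at x)"
    if "x \<in> S" for x
  proof -
    have g': "(g has_derivative ?g' (f x)) (at (f x))" using dg that Suc.prems(5) by auto
    have "linear (?g' (f x))" using has_derivative_linear[OF g'] .
    then have "(\<lambda>v. ?g' (f x) (?f' x v)) = (\<lambda>v. \<Sum>b\<in>Basis. (?f' x v \<bullet> b) *\<^sub>R ?g' (f x) b)"
      using linear_euclidean_sum by blast
    then show ?thesis using has_derivative_compose[OF df[OF that] g'] by simp
  qed
  have f: "times_differentiable_on k S f"
    by (rule times_differentiable_on_pred[OF Suc.prems(3)])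
  have "times_differentiable_on k S (\<lambda>x. ?f' x v \<bullet> b)" for v b
    by (intro bounded_bilinear.times_differentiable_on[OF bounded_bilinear_inner] Suc.prems(1)
       times_differentiable_on_const times_differentiable_on_SucD[OF Suc.prems(3)])
  then show ?case
    by (intro times_differentiable_on_SucI[OF Suc.prems(1) d] times_differentiable_on_sum Suc.prems(1)
        bounded_bilinear.times_differentiable_on[OF bounded_bilinear_scaleR]
        Suc.IH[OF Suc.prems(1,2) f times_differentiable_on_SucD[OF Suc.prems(4)] Suc.prems(5)])
qed

named_theorems smooth_intros

lemma smooth_on_cong: "smooth_on S f \<Longrightarrow> open S \<Longrightarrow> (\<And>x. x \<in> S \<Longrightarrow> f x = g x) \<Longrightarrow> smooth_on S g"
  using times_differentiable_on_cong unfolding smooth_on_def by metis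

lemma smooth_on_subset: "smooth_on S f \<Longrightarrow> T \<subseteq> S \<Longrightarrow> smooth_on T f"
  using times_differentiable_on_subset unfolding smooth_on_def by metis

lemma smooth_on_local:
  "(\<And>x. x \<in> S \<Longrightarrow> \<exists>T. open T \<and> x \<in> T \<and> smooth_on T f) \<Longrightarrow> smooth_on S f"
  using times_differentiable_on_local unfolding smooth_on_def by metis

lemma smooth_on_const [smooth_intros]: "open S \<Longrightarrow> smooth_on S (\<lambda>x. c)"
  by (simp add: smooth_on_def times_differentiable_on_const)

lemma smooth_on_linear:
  fixes f :: "'e::euclidean_space \<Rightarrow> 'b::real_normed_vector"
  shows "open S \<Longrightarrow> linear f \<Longrightarrow> smooth_on S f"
  by (simp add: smooth_on_def times_differentiable_on_bounded_linear_id linear_conv_bounded_linear)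

lemma smooth_on_add [smooth_intros]:
  "open S \<Longrightarrow> smooth_on S f \<Longrightarrow> smooth_on S g \<Longrightarrow> smooth_on S (\<lambda>x. f x + g x)"
  by (simp add: smooth_on_def times_differentiable_on_add)

lemma smooth_on_sum [smooth_intros]:
  "open S \<Longrightarrow> (\<And>i. i \<in> I \<Longrightarrow> smooth_on S (f i)) \<Longrightarrow> smooth_on S (\<lambda>x. \<Sum>i\<in>I. f i x)"
  by (simp add: smooth_on_def times_differentiable_on_sum)

lemma smooth_on_scaleR [smooth_intros]:
  "open S \<Longrightarrow> smooth_on S f \<Longrightarrow> smooth_on S g \<Longrightarrow> smooth_on S (\<lambda>x. f x *\<^sub>R g x)"
  by (simp add: smooth_on_def bounded_bilinear.times_differentiable_on[OF bounded_bilinear_scaleR])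

lemma smooth_on_inner [smooth_intros]:
  "open S \<Longrightarrow> smooth_on S f \<Longrightarrow> smooth_on S g \<Longrightarrow> smooth_on S (\<lambda>x. f x \<bullet> g x)"
  by (simp add: smooth_on_def bounded_bilinear.times_differentiable_on[OF bounded_bilinear_inner])

lemma smooth_on_mult [smooth_intros]:
  fixes f :: "_ \<Rightarrow> 'b::real_normed_algebra"
  shows "open S \<Longrightarrow> smooth_on S f \<Longrightarrow> smooth_on S g \<Longrightarrow> smooth_on S (\<lambda>x. f x * g x)"
  by (simp add: smooth_on_def bounded_bilinear.times_differentiable_on[OF bounded_bilinear_mult])

lemma smooth_on_minus [smooth_intros]:
  "open S \<Longrightarrow> smooth_on S f \<Longrightarrow> smooth_on S (\<lambda>x. - f x)"
  using smooth_on_scaleR[OF _ smooth_on_const, of S f "-1"] by simp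

lemma smooth_on_diff [smooth_intros]:
  "open S \<Longrightarrow> smooth_on S f \<Longrightarrow> smooth_on S g \<Longrightarrow> smooth_on S (\<lambda>x. f x - g x)"
  using smooth_on_add[OF _ _ smooth_on_minus, of S f g] by simp

lemma smooth_on_divide [smooth_intros]:
  fixes f g :: "_ \<Rightarrow> real"
  shows "open S \<Longrightarrow> smooth_on S f \<Longrightarrow> smooth_on S g \<Longrightarrow> (\<And>x. x \<in> S \<Longrightarrow> g x \<noteq> 0) \<Longrightarrow>
    smooth_on S (\<lambda>x. f x / g x)"
  by (simp add: divide_inverse smooth_on_mult smooth_on_def times_differentiable_on_inverse
      bounded_bilinear.times_differentiable_on[OF bounded_bilinear_mult])

lemma smooth_on_compose:
  fixes f :: "'e::real_normed_vector \<Rightarrow> 'b::euclidean_space"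
  shows "smooth_on T g \<Longrightarrow> open S \<Longrightarrow> open T \<Longrightarrow> smooth_on S f \<Longrightarrow> (\<And>x. x \<in> S \<Longrightarrow> f x \<in> T) \<Longrightarrow>
    smooth_on S (\<lambda>x. g (f x))"
  unfolding smooth_on_def using times_differentiable_on_compose[of S T] by blast

lemma smooth_on_fst [smooth_intros]:
  fixes f :: "'e::real_normed_vector \<Rightarrow> 'b::euclidean_space \<times> 'c::euclidean_space"
  shows "open S \<Longrightarrow> smooth_on S f \<Longrightarrow> smooth_on S (\<lambda>x. fst (f x))"
  by (rule smooth_on_compose[OF smooth_on_linear[OF open_UNIV linear_fst]]) auto

lemma smooth_on_snd [smooth_intros]:
  fixes f :: "'e::real_normed_vector \<Rightarrow> 'b::euclidean_space \<times> 'c::euclidean_space"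
  shows "open S \<Longrightarrow> smooth_on S f \<Longrightarrow> smooth_on S (\<lambda>x. snd (f x))"
  by (rule smooth_on_compose[OF smooth_on_linear[OF open_UNIV linear_snd]]) auto

lemma smooth_on_Pair [smooth_intros]:
  fixes f :: "'e::real_normed_vector \<Rightarrow> 'b::euclidean_space" and g :: "'e \<Rightarrow> 'c::euclidean_space"
  assumes "open S" "smooth_on S f" "smooth_on S g"
  shows "smooth_on S (\<lambda>x. (f x, g x))"
proof -
  have "smooth_on S (\<lambda>x. (f x, 0) + (0, g x))"
    by (intro smooth_on_add assms(1)
        smooth_on_compose[OF smooth_on_linear[of UNIV "\<lambda>a. (a, 0 :: 'c)"] assms(1) open_UNIV assms(2)]
        smooth_on_compose[OF smooth_on_linear[of UNIV "\<lambda>a. (0 :: 'b, a)"] assms(1) open_UNIV assms(3)])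
       (auto intro!: linearI)
  then show ?thesis by simp
qed

lemma smooth_on_ident [smooth_intros]:
  "open S \<Longrightarrow> smooth_on S (\<lambda>x. x :: 'e::real_normed_vector)"
  by (simp add: smooth_on_def times_differentiable_on_bounded_linear_id bounded_linear_ident)

lemma smooth_on_has_derivative:
  "smooth_on S f \<Longrightarrow> x \<in> S \<Longrightarrow> (f has_derivative frechet_derivative f (at x)) (at x)"
  unfolding smooth_on_def using times_differentiable_on_Suc_has_derivative by blast

lemma smooth_on_compose_has_derivative:
  "smooth_on S f \<Longrightarrow> (g has_derivative g') (at t within T) \<Longrightarrow> g t \<in> S \<Longrightarrow>
    ((\<lambda>t. f (g t)) has_derivative (\<lambda>v. frechet_derivative f (at (g t)) (g' v))) (at t within T)"
  using has_derivative_compose[of g g' t T f] smooth_on_has_derivative by blast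

lemma smooth_on_frechet_derivative: "smooth_on S f \<Longrightarrow> smooth_on S (\<lambda>x. frechet_derivative f (at x) v)"
  unfolding smooth_on_def by (metis times_differentiable_on.simps(2))

lemma smooth_on_continuous: "smooth_on S f \<Longrightarrow> continuous_on S f"
  unfolding smooth_on_def by (metis times_differentiable_on.simps(1))

lemma linear_frechet_derivative_smooth: "smooth_on S f \<Longrightarrow> x \<in> S \<Longrightarrow> linear (frechet_derivative f (at x))"
  using smooth_on_has_derivative has_derivative_linear by blast

lemma smooth_on_directional_derivative:
  fixes f :: "'e::euclidean_space \<Rightarrow> 'b::real_normed_vector"
  assumes "open S" "smooth_on S f" "smooth_on S g"
  shows "smooth_on S (\<lambda>x. frechet_derivative f (at x) (g x))"
proof -
  have "smooth_on S (\<lambda>x. \<Sum>b\<in>Basis. (g x \<bullet> b) *\<^sub>R frechet_derivative f (at x) b)"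
    using assms by (intro smooth_intros smooth_on_frechet_derivative) auto
  then show ?thesis
    by (rule smooth_on_cong[OF _ assms(1)])
       (simp add: linear_euclidean_sum[OF linear_frechet_derivative_smooth[OF assms(2)]])
qed

text \<open>The weights \<open>s ^ j\<close> make the class of these integrals closed under differentiation: each directional
  derivative brings down one more factor \<open>s\<close>.\<close>

lemma times_differentiable_on_averaged:
  fixes f :: "'e::euclidean_space \<Rightarrow> real"
  assumes "open S" "convex S" "a \<in> S" "smooth_on S f"
  shows "times_differentiable_on k S (\<lambda>x. integral {0..1} (\<lambda>s. s ^ j * f (a + s *\<^sub>R (x - a))))"
  using assms(4)
proof (induction k arbitrary: f j)
  have mem: "a + s *\<^sub>R (x - a) \<in> S" if "x \<in> S" "s \<in> {0..1}" for x s
  proof -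
    have "(1 - s) *\<^sub>R a + s *\<^sub>R x \<in> S"
      using assms(2,3) that by (auto intro: convexD)
    then show ?thesis by (simp add: algebra_simps)
  qed
  let ?I = "\<lambda>j f x. integral {0..1} (\<lambda>s::real. s ^ j * (f (a + s *\<^sub>R (x - a)) :: real))"
  let ?F = "\<lambda>j (f :: 'e \<Rightarrow> real) x s. Blinfun (\<lambda>v. s ^ Suc j * frechet_derivative f (at (a + s *\<^sub>R (x - a))) v)"
  have cont: "continuous_on (S \<times> cbox 0 1) (\<lambda>(x, s). s ^ j * f (a + s *\<^sub>R (x - a)))"
    if "smooth_on S f" for f :: "'e \<Rightarrow> real" and j
    unfolding split_beta
    by (intro continuous_intros
        continuous_on_compose2[OF smooth_on_continuous[OF that], where f="\<lambda>p. a + snd p *\<^sub>R (fst p - a)"])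
       (use mem in auto)
  have int: "(\<lambda>s. s ^ j * f (a + s *\<^sub>R (x - a))) integrable_on {0..1}"
    if "smooth_on S f" "x \<in> S" for f :: "'e \<Rightarrow> real" and j x
    by (intro integrable_continuous_interval continuous_intros
        continuous_on_compose2[OF smooth_on_continuous[OF that(1)], where f="\<lambda>s. a + s *\<^sub>R (x - a)"])
       (use mem that in auto)
  have bl: "bounded_linear (\<lambda>v. s ^ Suc j * frechet_derivative f (at (a + s *\<^sub>R (x - a))) v)"
    if "smooth_on S f" "x \<in> S" "s \<in> {0..1}" for f :: "'e \<Rightarrow> real" and x s j
    using has_derivative_bounded_linear[OF smooth_on_has_derivative[OF that(1) mem[OF that(2,3)]]]
    by (intro bounded_linear_const_mult) 
  have cF: "continuous_on (S \<times> cbox 0 1) (\<lambda>(x, s). ?F j f x s)" if f: "smooth_on S f" for f j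
  proof (rule continuous_on_blinfun_componentwise)
    fix i :: 'e
    show "continuous_on (S \<times> cbox 0 1) (\<lambda>x. blinfun_apply (case x of (x, s) \<Rightarrow> ?F j f x s) i)"
      by (rule continuous_on_eq[OF cont[OF smooth_on_frechet_derivative[OF f, of i], of "Suc j"]])
         (auto simp: bounded_linear_Blinfun_apply bl[OF f] simp del: power_Suc)
  qed
  have d: "(?I j f has_derivative (\<lambda>v. ?I (Suc j) (\<lambda>y. frechet_derivative f (at y) v) x)) (at x)"
    if f: "smooth_on S f" and x: "x \<in> S" for f j x
  proof -
    have L: "((\<lambda>x. integral (cbox 0 1) (\<lambda>s. s ^ j * f (a + s *\<^sub>R (x - a)))) has_derivative
        integral (cbox 0 1) (?F j f x)) (at x within S)"
    proof (rule leibniz_rule[OF _ _ cF[OF f] x assms(2)])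
      fix x s assume xs: "x \<in> S" "s \<in> cbox 0 (1::real)"
      have "((\<lambda>x. s ^ j * f (a + s *\<^sub>R (x - a))) has_derivative
         (\<lambda>v. s ^ j * frechet_derivative f (at (a + s *\<^sub>R (x - a))) (s *\<^sub>R v))) (at x)"
        by (rule has_derivative_mult_right[OF smooth_on_compose_has_derivative[OF f, where g="\<lambda>x. a + s *\<^sub>R (x - a)"]])
           (use xs mem in \<open>auto intro!: derivative_eq_intros\<close>)
      then show "((\<lambda>x. s ^ j * f (a + s *\<^sub>R (x - a))) has_derivative blinfun_apply (?F j f x s)) (at x within S)"
        using xs linear_cmul[OF linear_frechet_derivative_smooth[OF f mem]]
        by (subst bounded_linear_Blinfun_apply[OF bl[OF f]])
           (auto intro: has_derivative_at_withinI simp: mult.assoc mult.left_commute)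
    qed (use int f in auto)
    have E: "blinfun_apply (integral (cbox 0 1) (?F j f x)) v
        = ?I (Suc j) (\<lambda>y. frechet_derivative f (at y) v) x" for v
    proof -
      have p: "continuous_on (cbox 0 1) (\<lambda>s::real. (x, s))"
        by (intro continuous_on_Pair continuous_on_const continuous_on_id)
      have "continuous_on (cbox 0 1) (?F j f x)"
        using continuous_on_compose2[OF cF[OF f, of j] p] x by auto
      then have "?F j f x integrable_on cbox 0 1" by (rule integrable_continuous)
      from integral_linear[OF this, of "\<lambda>h. blinfun_apply h v"]
      have "blinfun_apply (integral (cbox 0 1) (?F j f x)) v = integral (cbox 0 1) (\<lambda>s. blinfun_apply (?F j f x s) v)"
        by (simp add: o_def bounded_linear_blinfun_apply bounded_linear_apply_blinfun)
      also have "\<dots> = ?I (Suc j) (\<lambda>y. frechet_derivative f (at y) v) x"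
        unfolding cbox_interval
        by (rule integral_cong) (use x in \<open>simp add: bounded_linear_Blinfun_apply[OF bl[OF f]] del: power_Suc\<close>)
      finally show ?thesis .
    qed
    show ?thesis
      using L unfolding cbox_interval at_within_open[OF x assms(1)]
      by (rule has_derivative_eq_rhs) (use E[unfolded cbox_interval] in blast)
  qed
  {
    case 0
    then show ?case
      using d by (auto intro!: continuous_at_imp_continuous_on has_derivative_continuous)
  next
    case (Suc k)
    show ?case
      by (rule times_differentiable_on_SucI[OF assms(1) d[OF Suc.prems]])
         (use Suc.IH smooth_on_frechet_derivative[OF Suc.prems] in blast)+
  }
qed

text \<open>Integrate \<open>d/ds f(a + s (x - a))\<close> over the unit interval.\<close>

lemma Hadamard:
  fixes f :: "'e::euclidean_space \<Rightarrow> real"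
  assumes "open S" "convex S" "a \<in> S" "smooth_on S f"
  obtains g where "\<And>b. smooth_on S (g b)" "\<And>b. g b a = frechet_derivative f (at a) b"
    "\<And>x. x \<in> S \<Longrightarrow> f x = f a + (\<Sum>b\<in>Basis. (x \<bullet> b - a \<bullet> b) * g b x)"
proof
  let ?g = "\<lambda>b x. integral {0..1} (\<lambda>s. s ^ 0 * frechet_derivative f (at (a + s *\<^sub>R (x - a))) b)"
  show "smooth_on S (?g b)" for b
    unfolding smooth_on_def
    using times_differentiable_on_averaged[OF assms(1-3) smooth_on_frechet_derivative[OF assms(4)], where j=0] by blast
  show "?g b a = frechet_derivative f (at a) b" for b by simp
  fix x assume x: "x \<in> S"
  have mem: "a + s *\<^sub>R (x - a) \<in> S" if "s \<in> {0..1}" for s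
  proof -
    have "(1 - s) *\<^sub>R a + s *\<^sub>R x \<in> S"
      using assms(2,3) x that by (auto intro: convexD)
    then show ?thesis by (simp add: algebra_simps)
  qed
  let ?D = "\<lambda>s. frechet_derivative f (at (a + s *\<^sub>R (x - a)))"
  have "((\<lambda>s. ?D s (x - a)) has_integral f (a + 1 *\<^sub>R (x - a)) - f (a + 0 *\<^sub>R (x - a))) {0..1}"
  proof (rule fundamental_theorem_of_calculus)
    fix s :: real assume s: "s \<in> {0..1}"
    have "((\<lambda>s. f (a + s *\<^sub>R (x - a))) has_derivative (\<lambda>t. ?D s (t *\<^sub>R (x - a)))) (at s)"
      by (rule smooth_on_compose_has_derivative[OF assms(4), where g="\<lambda>s. a + s *\<^sub>R (x - a)"])
         (use mem s in \<open>auto intro!: derivative_eq_intros\<close>)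
    then show "((\<lambda>s. f (a + s *\<^sub>R (x - a))) has_vector_derivative ?D s (x - a)) (at s within {0..1})"
      using linear_cmul[OF linear_frechet_derivative_smooth[OF assms(4) mem[OF s]]]
      by (auto simp: has_vector_derivative_def intro: has_derivative_at_withinI)
  qed simp
  then have "f x - f a = integral {0..1} (\<lambda>s. ?D s (x - a))"
    by (simp add: integral_unique)
  also have "\<dots> = integral {0..1} (\<lambda>s. \<Sum>b\<in>Basis. (x \<bullet> b - a \<bullet> b) * ?D s b)"
    by (rule integral_cong)
       (subst linear_euclidean_sum[OF linear_frechet_derivative_smooth[OF assms(4) mem]], auto simp: inner_diff_left)
  also have "\<dots> = (\<Sum>b\<in>Basis. integral {0..1} (\<lambda>s. (x \<bullet> b - a \<bullet> b) * ?D s b))"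
    by (intro integral_sum integrable_continuous_interval continuous_intros finite_Basis
        continuous_on_compose2[OF smooth_on_continuous[OF smooth_on_frechet_derivative[OF assms(4)]],
          where f="\<lambda>s. a + s *\<^sub>R (x - a)"])
       (use mem in auto)
  finally show "f x = f a + (\<Sum>b\<in>Basis. (x \<bullet> b - a \<bullet> b) * ?g b x)"
    by simp
qed

text \<open>Used for functions on the total space that are affine along the fibres.\<close>

lemma frechet_derivative_affine_line:
  assumes F: "(F has_derivative F') (at y)" and line: "\<And>s. F (y + s *\<^sub>R v) = F y + s *\<^sub>R c"
  shows "F' v = c"
proof -
  have "((\<lambda>s. F (y + s *\<^sub>R v)) has_derivative (\<lambda>s. F' (s *\<^sub>R v))) (at 0)"
    by (rule has_derivative_compose[of "\<lambda>s. y + s *\<^sub>R v" "\<lambda>s. s *\<^sub>R v" 0 UNIV F F'])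
       (use F in \<open>auto intro!: derivative_eq_intros\<close>)
  moreover have "((\<lambda>s. F (y + s *\<^sub>R v)) has_derivative (\<lambda>s. s *\<^sub>R c)) (at 0)"
    unfolding line by (auto intro!: derivative_eq_intros)
  ultimately have "(\<lambda>s. F' (s *\<^sub>R v)) = (\<lambda>s. s *\<^sub>R c)" by (rule has_derivative_unique)
  then have "F' (1 *\<^sub>R v) = 1 *\<^sub>R c" by (rule fun_cong)
  then show ?thesis by simp
qed


section \<open>Smooth functions on an atlas\<close>

text \<open>The conditions on charts and pairs of charts in \<open>smooth_manifold\<close>. The base satisfies them by assumption, the
  affine charts of its projectivized contact distribution by \<open>affine_chart_transition\<close>.\<close>

locale smooth_atlas =
  fixes A :: "('a, 'e::euclidean_space) chart set"
  assumes inj_chart: "(U, \<phi>) \<in> A \<Longrightarrow> inj_on \<phi> U"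
    and open_transition: "(U, \<phi>) \<in> A \<Longrightarrow> (U', \<phi>') \<in> A \<Longrightarrow> open (\<phi> ` (U \<inter> U'))"
    and smooth_transition: "(U, \<phi>) \<in> A \<Longrightarrow> (U', \<phi>') \<in> A \<Longrightarrow> smooth_on (\<phi> ` (U \<inter> U')) (\<phi>' \<circ> inv_into U \<phi>)"
begin

abbreviation opens :: "'a set \<Rightarrow> bool" where
  "opens \<equiv> openin (atlas_topology A)"

lemma openin_chart_image:
  assumes "opens S" "(U, \<phi>) \<in> A"
  shows "open (\<phi> ` (S \<inter> U))"
proof -
  have inj: "inj_on \<phi> U" and op: "open (\<phi> ` U)"
    using inj_chart open_transition[OF assms(2) assms(2)] assms(2) by auto
  have "generate_topology_on {U \<inter> \<phi> -` G |U \<phi> G. (U, \<phi>) \<in> A \<and> open G} S"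
    using assms(1) by (simp add: atlas_topology_def openin_topology_generated_by_iff)
  then show ?thesis
  proof induction
    case (Int a b)
    have "\<phi> ` (a \<inter> b \<inter> U) = \<phi> ` (a \<inter> U) \<inter> \<phi> ` (b \<inter> U)"
      using inj by (auto simp: inj_on_def)
    then show ?case using Int by auto
  next
    case (UN K)
    have "\<phi> ` (\<Union> K \<inter> U) = (\<Union>k\<in>K. \<phi> ` (k \<inter> U))" by auto
    then show ?case using UN by auto
  next
    case (Basis s)
    then obtain U' \<phi>' G where s: "s = U' \<inter> \<phi>' -` G" "(U', \<phi>') \<in> A" "open G" by auto
    have "\<phi> ` (s \<inter> U) = \<phi> ` (U \<inter> U') \<inter> (\<phi>' \<circ> inv_into U \<phi>) -` G"
      using inj s(1) by (auto simp: inv_into_f_f)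
    then show ?case
      using continuous_on_open_vimage[OF open_transition[OF assms(2) s(2)], THEN iffD1,
          OF smooth_on_continuous[OF smooth_transition[OF assms(2) s(2)]]] s(3)
      by (metis Int_commute)
  qed auto
qed

lemma opens_chart_vimage: "(U, \<phi>) \<in> A \<Longrightarrow> open G \<Longrightarrow> opens (U \<inter> \<phi> -` G)"
  unfolding atlas_topology_def openin_topology_generated_by_iff
  by (rule generate_topology_on.Basis) auto

lemma opens_chart_domain: "(U, \<phi>) \<in> A \<Longrightarrow> opens U"
  using opens_chart_vimage[of U \<phi> UNIV] by simp

lemma opens_chart_inverse:
  assumes "(U, \<phi>) \<in> A" "open G" "G \<subseteq> \<phi> ` U"
  shows "opens (inv_into U \<phi> ` G)"
proof -
  have "inv_into U \<phi> ` G = U \<inter> \<phi> -` G"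
    using assms inj_chart[OF assms(1)]
    by (auto simp: inv_into_into f_inv_into_f subset_iff image_iff) (metis inv_into_f_f)
  then show ?thesis using opens_chart_vimage[OF assms(1,2)] by simp
qed

lemma opens_point_chart:
  assumes "opens S" "p \<in> S"
  obtains U \<phi> where "(U, \<phi>) \<in> A" "p \<in> U"
proof -
  have "p \<in> topspace (atlas_topology A)" using openin_subset assms by blast
  then show ?thesis
    unfolding atlas_topology_def topology_generated_by_topspace using that by auto
qed

text \<open>Smoothness at a point can be tested in any one chart, as the transition maps are smooth.\<close>

lemma smooth_near_chart_iff:
  assumes c: "(U, \<phi>) \<in> A" and p: "p \<in> U"
  shows "smooth_near A p f \<longleftrightarrow>
    (\<exists>G. open G \<and> \<phi> p \<in> G \<and> G \<subseteq> \<phi> ` U \<and> smooth_on G (f \<circ> inv_into U \<phi>))"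
proof
  assume "smooth_near A p f"
  then obtain S where "p \<in> S" "smooth_fun A S f" by (auto simp: smooth_near_def)
  then show "\<exists>G. open G \<and> \<phi> p \<in> G \<and> G \<subseteq> \<phi> ` U \<and> smooth_on G (f \<circ> inv_into U \<phi>)"
    using c p by (intro exI[of _ "\<phi> ` (S \<inter> U)"]) (auto simp: smooth_fun_def openin_chart_image)
next
  assume "\<exists>G. open G \<and> \<phi> p \<in> G \<and> G \<subseteq> \<phi> ` U \<and> smooth_on G (f \<circ> inv_into U \<phi>)"
  then obtain G where G: "open G" "\<phi> p \<in> G" "G \<subseteq> \<phi> ` U" "smooth_on G (f \<circ> inv_into U \<phi>)" by auto
  let ?S = "inv_into U \<phi> ` G"
  have o: "opens ?S" by (rule opens_chart_inverse[OF c G(1,3)])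
  have SU: "?S \<subseteq> U" using G(3) by (auto intro: inv_into_into)
  have "smooth_on (\<phi>' ` (?S \<inter> U')) (f \<circ> inv_into U' \<phi>')" if c': "(U', \<phi>') \<in> A" for U' \<phi>'
  proof -
    let ?T = "\<phi>' ` (?S \<inter> U')"
    have T: "open ?T" by (rule openin_chart_image[OF o c'])
    have s: "smooth_on ?T (\<phi> \<circ> inv_into U' \<phi>')"
      using SU by (intro smooth_on_subset[OF smooth_transition[OF c' c]]) auto
    have "smooth_on ?T (\<lambda>x. (f \<circ> inv_into U \<phi>) ((\<phi> \<circ> inv_into U' \<phi>') x))"
    proof (rule smooth_on_compose[OF G(4) T G(1) s])
      fix x assume "x \<in> ?T"
      then show "(\<phi> \<circ> inv_into U' \<phi>') x \<in> G"
        using G(3) inj_chart[OF c'] by (auto simp: inv_into_f_f f_inv_into_f subset_iff)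
    qed
    then show ?thesis
      by (rule smooth_on_cong[OF _ T])
         (use SU inj_chart[OF c'] inj_chart[OF c] in \<open>auto simp: inv_into_f_f subset_iff\<close>)
  qed
  then have "smooth_fun A ?S f" using o by (auto simp: smooth_fun_def)
  moreover have "p \<in> ?S" using G(2) p inj_chart[OF c] by (metis image_eqI inv_into_f_f)
  ultimately show "smooth_near A p f" by (auto simp: smooth_near_def)
qed

lemma smooth_fun_iff: "smooth_fun A S f \<longleftrightarrow> opens S \<and> (\<forall>p\<in>S. smooth_near A p f)"
proof
  assume r: "opens S \<and> (\<forall>p\<in>S. smooth_near A p f)"
  have "smooth_on (\<phi> ` (S \<inter> U)) (f \<circ> inv_into U \<phi>)" if c: "(U, \<phi>) \<in> A" for U \<phi>
    by (rule smooth_on_local) (use r smooth_near_chart_iff[OF c] in blast)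
  then show "smooth_fun A S f" using r by (auto simp: smooth_fun_def)
qed (auto simp: smooth_fun_def smooth_near_def)

lemma smooth_fun_subset: "smooth_fun A S f \<Longrightarrow> opens T \<Longrightarrow> T \<subseteq> S \<Longrightarrow> smooth_fun A T f"
  by (auto simp: smooth_fun_iff)

lemma smooth_near_opens: "smooth_near A p f \<Longrightarrow> \<exists>S. opens S \<and> p \<in> S \<and> smooth_fun A S f"
  by (auto simp: smooth_near_def smooth_fun_def)

lemma smooth_near_cong:
  assumes "opens S" "p \<in> S" "\<And>q. q \<in> S \<Longrightarrow> f q = g q" "smooth_near A p f"
  shows "smooth_near A p g"
proof -
  obtain U \<phi> where c: "(U, \<phi>) \<in> A" "p \<in> U" using opens_point_chart assms(1,2) by blast
  obtain G where G: "open G" "\<phi> p \<in> G" "G \<subseteq> \<phi> ` U" "smooth_on G (f \<circ> inv_into U \<phi>)"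
    using assms(4) smooth_near_chart_iff[OF c] by auto
  have o: "open (G \<inter> \<phi> ` (S \<inter> U))" using openin_chart_image[OF assms(1) c(1)] G(1) by auto
  have "smooth_on (G \<inter> \<phi> ` (S \<inter> U)) (g \<circ> inv_into U \<phi>)"
    by (rule smooth_on_cong[OF smooth_on_subset[OF G(4)] o])
       (use assms(3) inj_chart[OF c(1)] in \<open>auto simp: inv_into_f_f\<close>)
  then show ?thesis
    unfolding smooth_near_chart_iff[OF c] using o G(2,3) assms(2) c(2) by blast
qed

lemma smooth_near_combine:
  assumes "smooth_near A p f" "smooth_near A p g"
    "\<And>(G :: 'e set) F F'. open G \<Longrightarrow> smooth_on G F \<Longrightarrow> smooth_on G F' \<Longrightarrow> smooth_on G (\<lambda>x. h (F x) (F' x))"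
  shows "smooth_near A p (\<lambda>q. h (f q) (g q))"
proof -
  obtain U \<phi> where c: "(U, \<phi>) \<in> A" "p \<in> U"
    using opens_point_chart smooth_near_opens[OF assms(1)] by blast
  obtain G G' where G: "open G" "\<phi> p \<in> G" "G \<subseteq> \<phi> ` U" "smooth_on G (f \<circ> inv_into U \<phi>)"
    "open G'" "\<phi> p \<in> G'" "smooth_on G' (g \<circ> inv_into U \<phi>)"
    using assms(1,2) smooth_near_chart_iff[OF c] by auto
  have "smooth_on (G \<inter> G') (\<lambda>x. h ((f \<circ> inv_into U \<phi>) x) ((g \<circ> inv_into U \<phi>) x))"
    using G by (intro assms(3) smooth_on_subset[OF G(4)] smooth_on_subset[OF G(7)]) auto
  then show ?thesis
    unfolding smooth_near_chart_iff[OF c] using G by (intro exI[of _ "G \<inter> G'"]) (auto simp: o_def)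
qed

lemma smooth_near_add: "smooth_near A p f \<Longrightarrow> smooth_near A p g \<Longrightarrow> smooth_near A p (\<lambda>q. f q + g q)"
  by (rule smooth_near_combine) (auto intro: smooth_on_add)

lemma smooth_near_mult: "smooth_near A p f \<Longrightarrow> smooth_near A p g \<Longrightarrow> smooth_near A p (\<lambda>q. f q * g q)"
  by (rule smooth_near_combine) (auto intro: smooth_on_mult)

lemma smooth_near_diff: "smooth_near A p f \<Longrightarrow> smooth_near A p g \<Longrightarrow> smooth_near A p (\<lambda>q. f q - g q)"
  by (rule smooth_near_combine) (auto intro: smooth_on_diff)

lemma smooth_near_cmult: "smooth_near A p f \<Longrightarrow> smooth_near A p (\<lambda>q. c * f q)"
  by (rule smooth_near_combine[where g=f and h="\<lambda>x _. c * x"]) (auto intro: smooth_on_mult smooth_on_const)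

lemma smooth_near_const:
  assumes "opens S" "p \<in> S"
  shows "smooth_near A p (\<lambda>q. c)"
proof -
  obtain U \<phi> where c: "(U, \<phi>) \<in> A" "p \<in> U" using opens_point_chart assms by blast
  show ?thesis
    unfolding smooth_near_chart_iff[OF c] using c open_transition[OF c(1) c(1)]
    by (intro exI[of _ "\<phi> ` U"]) (auto simp: o_def intro: smooth_on_const)
qed

lemma smooth_near_sum:
  assumes "opens S" "p \<in> S" "\<And>i. i \<in> I \<Longrightarrow> smooth_near A p (f i)"
  shows "smooth_near A p (\<lambda>q. \<Sum>i\<in>I. f i q)"
  using assms(3)
  by (induction I rule: infinite_finite_induct) (auto intro: smooth_near_add smooth_near_const[OF assms(1,2)])

section \<open>Derivations\<close>

lemma tangent_add: "v \<in> tangent A p \<Longrightarrow> smooth_near A p f \<Longrightarrow> smooth_near A p g \<Longrightarrow> v (\<lambda>q. f q + g q) = v f + v g"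
  and tangent_mult: "v \<in> tangent A p \<Longrightarrow> smooth_near A p f \<Longrightarrow> smooth_near A p g \<Longrightarrow>
    v (\<lambda>q. f q * g q) = f p * v g + g p * v f"
  and tangent_cmult: "v \<in> tangent A p \<Longrightarrow> smooth_near A p f \<Longrightarrow> v (\<lambda>q. c * f q) = c * v f"
  and tangent_not_smooth: "v \<in> tangent A p \<Longrightarrow> \<not> smooth_near A p f \<Longrightarrow> v f = 0"
  by (auto simp: tangent_def)

lemma subspace_tangent: "subspace (tangent A p)"
  unfolding subspace_def
  by (auto simp: tangent_def scaleR_fun_def algebra_simps)

text \<open>A function \<open>h\<close> that vanishes on a neighbourhood \<open>S\<close> of \<open>p\<close> is the product of \<open>h\<close> with the
  indicator function of the complement of \<open>S\<close>, and both factors are smooth near \<open>p\<close> and vanish there.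
  So derivations kill \<open>h\<close> by the product rule.\<close>

lemma tangent_local:
  assumes v: "v \<in> tangent A p" and S: "opens S" "p \<in> S" and eq: "\<And>q. q \<in> S \<Longrightarrow> f q = g q"
    and f: "smooth_near A p f"
  shows "v f = v g"
proof -
  let ?h = "\<lambda>q. f q - g q" and ?i = "\<lambda>q. if q \<in> S then 0 else 1 :: real"
  have g: "smooth_near A p g" by (rule smooth_near_cong[OF S eq f])
  have h: "smooth_near A p ?h" by (rule smooth_near_diff[OF f g])
  have i: "smooth_near A p ?i" by (rule smooth_near_cong[OF S _ smooth_near_const[OF S]]) auto
  have "?h = (\<lambda>q. ?h q * ?i q)" using eq by auto
  then have "v ?h = v (\<lambda>q. ?h q * ?i q)" by (rule arg_cong)
  also have "\<dots> = 0" using tangent_mult[OF v h i] eq[OF S(2)] S(2) by simp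
  finally have "v ?h = 0" .
  moreover have "v (\<lambda>q. g q + ?h q) = v g + v ?h" by (rule tangent_add[OF v g h])
  ultimately show ?thesis by simp
qed

lemma tangent_const:
  assumes v: "v \<in> tangent A p" and S: "opens S" "p \<in> S"
  shows "v (\<lambda>q. c) = 0"
proof -
  have "v (\<lambda>q. 1 * 1) = 1 * v (\<lambda>q. 1) + 1 * v (\<lambda>q. 1)"
    by (rule tangent_mult[OF v smooth_near_const[OF S] smooth_near_const[OF S]])
  then have "v (\<lambda>q. 1) = 0" by simp
  then show ?thesis using tangent_cmult[OF v smooth_near_const[OF S], of c 1] by simp
qed

lemma tangent_sum:
  assumes v: "v \<in> tangent A p" and S: "opens S" "p \<in> S" and "\<And>i. i \<in> I \<Longrightarrow> smooth_near A p (f i)"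
  shows "v (\<lambda>q. \<Sum>i\<in>I. f i q) = (\<Sum>i\<in>I. v (f i))"
  using assms(4)
proof (induction I rule: infinite_finite_induct)
  case (insert i I)
  then show ?case
    using tangent_add[OF v, of "f i" "\<lambda>q. \<Sum>i\<in>I. f i q"] smooth_near_sum[OF S, of I f] by auto
qed (auto simp: tangent_const[OF v S])

lemma vector_field_tangent: "vector_field A S X \<Longrightarrow> p \<in> S \<Longrightarrow> X p \<in> tangent A p"
  by (auto simp: vector_field_def)

lemma vector_field_opens: "vector_field A S X \<Longrightarrow> opens S"
  by (auto simp: vector_field_def)

lemma vector_field_subset: "vector_field A S X \<Longrightarrow> opens T \<Longrightarrow> T \<subseteq> S \<Longrightarrow> vector_field A T X"
  by (auto simp: vector_field_def)

lemma vector_field_smooth_near: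
  assumes "vector_field A S X" "p \<in> S" "smooth_near A p f"
  shows "smooth_near A p (\<lambda>q. X q f)"
proof -
  obtain T where T: "opens T" "p \<in> T" "smooth_fun A T f" using smooth_near_opens assms(3) by blast
  have "smooth_fun A (S \<inter> T) f"
    using T vector_field_opens[OF assms(1)] by (auto intro: smooth_fun_subset)
  then have "smooth_fun A (S \<inter> T) (\<lambda>q. X q f)" using assms(1) by (auto simp: vector_field_def)
  then show ?thesis using T assms(2) by (auto simp: smooth_near_def)
qed

lemma vector_fieldI:
  assumes "opens S" "\<And>p. p \<in> S \<Longrightarrow> X p \<in> tangent A p"
    "\<And>p f. p \<in> S \<Longrightarrow> smooth_near A p f \<Longrightarrow> smooth_near A p (\<lambda>q. X q f)"
  shows "vector_field A S X"
  using assms by (auto simp: vector_field_def smooth_fun_iff)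

lemma one_form_subset: "one_form A S \<omega> \<Longrightarrow> opens T \<Longrightarrow> T \<subseteq> S \<Longrightarrow> one_form A T \<omega>"
  unfolding one_form_def by blast

lemma one_form_linear:
  "one_form A S \<omega> \<Longrightarrow> p \<in> S \<Longrightarrow> u \<in> tangent A p \<Longrightarrow> v \<in> tangent A p \<Longrightarrow>
    \<omega> p (a *\<^sub>R u + b *\<^sub>R v) = a * \<omega> p u + b * \<omega> p v"
  unfolding one_form_def by blast

lemma bracket_anticommute: "bracket A Y X p = - bracket A X Y p"
  by (auto simp: bracket_def fun_eq_iff)

lemma bracket_tangent:
  assumes X: "vector_field A S X" and Y: "vector_field A S Y" and p: "p \<in> S"
  shows "bracket A X Y p \<in> tangent A p"
proof -
  note S = vector_field_opens[OF X]
  have *: "Z p (\<lambda>q. Z' q (\<lambda>q. f q * g q)) = Z p f * Z' p g + f p * Z p (\<lambda>q. Z' q g) + Z p g * Z' p f + g p * Z p (\<lambda>q. Z' q f)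
    \<and> Z p (\<lambda>q. Z' q (\<lambda>q. f q + g q)) = Z p (\<lambda>q. Z' q f) + Z p (\<lambda>q. Z' q g)
    \<and> Z p (\<lambda>q. Z' q (\<lambda>q. c * f q)) = c * Z p (\<lambda>q. Z' q f)"
    if Z: "vector_field A S Z" and Z': "vector_field A S Z'" and f: "smooth_near A p f" and g: "smooth_near A p g" for Z Z' f g c
  proof -
    obtain T where T: "opens T" "p \<in> T" "\<forall>q\<in>T. smooth_near A q f"
      using smooth_near_opens[OF f] by (auto simp: smooth_fun_iff)
    obtain T' where T': "opens T'" "p \<in> T'" "\<forall>q\<in>T'. smooth_near A q g"
      using smooth_near_opens[OF g] by (auto simp: smooth_fun_iff)
    let ?R = "S \<inter> T \<inter> T'"
    have R: "opens ?R" "p \<in> ?R" using S T T' p by auto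
    note Zp = vector_field_tangent[OF Z p]
    have Z'q: "Z' q \<in> tangent A q" if "q \<in> ?R" for q using vector_field_tangent[OF Z'] that by auto
    note sm = vector_field_smooth_near[OF Z' p]
    have "Z p (\<lambda>q. Z' q (\<lambda>q. f q * g q)) = Z p (\<lambda>q. f q * Z' q g + g q * Z' q f)"
      by (rule tangent_local[OF Zp R])
         (use T T' f g in \<open>auto intro!: tangent_mult[OF Z'q] sm smooth_near_mult\<close>)
    also have "\<dots> = Z p (\<lambda>q. f q * Z' q g) + Z p (\<lambda>q. g q * Z' q f)"
      by (intro tangent_add[OF Zp] smooth_near_mult sm f g)
    also have "\<dots> = f p * Z p (\<lambda>q. Z' q g) + Z' p g * Z p f + (g p * Z p (\<lambda>q. Z' q f) + Z' p f * Z p g)"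
      by (simp add: tangent_mult[OF Zp] sm f g)
    moreover have "Z p (\<lambda>q. Z' q (\<lambda>q. f q + g q)) = Z p (\<lambda>q. Z' q f + Z' q g)"
      by (rule tangent_local[OF Zp R])
         (use T T' f g in \<open>auto intro!: tangent_add[OF Z'q] sm smooth_near_add\<close>)
    moreover have "\<dots> = Z p (\<lambda>q. Z' q f) + Z p (\<lambda>q. Z' q g)"
      by (intro tangent_add[OF Zp] sm f g)
    moreover have "Z p (\<lambda>q. Z' q (\<lambda>q. c * f q)) = Z p (\<lambda>q. c * Z' q f)"
      by (rule tangent_local[OF Zp R])
         (use T T' f g in \<open>auto intro!: tangent_cmult[OF Z'q] sm smooth_near_cmult\<close>)
    moreover have "\<dots> = c * Z p (\<lambda>q. Z' q f)"
      by (intro tangent_cmult[OF Zp] sm f g)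
    ultimately show ?thesis by simp
  qed
  show ?thesis
    unfolding tangent_def bracket_def
    using *[OF X Y] *[OF Y X]
    by (auto simp: smooth_near_add smooth_near_mult smooth_near_cmult algebra_simps)
qed

lemma bracket_vector_field:
  assumes X: "vector_field A S X" and Y: "vector_field A S Y"
  shows "vector_field A S (bracket A X Y)"
proof (rule vector_fieldI[OF vector_field_opens[OF X] bracket_tangent[OF X Y]])
  fix p f assume p: "p \<in> S" and f: "smooth_near A p f"
  obtain T where T: "opens T" "p \<in> T" "\<forall>q\<in>T. smooth_near A q f"
    using smooth_near_opens[OF f] by (auto simp: smooth_fun_iff)
  show "smooth_near A p (\<lambda>q. bracket A X Y q f)"
    by (rule smooth_near_cong[OF T(1,2), of "\<lambda>q. X q (\<lambda>q. Y q f) - Y q (\<lambda>q. X q f)"])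
       (use T in \<open>auto simp: bracket_def intro!: smooth_near_diff vector_field_smooth_near[OF X p]
          vector_field_smooth_near[OF Y p] f\<close>)
qed

end

section \<open>Coordinate expressions\<close>

locale coordinates = smooth_atlas A for A :: "('a, 'e::euclidean_space) chart set" +
  fixes U :: "'a set" and \<phi> :: "'a \<Rightarrow> 'e"
  assumes chart: "(U, \<phi>) \<in> A"
begin

abbreviation \<iota> :: "'e \<Rightarrow> 'a" where "\<iota> \<equiv> inv_into U \<phi>"

text \<open>The directional derivative along \<open>w\<close> in the chart, with the convention of \<open>tangent\<close> for functions that are not
  smooth near \<open>p\<close>.\<close>

definition tangent_of :: "'a \<Rightarrow> 'e \<Rightarrow> 'a tvec" where
  "tangent_of p w = (\<lambda>f. if smooth_near A p f then frechet_derivative (f \<circ> \<iota>) (at (\<phi> p)) w else 0)"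

definition components :: "'a tvec \<Rightarrow> 'e" where
  "components v = (\<Sum>b\<in>Basis. v (\<lambda>q. \<phi> q \<bullet> b) *\<^sub>R b)"

definition field_rep :: "('a \<Rightarrow> 'a tvec) \<Rightarrow> 'e \<Rightarrow> 'e" where
  "field_rep X u = components (X (\<iota> u))"

definition form_rep :: "('a \<Rightarrow> 'a tvec \<Rightarrow> real) \<Rightarrow> 'e \<Rightarrow> 'e" where
  "form_rep \<omega> u = (\<Sum>b\<in>Basis. \<omega> (\<iota> u) (tangent_of (\<iota> u) b) *\<^sub>R b)"

lemma inverse_chart [simp]: "p \<in> U \<Longrightarrow> \<iota> (\<phi> p) = p"
  using inj_chart[OF chart] by (rule inv_into_f_f)

lemma chart_inverse [simp]: "u \<in> \<phi> ` U \<Longrightarrow> \<phi> (\<iota> u) = u"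
  by (rule f_inv_into_f)

lemma opens_domain: "opens U" by (rule opens_chart_domain[OF chart])

lemma open_image: "opens S \<Longrightarrow> open (\<phi> ` (S \<inter> U))" by (rule openin_chart_image[OF _ chart])

lemma smooth_nearD:
  assumes "smooth_near A p f" "p \<in> U"
  obtains G where "open G" "\<phi> p \<in> G" "G \<subseteq> \<phi> ` U" "smooth_on G (f \<circ> \<iota>)"
  using assms smooth_near_chart_iff[OF chart] by blast

lemma smooth_nearI:
  assumes "p \<in> U" "open G" "\<phi> p \<in> G" "G \<subseteq> \<phi> ` U" "smooth_on G F" "\<And>u. u \<in> G \<Longrightarrow> f (\<iota> u) = F u"
  shows "smooth_near A p f"
  unfolding smooth_near_chart_iff[OF chart assms(1)]
  by (rule exI[of _ G]) (use assms smooth_on_cong[OF assms(5,2), of "f \<circ> \<iota>"] in auto)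

lemma smooth_near_coordinate: "p \<in> U \<Longrightarrow> smooth_near A p (\<lambda>q. \<phi> q \<bullet> b)"
  by (rule smooth_nearI[where G="\<phi> ` U" and F="\<lambda>u. u \<bullet> b"])
     (use open_image[OF opens_domain] in \<open>auto intro!: smooth_intros\<close>)

lemma linear_tangent_of:
  assumes "p \<in> U"
  shows "linear (tangent_of p)"
proof (rule linearI)
  have *: "linear (frechet_derivative (f \<circ> \<iota>) (at (\<phi> p)))" if "smooth_near A p f" for f
    by (rule smooth_nearD[OF that assms]) (auto intro: linear_frechet_derivative_smooth)
  show "tangent_of p (v + w) = tangent_of p v + tangent_of p w" for v w
    by (auto simp: tangent_of_def fun_eq_iff linear_add[OF *])
  show "tangent_of p (c *\<^sub>R v) = c *\<^sub>R tangent_of p v" for c v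
    by (auto simp: tangent_of_def fun_eq_iff scaleR_fun_def linear_cmul[OF *])
qed

lemma linear_components: "linear components"
  by (rule linearI) (auto simp: components_def scaleR_fun_def algebra_simps sum.distrib scaleR_sum_right)

lemma components_inner: "b \<in> Basis \<Longrightarrow> components v \<bullet> b = v (\<lambda>q. \<phi> q \<bullet> b)"
  by (simp add: components_def)

lemma components_zero [simp]: "components 0 = 0" and components_add: "components (v + w) = components v + components w"
  and components_diff: "components (v - w) = components v - components w"
  and components_scaleR: "components (c *\<^sub>R v) = c *\<^sub>R components v"
  using linear_components by (auto simp: linear_0 linear_add linear_diff linear_cmul)

lemma tangent_of_tangent:
  assumes p: "p \<in> U"
  shows "tangent_of p w \<in> tangent A p"
proof -
  let ?D = "\<lambda>f. frechet_derivative f (at (\<phi> p)) w"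
  have d: "(f \<circ> \<iota> has_derivative frechet_derivative (f \<circ> \<iota>) (at (\<phi> p))) (at (\<phi> p))"
    if "smooth_near A p f" for f
    by (rule smooth_nearD[OF that p]) (rule smooth_on_has_derivative)
  have "?D ((\<lambda>q. f q + g q) \<circ> \<iota>) = ?D (f \<circ> \<iota>) + ?D (g \<circ> \<iota>)"
    "?D ((\<lambda>q. f q * g q) \<circ> \<iota>) = f p * ?D (g \<circ> \<iota>) + g p * ?D (f \<circ> \<iota>)"
    if "smooth_near A p f" "smooth_near A p g" for f g
    using frechet_derivative_eqI[OF has_derivative_add[OF d[OF that(1)] d[OF that(2)]]]
      frechet_derivative_eqI[OF has_derivative_mult[OF d[OF that(1)] d[OF that(2)]]] p
    by (auto simp: o_def)
  moreover have "?D ((\<lambda>q. c * f q) \<circ> \<iota>) = c * ?D (f \<circ> \<iota>)" if "smooth_near A p f" for f c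
    using frechet_derivative_eqI[OF has_derivative_mult_right[OF d[OF that]]] by (auto simp: o_def)
  ultimately show ?thesis
    by (auto simp: tangent_def tangent_of_def smooth_near_add smooth_near_mult smooth_near_cmult)
qed

lemma frechet_derivative_inner_left:
  fixes F :: "'e \<Rightarrow> 'g::euclidean_space"
  assumes "(F has_derivative F') (at u)"
  shows "frechet_derivative (\<lambda>u. F u \<bullet> b) (at u) w = F' w \<bullet> b"
  using frechet_derivative_eqI[OF has_derivative_inner_left[OF assms]] by metis

lemma components_tangent_of [simp]:
  assumes "p \<in> U"
  shows "components (tangent_of p w) = w"
proof -
  have "tangent_of p w (\<lambda>q. \<phi> q \<bullet> b) = w \<bullet> b" for b
  proof -
    have "frechet_derivative ((\<lambda>q. \<phi> q \<bullet> b) \<circ> \<iota>) (at (\<phi> p)) = frechet_derivative (\<lambda>u. u \<bullet> b) (at (\<phi> p))"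
      by (rule frechet_derivative_cong_open[OF open_image[OF opens_domain]]) (use assms in auto)
    moreover have "frechet_derivative (\<lambda>u. u \<bullet> b) (at (\<phi> p)) w = w \<bullet> b"
      by (rule frechet_derivative_inner_left) (rule has_derivative_ident)
    ultimately show ?thesis by (simp add: tangent_of_def smooth_near_coordinate assms)
  qed
  then show ?thesis by (simp add: components_def euclidean_representation)
qed

text \<open>Every derivation is a directional derivative in the chart: by Hadamard's lemma, modulo
  constants a function is a combination of the coordinates with smooth coefficients.\<close>

lemma tangent_of_components [simp]:
  assumes p: "p \<in> U" and v: "v \<in> tangent A p"
  shows "tangent_of p (components v) = v"
proof
  fix f
  show "tangent_of p (components v) f = v f"
  proof (cases "smooth_near A p f")
    case False
    then show ?thesis using tangent_not_smooth[OF v] by (simp add: tangent_of_def)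
  next
    case True
    obtain G where G: "open G" "\<phi> p \<in> G" "G \<subseteq> \<phi> ` U" "smooth_on G (f \<circ> \<iota>)"
      using smooth_nearD[OF True p] .
    obtain r where r: "r > 0" "ball (\<phi> p) r \<subseteq> G" using G(1,2) open_contains_ball by blast
    let ?B = "ball (\<phi> p) r"
    have sm: "smooth_on ?B (f \<circ> \<iota>)" using smooth_on_subset[OF G(4) r(2)] .
    have pB: "\<phi> p \<in> ?B" using r by simp
    obtain g where g: "\<And>b. smooth_on ?B (g b)" "\<And>b. g b (\<phi> p) = frechet_derivative (f \<circ> \<iota>) (at (\<phi> p)) b"
      "\<And>x. x \<in> ?B \<Longrightarrow> (f \<circ> \<iota>) x = (f \<circ> \<iota>) (\<phi> p) + (\<Sum>b\<in>Basis. (x \<bullet> b - \<phi> p \<bullet> b) * g b x)"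
      using Hadamard[OF open_ball convex_ball pB sm] by blast
    let ?S = "\<iota> ` ?B"
    have BU: "?B \<subseteq> \<phi> ` U" using r G(3) by blast
    have S: "opens ?S" "p \<in> ?S"
      using opens_chart_inverse[OF chart open_ball BU] pB p by (auto, metis imageI inverse_chart pB)
    have sg: "smooth_near A p (\<lambda>q. g b (\<phi> q))" for b
      by (rule smooth_nearI[OF p open_ball pB BU g(1)]) (use BU in auto)
    have sc: "smooth_near A p (\<lambda>q. \<phi> q \<bullet> b - \<phi> p \<bullet> b)" for b
      by (intro smooth_near_diff smooth_near_coordinate p smooth_near_const[OF S])
    have vc: "v (\<lambda>q. \<phi> q \<bullet> b - \<phi> p \<bullet> b) = v (\<lambda>q. \<phi> q \<bullet> b)" for b
      using tangent_add[OF v smooth_near_coordinate[OF p] smooth_near_const[OF S], of b "- (\<phi> p \<bullet> b)"]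
        tangent_const[OF v S] by simp
    have ss: "smooth_near A p (\<lambda>q. \<Sum>b\<in>Basis. (\<phi> q \<bullet> b - \<phi> p \<bullet> b) * g b (\<phi> q))"
      by (intro smooth_near_sum[OF S] smooth_near_mult sc sg)
    have "v f = v (\<lambda>q. f p + (\<Sum>b\<in>Basis. (\<phi> q \<bullet> b - \<phi> p \<bullet> b) * g b (\<phi> q)))"
    proof (rule tangent_local[OF v S _ True])
      fix q assume "q \<in> ?S"
      then obtain u where "u \<in> ?B" "q = \<iota> u" by blast
      then show "f q = f p + (\<Sum>b\<in>Basis. (\<phi> q \<bullet> b - \<phi> p \<bullet> b) * g b (\<phi> q))"
        using g(3)[of u] BU p by (auto simp: subset_iff)
    qed
    also have "\<dots> = v (\<lambda>q. \<Sum>b\<in>Basis. (\<phi> q \<bullet> b - \<phi> p \<bullet> b) * g b (\<phi> q))"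
      using tangent_add[OF v smooth_near_const[OF S] ss, of "f p"] tangent_const[OF v S] by simp
    also have "\<dots> = (\<Sum>b\<in>Basis. v (\<lambda>q. (\<phi> q \<bullet> b - \<phi> p \<bullet> b) * g b (\<phi> q)))"
      by (intro tangent_sum[OF v S] smooth_near_mult sc sg)
    also have "\<dots> = (\<Sum>b\<in>Basis. (components v \<bullet> b) *\<^sub>R frechet_derivative (f \<circ> \<iota>) (at (\<phi> p)) b)"
      by (intro sum.cong) (auto simp: tangent_mult[OF v sc sg] vc g(2) components_def)
    also have "\<dots> = tangent_of p (components v) f"
      using linear_euclidean_sum[OF linear_frechet_derivative_smooth[OF G(4,2)], of "components v"] True
      by (simp add: tangent_of_def)
    finally show ?thesis by simp
  qed
qed

lemma components_eq_iff:
  "p \<in> U \<Longrightarrow> v \<in> tangent A p \<Longrightarrow> w \<in> tangent A p \<Longrightarrow> components v = components w \<longleftrightarrow> v = w"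
  by (metis tangent_of_components)

lemma tangent_apply:
  "p \<in> U \<Longrightarrow> v \<in> tangent A p \<Longrightarrow> smooth_near A p f \<Longrightarrow>
    v f = frechet_derivative (f \<circ> \<iota>) (at (\<phi> p)) (components v)"
  by (metis tangent_of_components tangent_of_def)

lemma smooth_field_rep:
  assumes "vector_field A S X"
  shows "smooth_on (\<phi> ` (S \<inter> U)) (field_rep X)"
proof -
  note S = vector_field_opens[OF assms]
  have "smooth_on (\<phi> ` (S \<inter> U)) (\<lambda>u. X (\<iota> u) (\<lambda>q. \<phi> q \<bullet> b))" for b
  proof -
    have "smooth_fun A (S \<inter> U) (\<lambda>q. X q (\<lambda>q. \<phi> q \<bullet> b))"
      using S opens_domain smooth_near_coordinate vector_field_smooth_near[OF assms] by (auto simp: smooth_fun_iff)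
    then have "smooth_on (\<phi> ` (S \<inter> U \<inter> U)) ((\<lambda>q. X q (\<lambda>q. \<phi> q \<bullet> b)) \<circ> \<iota>)"
      using chart unfolding smooth_fun_def by blast
    then show ?thesis by (simp add: o_def Int_assoc)
  qed
  then show ?thesis
    unfolding field_rep_def[abs_def] components_def using open_image[OF S]
    by (intro smooth_intros) auto
qed

lemma vector_field_of_rep:
  assumes S: "opens S" "S \<subseteq> U" and Y: "smooth_on (\<phi> ` S) Y"
  shows "vector_field A S (\<lambda>q. tangent_of q (Y (\<phi> q)))"
proof (rule vector_fieldI[OF S(1)])
  show "tangent_of p (Y (\<phi> p)) \<in> tangent A p" if "p \<in> S" for p using tangent_of_tangent S that by auto
next
  fix p f assume p: "p \<in> S" and f: "smooth_near A p f"
  have pU: "p \<in> U" using p S by auto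
  obtain G where G: "open G" "\<phi> p \<in> G" "G \<subseteq> \<phi> ` U" "smooth_on G (f \<circ> \<iota>)"
    using smooth_nearD[OF f pU] .
  let ?G = "G \<inter> \<phi> ` S"
  have "open (G \<inter> \<phi> ` (S \<inter> U))" by (intro open_Int G(1) open_image[OF S(1)])
  then have o: "open ?G" using Int_absorb2[OF S(2)] by simp
  show "smooth_near A p (\<lambda>q. tangent_of q (Y (\<phi> q)) f)"
  proof (rule smooth_nearI[OF pU o])
    show "smooth_on ?G (\<lambda>u. frechet_derivative (f \<circ> \<iota>) (at u) (Y u))"
      by (intro smooth_on_directional_derivative o smooth_on_subset[OF G(4)] smooth_on_subset[OF Y]) auto
    fix u assume u: "u \<in> ?G"
    then have "smooth_near A (\<iota> u) f"
      using G by (intro smooth_nearI[OF _ G(1) _ G(3) G(4)]) (auto intro: inv_into_into)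
    moreover have "u \<in> \<phi> ` U" using u S by auto
    ultimately show "tangent_of (\<iota> u) (Y (\<phi> (\<iota> u))) f = frechet_derivative (f \<circ> \<iota>) (at u) (Y u)"
      by (simp add: tangent_of_def)
  qed (use p G in auto)
qed

lemma field_rep_at: "p \<in> U \<Longrightarrow> field_rep X (\<phi> p) = components (X p)"
  by (simp add: field_rep_def)

lemma form_eq_rep:
  assumes "one_form A S \<omega>" "p \<in> S \<inter> U" "v \<in> tangent A p"
  shows "\<omega> p v = form_rep \<omega> (\<phi> p) \<bullet> components v"
proof -
  have lin: "\<omega> p (\<Sum>b\<in>I. c b *\<^sub>R tangent_of p b) = (\<Sum>b\<in>I. c b * \<omega> p (tangent_of p b))" if "finite I" for I c
    using that
  proof induction
    case empty
    have "\<omega> p (0 *\<^sub>R v + 0 *\<^sub>R v) = 0"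
      using one_form_linear[OF assms(1) _ assms(3,3), of 0 0] assms(2) by simp
    then show ?case by (simp only: sum.empty scaleR_zero_left add_0_left)
  next
    case (insert b I)
    have "(\<Sum>b\<in>I. c b *\<^sub>R tangent_of p b) \<in> tangent A p"
      using assms(2) by (intro subspace_sum subspace_scale subspace_tangent tangent_of_tangent) auto
    then have "\<omega> p (c b *\<^sub>R tangent_of p b + (\<Sum>b\<in>I. c b *\<^sub>R tangent_of p b)) =
        c b * \<omega> p (tangent_of p b) + \<omega> p (\<Sum>b\<in>I. c b *\<^sub>R tangent_of p b)"
      using one_form_linear[of S \<omega> p "tangent_of p b" "\<Sum>b\<in>I. c b *\<^sub>R tangent_of p b" "c b" 1]
        tangent_of_tangent assms(1,2) by auto
    then show ?case unfolding sum.insert[OF insert(1,2)] insert(3) .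
  qed
  have "v = tangent_of p (components v)" using assms by simp
  also have "\<dots> = (\<Sum>b\<in>Basis. (components v \<bullet> b) *\<^sub>R tangent_of p b)"
    using linear_euclidean_sum[OF linear_tangent_of] assms(2) by blast
  finally have "\<omega> p v = \<omega> p (\<Sum>b\<in>Basis. (components v \<bullet> b) *\<^sub>R tangent_of p b)" by (rule arg_cong)
  also have "\<dots> = (\<Sum>b\<in>Basis. (components v \<bullet> b) * \<omega> p (tangent_of p b))" by (rule lin) simp
  also have "\<dots> = form_rep \<omega> (\<phi> p) \<bullet> components v"
    using assms(2) by (simp add: form_rep_def inner_sum_left mult.commute inner_commute[of "components v"])
  finally show ?thesis .
qed

lemma smooth_form_rep:
  assumes "one_form A S \<omega>"
  shows "smooth_on (\<phi> ` (S \<inter> U)) (form_rep \<omega>)"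
proof -
  have S: "opens S" using assms by (simp add: one_form_def)
  have o: "open (\<phi> ` (S \<inter> U))" by (rule open_image[OF S])
  have "smooth_on (\<phi> ` (S \<inter> U)) (\<lambda>u. \<omega> (\<iota> u) (tangent_of (\<iota> u) b))" for b
  proof -
    have "vector_field A (S \<inter> U) (\<lambda>q. tangent_of q b)"
      by (rule vector_field_of_rep[where Y="\<lambda>_. b"]) (use S opens_domain o in \<open>auto intro!: smooth_intros\<close>)
    then have "smooth_fun A (S \<inter> U) (\<lambda>q. \<omega> q (tangent_of q b))"
      using assms unfolding one_form_def by (metis inf_le1)
    then have "smooth_on (\<phi> ` (S \<inter> U \<inter> U)) ((\<lambda>q. \<omega> q (tangent_of q b)) \<circ> \<iota>)"
      using chart unfolding smooth_fun_def by blast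
    then show ?thesis by (simp add: o_def Int_assoc)
  qed
  then show ?thesis unfolding form_rep_def[abs_def] using o by (intro smooth_intros) auto
qed

lemma one_form_of_rep:
  assumes S: "opens S" "S \<subseteq> U" and w: "smooth_on (\<phi> ` S) w"
  shows "one_form A S (\<lambda>q v. w (\<phi> q) \<bullet> components v)"
proof -
  have "smooth_fun A T (\<lambda>p. w (\<phi> p) \<bullet> components (X p))" if T: "T \<subseteq> S" and X: "vector_field A T X" for T X
  proof -
    note o = vector_field_opens[OF X]
    have TU: "T \<inter> U = T" using T S by auto
    have "smooth_on (\<phi> ` T) (\<lambda>u. w u \<bullet> field_rep X u)"
      using smooth_field_rep[OF X] open_image[OF o] T
      by (intro smooth_intros smooth_on_subset[OF w]) (auto simp: TU)
    then show ?thesis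
      using T S o open_image[OF o] unfolding smooth_fun_iff
      by (auto simp: TU field_rep_def intro!: smooth_nearI[where G="\<phi> ` T" and F="\<lambda>u. w u \<bullet> field_rep X u"])
  qed
  then show ?thesis
    using S(1) by (auto simp: one_form_def components_add components_scaleR inner_add_right)
qed

lemma form_rep_of_rep [simp]: "u \<in> \<phi> ` U \<Longrightarrow> form_rep (\<lambda>q v. w (\<phi> q) \<bullet> components v) u = w u"
  by (auto simp: form_rep_def inv_into_into euclidean_representation)

lemma components_bracket:
  assumes X: "vector_field A S X" and Y: "vector_field A S Y" and p: "p \<in> S \<inter> U"
  shows "components (bracket A X Y p) =
    frechet_derivative (field_rep Y) (at (\<phi> p)) (components (X p)) -
    frechet_derivative (field_rep X) (at (\<phi> p)) (components (Y p))"
proof -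
  have *: "Z p (\<lambda>q. Z' q (\<lambda>q. \<phi> q \<bullet> b)) = frechet_derivative (field_rep Z') (at (\<phi> p)) (components (Z p)) \<bullet> b"
    if Z: "vector_field A S Z" and Z': "vector_field A S Z'" and b: "b \<in> Basis" for Z Z' b
  proof -
    have "Z p (\<lambda>q. Z' q (\<lambda>q. \<phi> q \<bullet> b)) =
        frechet_derivative ((\<lambda>q. Z' q (\<lambda>q. \<phi> q \<bullet> b)) \<circ> \<iota>) (at (\<phi> p)) (components (Z p))"
      using p vector_field_tangent[OF Z] by (intro tangent_apply vector_field_smooth_near[OF Z'] smooth_near_coordinate) auto
    also have "(\<lambda>q. Z' q (\<lambda>q. \<phi> q \<bullet> b)) \<circ> \<iota> = (\<lambda>u. field_rep Z' u \<bullet> b)"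
      using b by (auto simp: field_rep_def components_def)
    also have "frechet_derivative \<dots> (at (\<phi> p)) (components (Z p)) =
        frechet_derivative (field_rep Z') (at (\<phi> p)) (components (Z p)) \<bullet> b"
      by (rule frechet_derivative_inner_left[OF smooth_on_has_derivative[OF smooth_field_rep[OF Z']]]) (use p in auto)
    finally show ?thesis .
  qed
  have br: "bracket A X Y p (\<lambda>q. \<phi> q \<bullet> b) = X p (\<lambda>q. Y q (\<lambda>q. \<phi> q \<bullet> b)) - Y p (\<lambda>q. X q (\<lambda>q. \<phi> q \<bullet> b))" for b
    using p by (simp add: bracket_def smooth_near_coordinate)
  show ?thesis
    by (rule euclidean_eqI) (simp add: components_inner br *[OF X Y] *[OF Y X] inner_diff_left)
qed

lemma field_derivative_form:
  assumes Z: "vector_field A S Z" and Z': "vector_field A S Z'" and w: "one_form A S \<omega>" and p: "p \<in> S \<inter> U"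
  shows "Z p (\<lambda>q. \<omega> q (Z' q)) =
    frechet_derivative (form_rep \<omega>) (at (\<phi> p)) (components (Z p)) \<bullet> components (Z' p) +
    form_rep \<omega> (\<phi> p) \<bullet> frechet_derivative (field_rep Z') (at (\<phi> p)) (components (Z p))"
proof -
  have S: "opens S" using w by (simp add: one_form_def)
  have "smooth_fun A S (\<lambda>q. \<omega> q (Z' q))" using w Z' by (auto simp: one_form_def)
  then have "Z p (\<lambda>q. \<omega> q (Z' q)) = frechet_derivative ((\<lambda>q. \<omega> q (Z' q)) \<circ> \<iota>) (at (\<phi> p)) (components (Z p))"
    using p vector_field_tangent[OF Z] by (intro tangent_apply) (auto simp: smooth_fun_iff)
  also have "frechet_derivative ((\<lambda>q. \<omega> q (Z' q)) \<circ> \<iota>) (at (\<phi> p)) =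
      frechet_derivative (\<lambda>u. form_rep \<omega> u \<bullet> field_rep Z' u) (at (\<phi> p))"
    by (rule frechet_derivative_cong_open[OF open_image[OF S]])
       (use p form_eq_rep[OF w] vector_field_tangent[OF Z'] in \<open>auto simp: field_rep_def\<close>)
  also have "\<dots> = (\<lambda>h. form_rep \<omega> (\<phi> p) \<bullet> frechet_derivative (field_rep Z') (at (\<phi> p)) h +
      frechet_derivative (form_rep \<omega>) (at (\<phi> p)) h \<bullet> field_rep Z' (\<phi> p))"
    by (rule frechet_derivative_eqI[OF has_derivative_inner[OF
          smooth_on_has_derivative[OF smooth_form_rep[OF w]] smooth_on_has_derivative[OF smooth_field_rep[OF Z']]]])
       (use p in auto)
  finally show ?thesis using p by (simp add: field_rep_at)
qed

text \<open>Of the derivatives of the two fields, those produced by differentiating \<open>\<omega>(Y)\<close> and \<open>\<omega>(X)\<close> are cancelled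
  by the bracket. Only the derivative of \<open>\<omega>\<close> remains, so the value depends on the fields at the point alone,
  which is what makes \<open>ext_deriv\<close> well defined.\<close>

lemma exterior_derivative_formula:
  assumes X: "vector_field A S X" and Y: "vector_field A S Y" and w: "one_form A S \<omega>" and p: "p \<in> S \<inter> U"
  shows "X p (\<lambda>q. \<omega> q (Y q)) - Y p (\<lambda>q. \<omega> q (X q)) - \<omega> p (bracket A X Y p) =
    frechet_derivative (form_rep \<omega>) (at (\<phi> p)) (components (X p)) \<bullet> components (Y p) -
    frechet_derivative (form_rep \<omega>) (at (\<phi> p)) (components (Y p)) \<bullet> components (X p)"
  using p form_eq_rep[OF w p bracket_tangent[OF X Y]]
  by (simp add: field_derivative_form[OF X Y w p] field_derivative_form[OF Y X w p]
      components_bracket[OF X Y p] inner_diff_right)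

lemma ext_deriv_rep:
  assumes w: "one_form A S \<omega>" and p: "p \<in> S \<inter> U" and u: "u \<in> tangent A p" and v: "v \<in> tangent A p"
  shows "ext_deriv A \<omega> p u v =
    frechet_derivative (form_rep \<omega>) (at (\<phi> p)) (components u) \<bullet> components v -
    frechet_derivative (form_rep \<omega>) (at (\<phi> p)) (components v) \<bullet> components u"
    (is "_ = ?r")
  unfolding ext_deriv_def
proof (rule the_equality)
  have S: "opens S" using w by (simp add: one_form_def)
  have vf: "vector_field A (S \<inter> U) (\<lambda>q. tangent_of q b)" for b
    by (rule vector_field_of_rep[where Y="\<lambda>_. b"]) (use S opens_domain open_image in \<open>auto intro!: smooth_intros\<close>)
  have w': "one_form A (S \<inter> U) \<omega>" using one_form_subset[OF w] S opens_domain by auto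
  show "\<exists>S X Y. p \<in> S \<and> vector_field A S X \<and> vector_field A S Y \<and> X p = u \<and> Y p = v \<and>
    ?r = X p (\<lambda>q. \<omega> q (Y q)) - Y p (\<lambda>q. \<omega> q (X q)) - \<omega> p (bracket A X Y p)"
    by (rule exI[of _ "S \<inter> U"], rule exI[of _ "\<lambda>q. tangent_of q (components u)"],
        rule exI[of _ "\<lambda>q. tangent_of q (components v)"])
       (use p u v exterior_derivative_formula[OF vf[of "components u"] vf[of "components v"] w', of p] in \<open>auto simp: vf\<close>)
  fix r
  assume "\<exists>S X Y. p \<in> S \<and> vector_field A S X \<and> vector_field A S Y \<and> X p = u \<and> Y p = v \<and>
    r = X p (\<lambda>q. \<omega> q (Y q)) - Y p (\<lambda>q. \<omega> q (X q)) - \<omega> p (bracket A X Y p)"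
  then obtain S' X Y where *: "p \<in> S'" "vector_field A S' X" "vector_field A S' Y" "X p = u" "Y p = v"
    "r = X p (\<lambda>q. \<omega> q (Y q)) - Y p (\<lambda>q. \<omega> q (X q)) - \<omega> p (bracket A X Y p)" by blast
  have o: "opens (S \<inter> S')" using S vector_field_opens[OF *(2)] by auto
  show "r = ?r"
    using exterior_derivative_formula[OF vector_field_subset[OF *(2) o] vector_field_subset[OF *(3) o]
        one_form_subset[OF w o]] * p by auto
qed

end

context smooth_atlas
begin

lemma ext_deriv_eq:
  assumes "one_form A S \<omega>" "vector_field A S X" "vector_field A S Y" "p \<in> S"
  shows "ext_deriv A \<omega> p (X p) (Y p) = X p (\<lambda>q. \<omega> q (Y q)) - Y p (\<lambda>q. \<omega> q (X q)) - \<omega> p (bracket A X Y p)"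
proof -
  have "opens S" using assms(1) by (simp add: one_form_def)
  then obtain U \<phi> where c: "(U, \<phi>) \<in> A" "p \<in> U" using opens_point_chart assms(4) by blast
  interpret coordinates A U \<phi> by unfold_locales (rule c)
  show ?thesis
    using ext_deriv_rep[OF assms(1)] exterior_derivative_formula[OF assms(2,3,1)] c assms vector_field_tangent by auto
qed

end

section \<open>Frames\<close>

lemma independent_family_coefficients:
  fixes f :: "'i \<Rightarrow> 'v::real_vector"
  assumes "finite I" "inj_on f I" "independent (f ` I)" "(\<Sum>i\<in>I. c i *\<^sub>R f i) = 0" "i \<in> I"
  shows "c i = 0"
proof -
  have "(\<Sum>v\<in>f ` I. c (inv_into I f v) *\<^sub>R v) = (\<Sum>i\<in>I. c i *\<^sub>R f i)"
    using assms(2) by (simp add: sum.reindex)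
  then show ?thesis
    using independentD[OF assms(3), of "f ` I" "\<lambda>v. c (inv_into I f v)" "f i"] assms by simp
qed

lemma span_family:
  fixes f :: "'i \<Rightarrow> 'v::real_vector"
  assumes "finite I" "inj_on f I" "v \<in> span (f ` I)"
  obtains c where "v = (\<Sum>i\<in>I. c i *\<^sub>R f i)"
proof -
  obtain c where "v = (\<Sum>w\<in>f ` I. c w *\<^sub>R w)" using assms(1,3) by (auto simp: span_finite)
  then show ?thesis using that[of "c \<circ> f"] assms(2) by (simp add: sum.reindex)
qed

lemma span_scaleR_singleton: "c \<noteq> 0 \<Longrightarrow> span {c *\<^sub>R v} = span {v}"
  unfolding span_singleton by (auto simp: image_iff) (metis nonzero_divide_eq_eq)

text \<open>The induction is Gram-Schmidt: projecting along one member of the family reduces the claim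
  to the remaining ones.\<close>

lemma smooth_coefficients:
  fixes \<epsilon> :: "'i \<Rightarrow> 'e::euclidean_space \<Rightarrow> 'b::euclidean_space"
  assumes "finite I" "open G" "\<And>i. i \<in> I \<Longrightarrow> smooth_on G (\<epsilon> i)"
    "\<And>u c i. u \<in> G \<Longrightarrow> (\<Sum>i\<in>I. c i *\<^sub>R \<epsilon> i u) = 0 \<Longrightarrow> i \<in> I \<Longrightarrow> c i = 0"
    "smooth_on G v" "\<And>u. u \<in> G \<Longrightarrow> v u = (\<Sum>i\<in>I. g i u *\<^sub>R \<epsilon> i u)" "i \<in> I"
  shows "smooth_on G (g i)"
  using assms(1,3-)
proof (induction I arbitrary: \<epsilon> v i rule: finite_induct)
  case (insert j I)
  let ?n = "\<lambda>u. \<epsilon> j u \<bullet> \<epsilon> j u"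
  let ?P = "\<lambda>w u. w u - ((w u \<bullet> \<epsilon> j u) / ?n u) *\<^sub>R \<epsilon> j u"
  have j: "smooth_on G (\<epsilon> j)" using insert.prems(1) by simp
  have nz: "?n u \<noteq> 0" if "u \<in> G" for u
  proof
    assume "?n u = 0"
    have "(\<Sum>i\<in>insert j I. (if i = j then 1 else 0) *\<^sub>R \<epsilon> i u) = (\<Sum>i\<in>I. (if i = j then 1 else 0) *\<^sub>R \<epsilon> i u)"
      using insert.hyps \<open>?n u = 0\<close> by simp
    also have "\<dots> = 0" using insert.hyps by (intro sum.neutral) auto
    finally show False using insert.prems(2)[OF that, of "\<lambda>i. if i = j then 1 else 0" j] by simp
  qed
  have proj: "smooth_on G (?P w)" if "smooth_on G w" for w
    using that j nz assms(2) by (intro smooth_intros) auto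
  have P_sum: "?P (\<lambda>u. \<Sum>i\<in>I. c i u *\<^sub>R \<epsilon> i u) u = (\<Sum>i\<in>I. c i u *\<^sub>R ?P (\<epsilon> i) u)" for c u
    by (simp add: inner_sum_left sum_divide_distrib scaleR_sum_left scaleR_diff_right sum_subtractf)
  have I: "smooth_on G (g i)" if "i \<in> I" for i
  proof (rule insert.IH[of "\<lambda>i. ?P (\<epsilon> i)" "?P v"])
    show "c i = 0" if "u \<in> G" "(\<Sum>i\<in>I. c i *\<^sub>R ?P (\<epsilon> i) u) = 0" "i \<in> I" for u c i
    proof -
      let ?w = "\<Sum>i\<in>I. c i *\<^sub>R \<epsilon> i u"
      \<comment> \<open>a relation among the projections is a relation in the whole family\<close>
      let ?c = "\<lambda>i. if i = j then - ((?w \<bullet> \<epsilon> j u) / ?n u) else c i"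
      have "(\<Sum>i\<in>I. ?c i *\<^sub>R \<epsilon> i u) = ?w" using insert.hyps by (intro sum.cong) auto
      then have "(\<Sum>i\<in>insert j I. ?c i *\<^sub>R \<epsilon> i u) = ?P (\<lambda>u. \<Sum>i\<in>I. c i *\<^sub>R \<epsilon> i u) u"
        using insert.hyps by simp
      also have "\<dots> = 0" using P_sum[of "\<lambda>i _. c i" u] that(2) by simp
      finally have "?c i = 0" using insert.prems(2)[OF that(1), of ?c i] that(3) by blast
      moreover have "i \<noteq> j" using that(3) insert.hyps by auto
      ultimately show "c i = 0" by simp
    qed
    show "?P v u = (\<Sum>i\<in>I. g i u *\<^sub>R ?P (\<epsilon> i) u)" if "u \<in> G" for u
      using P_sum[of g u] insert.prems(4)[OF that] insert.hyps nz[OF that]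
      by (simp add: inner_add_left algebra_simps add_divide_distrib)
  qed (use insert.prems proj that in auto)
  show ?case
  proof (cases "i = j")
    case True
    have "smooth_on G (\<lambda>u. ((v u - (\<Sum>i\<in>I. g i u *\<^sub>R \<epsilon> i u)) \<bullet> \<epsilon> j u) / ?n u)"
      using I insert.prems j nz assms(2) by (intro smooth_intros) auto
    then show ?thesis
      by (rule smooth_on_cong[OF _ assms(2)]) (use True insert nz in simp)
  qed (use I insert.prems in auto)
qed simp

context smooth_atlas
begin

lemma local_frame_independent:
  assumes "local_frame A S C I e" "finite I" "p \<in> S" "(\<Sum>i\<in>I. c i *\<^sub>R e i p) = 0" "i \<in> I"
  shows "c i = 0"
  using independent_family_coefficients[of I "\<lambda>i. e i p" c i] assms by (auto simp: local_frame_def)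

lemma local_frame_unique:
  assumes "local_frame A S C I e" "finite I" "p \<in> S" "(\<Sum>i\<in>I. c i *\<^sub>R e i p) = (\<Sum>i\<in>I. d i *\<^sub>R e i p)" "i \<in> I"
  shows "c i = d i"
  using local_frame_independent[OF assms(1-3) _ assms(5), of "\<lambda>i. c i - d i"] assms(4)
  by (simp add: scaleR_diff_left sum_subtractf)

lemma local_frame_span:
  assumes "local_frame A S C I e" "finite I" "p \<in> S" "v \<in> C p"
  obtains c where "v = (\<Sum>i\<in>I. c i *\<^sub>R e i p)"
  using span_family[of I "\<lambda>i. e i p" v] assms by (auto simp: local_frame_def)

lemma local_frame_subspace: "local_frame A S C I e \<Longrightarrow> p \<in> S \<Longrightarrow> subspace (C p)"
  unfolding local_frame_def by (metis subspace_span)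

lemma local_frame_field: "local_frame A S C I e \<Longrightarrow> i \<in> I \<Longrightarrow> vector_field A S (e i)"
  by (auto simp: local_frame_def section_of_def)

lemma local_frame_mem: "local_frame A S C I e \<Longrightarrow> i \<in> I \<Longrightarrow> p \<in> S \<Longrightarrow> e i p \<in> C p"
  by (auto simp: local_frame_def section_of_def)

end

context coordinates
begin

lemma field_rep_frame_independent:
  assumes "local_frame A S C I e" "finite I" "u \<in> \<phi> ` (S \<inter> U)" "(\<Sum>i\<in>I. c i *\<^sub>R field_rep (e i) u) = 0" "i \<in> I"
  shows "c i = 0"
proof -
  obtain p where p: "p \<in> S" "p \<in> U" "u = \<phi> p" using assms(3) by auto
  have "(\<Sum>i\<in>I. c i *\<^sub>R e i p) \<in> tangent A p"
    using vector_field_tangent[OF local_frame_field[OF assms(1)] p(1)]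
    by (intro subspace_sum subspace_scale subspace_tangent) auto
  moreover have "components (\<Sum>i\<in>I. c i *\<^sub>R e i p) = 0"
    using assms(4) p by (simp add: linear_sum[OF linear_components] components_scaleR field_rep_at)
  ultimately have "(\<Sum>i\<in>I. c i *\<^sub>R e i p) = 0"
    using components_eq_iff[OF p(2) _ subspace_0[OF subspace_tangent]] by simp
  then show ?thesis using local_frame_independent[OF assms(1,2) p(1) _ assms(5)] by simp
qed

end

context smooth_atlas
begin

lemma smooth_frame_coefficients:
  assumes e: "local_frame A S C I e" "finite I" and X: "vector_field A S X"
    and g: "\<And>p. p \<in> S \<Longrightarrow> X p = (\<Sum>i\<in>I. g i p *\<^sub>R e i p)" and i: "i \<in> I"
  shows "smooth_fun A S (g i)"
  unfolding smooth_fun_iff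
proof (intro conjI ballI)
  show S: "opens S" by (rule vector_field_opens[OF X])
  fix p assume p: "p \<in> S"
  obtain U \<phi> where c: "(U, \<phi>) \<in> A" "p \<in> U" using opens_point_chart[OF S p] .
  interpret coordinates A U \<phi> by unfold_locales (rule c)
  let ?G = "\<phi> ` (S \<inter> U)"
  have "smooth_on ?G (g i \<circ> \<iota>)"
  proof (rule smooth_coefficients[where \<epsilon>="\<lambda>i. field_rep (e i)" and v="field_rep X" and g="\<lambda>i. g i \<circ> \<iota>"])
    show "field_rep X u = (\<Sum>i\<in>I. (g i \<circ> \<iota>) u *\<^sub>R field_rep (e i) u)" if "u \<in> ?G" for u
      using that g by (auto simp: field_rep_def linear_sum[OF linear_components] components_scaleR)
  qed (use e i smooth_field_rep[OF X] smooth_field_rep[OF local_frame_field[OF e(1)]] open_image[OF S]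
      field_rep_frame_independent[OF e] in auto)
  then show "smooth_near A p (g i)"
    by (intro smooth_nearI[OF c(2) open_image[OF S]]) (use p c in \<open>auto simp: o_def\<close>)
qed

end

lemma (in smooth_atlas) local_frame_subset:
  "local_frame A S C I e \<Longrightarrow> opens T \<Longrightarrow> T \<subseteq> S \<Longrightarrow> local_frame A T C I e"
  using vector_field_subset by (auto simp: local_frame_def section_of_def)

section \<open>Affine charts of the projectivization\<close>

abbreviation frame_indices :: "'f::euclidean_space option set" where
  "frame_indices \<equiv> insert None (Some ` Basis)"

lemma sum_frame_indices:
  "(\<Sum>i\<in>frame_indices. h i) = h None + (\<Sum>b\<in>Basis. h (Some b))"
  by (simp add: sum.reindex)

text \<open>A chart \<open>\<phi>\<close> of the base and a frame \<open>e\<close> of \<open>H\<close> on \<open>S\<close>. A line on which the coefficient of \<open>e None\<close> does not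
  vanish has a unique generator with coefficient one.\<close>

locale affine_chart = coordinates A U \<phi>
  for A :: "('a, 'e::euclidean_space) chart set" and U \<phi> +
  fixes H :: "'a \<Rightarrow> 'a tvec set" and e :: "'f::euclidean_space option \<Rightarrow> 'a \<Rightarrow> 'a tvec" and S :: "'a set"
  assumes S: "opens S" "S \<subseteq> U" and frame: "local_frame A S H frame_indices e"
begin

definition generator :: "'a \<Rightarrow> 'f \<Rightarrow> 'a tvec" where
  "generator x z = e None x + (\<Sum>b\<in>Basis. (z \<bullet> b) *\<^sub>R e (Some b) x)"

abbreviation coord_domain :: "('e \<times> 'f) set" where "coord_domain \<equiv> \<phi> ` S \<times> UNIV"

definition domain :: "'a lpoint set" where
  "domain = proj_param (U, \<phi>) e ` coord_domain"

definition \<psi> :: "'a lpoint \<Rightarrow> 'e \<times> 'f" where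
  "\<psi> = inv_into coord_domain (proj_param (U, \<phi>) e)"

lemma finite_frame_indices: "finite (frame_indices :: 'f option set)" by simp

lemma param_eq: "x \<in> S \<Longrightarrow> proj_param (U, \<phi>) e (\<phi> x, z) = (x, span {generator x z})"
  using S by (auto simp: proj_param_def generator_def Let_def)

lemma generator_eq_sum: "generator x z = (\<Sum>i\<in>frame_indices. (case i of None \<Rightarrow> 1 | Some b \<Rightarrow> z \<bullet> b) *\<^sub>R e i x)"
  unfolding sum_frame_indices by (simp add: generator_def)

lemma generator_mem: "x \<in> S \<Longrightarrow> generator x z \<in> H x"
  unfolding generator_eq_sum
  by (intro subspace_sum subspace_scale local_frame_subspace[OF frame] local_frame_mem[OF frame])

lemma frame_sum_proportional:
  assumes "x \<in> S" "(\<Sum>i\<in>frame_indices. \<gamma> i *\<^sub>R e i x) = k *\<^sub>R generator x z"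
  shows "\<gamma> None = k" "b \<in> Basis \<Longrightarrow> \<gamma> (Some b) = k * (z \<bullet> b)"
proof -
  have "(\<Sum>i\<in>frame_indices. \<gamma> i *\<^sub>R e i x) =
      (\<Sum>i\<in>frame_indices. (k * (case i of None \<Rightarrow> 1 | Some b \<Rightarrow> z \<bullet> b)) *\<^sub>R e i x)"
    unfolding assms(2) generator_eq_sum scaleR_sum_right by simp
  note * = local_frame_unique[OF frame finite_frame_indices assms(1) this]
  show "\<gamma> None = k" using *[of None] by simp
  show "\<gamma> (Some b) = k * (z \<bullet> b)" if "b \<in> Basis" using *[of "Some b"] that by simp
qed

lemma generator_nonzero: "x \<in> S \<Longrightarrow> generator x z \<noteq> 0"
  using frame_sum_proportional(1)[of x "\<lambda>_. 0" 1 z] by auto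

lemma generator_proportional:
  assumes "x \<in> S" "generator x z = k *\<^sub>R generator x z'"
  shows "k = 1" "z = z'"
proof -
  note * = frame_sum_proportional[OF assms(1) assms(2)[unfolded generator_eq_sum[of x z]]]
  show k: "k = 1" using *(1) by simp
  show "z = z'" by (rule euclidean_eqI) (use *(2) k in auto)
qed

lemma inj_param: "inj_on (proj_param (U, \<phi>) e) coord_domain"
proof (rule inj_onI)
  fix y y' assume "y \<in> coord_domain" "y' \<in> coord_domain" and eq: "proj_param (U, \<phi>) e y = proj_param (U, \<phi>) e y'"
  then obtain x z x' z' where y: "y = (\<phi> x, z)" "x \<in> S" "y' = (\<phi> x', z')" "x' \<in> S" by auto
  then have "x = x'" "span {generator x z} = span {generator x z'}" using eq by (auto simp: param_eq)
  then have "generator x z \<in> span {generator x z'}" using span_base by blast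
  then obtain k where "generator x z = k *\<^sub>R generator x z'" by (auto simp: span_singleton)
  then show "y = y'" using generator_proportional y \<open>x = x'\<close> by blast
qed

lemma \<psi>_eq: "x \<in> S \<Longrightarrow> \<psi> (x, span {generator x z}) = (\<phi> x, z)"
  unfolding \<psi>_def using inv_into_f_f[OF inj_param, of "(\<phi> x, z)"] by (simp add: param_eq)

lemma domain_iff: "q \<in> domain \<longleftrightarrow> (\<exists>x z. x \<in> S \<and> q = (x, span {generator x z}))"
  unfolding domain_def by (force simp: param_eq image_iff)

lemma inj_\<psi>: "inj_on \<psi> domain"
  by (rule inj_onI) (auto simp: domain_iff \<psi>_eq inj_on_eq_iff[OF inj_chart[OF chart]] subset_iff dest: S(2)[THEN subsetD],
    (metis S(2) inverse_chart subset_iff)+)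

lemma \<psi>_domain: "\<psi> ` domain = coord_domain"
proof (intro set_eqI iffI)
  fix y assume "y \<in> coord_domain"
  then obtain x z where "x \<in> S" "y = (\<phi> x, z)" by auto
  then show "y \<in> \<psi> ` domain"
    by (intro image_eqI[of _ _ "(x, span {generator x z})"]) (auto simp: domain_iff \<psi>_eq)
qed (auto simp: domain_iff \<psi>_eq)

lemma inv_\<psi>: "x \<in> S \<Longrightarrow> inv_into domain \<psi> (\<phi> x, z) = (x, span {generator x z})"
  using inv_into_f_f[OF inj_\<psi>, of "(x, span {generator x z})"] by (auto simp: domain_iff \<psi>_eq)

lemma open_coord_domain: "open coord_domain"
  using open_image[OF S(1)] S(2) by (simp add: open_Times Int_absorb2)

lemma chart_mem: "(domain, \<psi>) \<in> proj_atlas A H"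
  unfolding proj_atlas_def domain_def \<psi>_def using chart S frame
  by (simp, intro exI[of _ U] exI[of _ \<phi>] exI[of _ e] exI[of _ S]) simp

end

lemma (in smooth_atlas) proj_atlas_affine_chart:
  assumes "(P, \<xi>) \<in> (proj_atlas A H :: ('a lpoint, 'e \<times> 'f::euclidean_space) chart set)"
  obtains U \<phi> e S where "affine_chart A U \<phi> H (e :: 'f option \<Rightarrow> 'a \<Rightarrow> 'a tvec) S"
    "P = affine_chart.domain U \<phi> e S" "\<xi> = affine_chart.\<psi> U \<phi> e S"
proof -
  obtain c e S where c: "P = proj_param c e ` (snd c ` S \<times> UNIV)" "\<xi> = inv_into (snd c ` S \<times> UNIV) (proj_param c e)"
    "c \<in> A" "S \<subseteq> fst c" "opens S" "local_frame A S H frame_indices (e :: 'f option \<Rightarrow> 'a \<Rightarrow> 'a tvec)"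
    using assms unfolding proj_atlas_def by blast
  interpret affine_chart A "fst c" "snd c" H e S by unfold_locales (use c in auto)
  show thesis
    by (rule that[OF affine_chart_axioms]) (use c in \<open>auto simp: domain_def \<psi>_def\<close>)
qed

text \<open>A change of frame acts on lines by a fractional linear map, whose coefficients are smooth.\<close>

lemma (in smooth_atlas) affine_chart_transition:
  fixes e e' :: "'f::euclidean_space option \<Rightarrow> 'a \<Rightarrow> 'a tvec"
  assumes "affine_chart A U \<phi> H e S" "affine_chart A U' \<phi>' H e' S'"
  defines "D \<equiv> affine_chart.domain U \<phi> e S" and "D' \<equiv> affine_chart.domain U' \<phi>' e' S'"
    and "c \<equiv> affine_chart.\<psi> U \<phi> e S" and "c' \<equiv> affine_chart.\<psi> U' \<phi>' e' S'"
  shows "open (c ` (D \<inter> D'))" "smooth_on (c ` (D \<inter> D')) (c' \<circ> inv_into D c)"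
proof -
  interpret a: affine_chart A U \<phi> H e S by fact
  interpret b: affine_chart A U' \<phi>' H e' S' by fact
  let ?I = "frame_indices :: 'f option set"
  let ?T = "S \<inter> S'"
  have T: "opens ?T" using a.S b.S by auto
  have frame': "local_frame A ?T H ?I e'"
    using b.frame T vector_field_subset by (auto simp: local_frame_def section_of_def)
  have "\<exists>g. \<forall>x\<in>?T. e j x = (\<Sum>i\<in>?I. g i x *\<^sub>R e' i x)" if "j \<in> ?I" for j
  proof -
    have "\<forall>x\<in>?T. \<exists>g. e j x = (\<Sum>i\<in>?I. g i *\<^sub>R e' i x)"
      using local_frame_span[OF b.frame b.finite_frame_indices] local_frame_mem[OF a.frame that] by (metis IntD1 IntD2)
    then obtain g where "\<forall>x\<in>?T. e j x = (\<Sum>i\<in>?I. g x i *\<^sub>R e' i x)" by metis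
    then show ?thesis by (intro exI[of _ "\<lambda>i x. g x i"]) simp
  qed
  then obtain g where g: "\<And>j x. j \<in> ?I \<Longrightarrow> x \<in> ?T \<Longrightarrow> e j x = (\<Sum>i\<in>?I. g j i x *\<^sub>R e' i x)" by metis
  have g_smooth: "smooth_fun A ?T (g j i)" if "j \<in> ?I" "i \<in> ?I" for i j
    by (rule smooth_frame_coefficients[OF frame' b.finite_frame_indices vector_field_subset[OF local_frame_field[OF a.frame that(1)] T]])
       (use g that in auto)
  define \<gamma> where "\<gamma> i x z = g None i x + (\<Sum>b\<in>Basis. (z \<bullet> b) * g (Some b) i x)" for i x and z :: 'f
  have gen: "a.generator x z = (\<Sum>i\<in>?I. \<gamma> i x z *\<^sub>R e' i x)" if "x \<in> ?T" for x z
  proof -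
    have "a.generator x z = (\<Sum>j\<in>?I. (case j of None \<Rightarrow> 1 | Some b \<Rightarrow> z \<bullet> b) *\<^sub>R (\<Sum>i\<in>?I. g j i x *\<^sub>R e' i x))"
      unfolding a.generator_eq_sum by (intro sum.cong) (use g that in auto)
    also have "\<dots> = (\<Sum>i\<in>?I. (\<Sum>j\<in>?I. (case j of None \<Rightarrow> 1 | Some b \<Rightarrow> z \<bullet> b) * g j i x) *\<^sub>R e' i x)"
      unfolding scaleR_sum_right scaleR_sum_left by (subst sum.swap) simp
    also have "\<dots> = (\<Sum>i\<in>?I. \<gamma> i x z *\<^sub>R e' i x)"
      by (simp only: sum_frame_indices[of "\<lambda>j. (case j of None \<Rightarrow> 1 | Some b \<Rightarrow> z \<bullet> b) * g j i x" for i x] \<gamma>_def) simp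
    finally show ?thesis .
  qed
  \<comment> \<open>\<open>\<gamma>\<close> are the coefficients of the generator in the second frame, \<open>\<zeta>\<close> the resulting affine coordinates\<close>
  define \<zeta> where "\<zeta> x z = (\<Sum>b\<in>Basis. (\<gamma> (Some b) x z / \<gamma> None x z) *\<^sub>R b)" for x z
  have line: "(x, span {a.generator x z}) = (x, span {b.generator x (\<zeta> x z)})"
    if x: "x \<in> ?T" and nz: "\<gamma> None x z \<noteq> 0" for x z
  proof -
    have "a.generator x z = \<gamma> None x z *\<^sub>R b.generator x (\<zeta> x z)"
      unfolding gen[OF x] sum_frame_indices b.generator_def scaleR_add_right scaleR_sum_right
      using nz by (simp add: \<zeta>_def inner_sum_left inner_Basis if_distrib cong: if_cong)
    then show ?thesis using nz by (simp add: span_scaleR_singleton)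
  qed
  have mem: "(x, span {a.generator x z}) \<in> D' \<longleftrightarrow> x \<in> S' \<and> \<gamma> None x z \<noteq> 0" if "x \<in> S" for x z
  proof
    assume "(x, span {a.generator x z}) \<in> D'"
    then obtain z' where x: "x \<in> S'" and eq: "span {a.generator x z} = span {b.generator x z'}"
      unfolding D'_def b.domain_iff by auto
    have "a.generator x z \<in> span {b.generator x z'}" using eq span_base by blast
    then obtain k where k: "a.generator x z = k *\<^sub>R b.generator x z'" by (auto simp: span_singleton)
    then have "\<gamma> None x z = k" using b.frame_sum_proportional(1)[OF x] gen[of x z] x that by simp
    then show "x \<in> S' \<and> \<gamma> None x z \<noteq> 0" using x k a.generator_nonzero[OF that] by auto
  next
    assume "x \<in> S' \<and> \<gamma> None x z \<noteq> 0"
    then show "(x, span {a.generator x z}) \<in> D'"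
      unfolding D'_def b.domain_iff using line[of x z] that by auto
  qed
  let ?G = "\<phi> ` ?T \<times> (UNIV :: 'f set)"
  have oT: "open (\<phi> ` ?T)" using a.open_image[OF T] a.S(2) by (simp add: Int_absorb2 le_infI1)
  have oG: "open ?G" using oT by (simp add: open_Times)
  have sg: "smooth_on ?G (\<lambda>y. g j i (a.\<iota> (fst y)))" if "j \<in> ?I" "i \<in> ?I" for i j
  proof -
    have "smooth_on (\<phi> ` (?T \<inter> U)) (g j i \<circ> a.\<iota>)" 
      using g_smooth[OF that] a.chart unfolding smooth_fun_def by blast
    then have "smooth_on (\<phi> ` ?T) (\<lambda>u. g j i (a.\<iota> u))" using a.S(2) by (simp add: Int_absorb2 le_infI1 o_def)
    then show ?thesis
      by (rule smooth_on_compose[OF _ oG oT]) (auto intro!: smooth_intros oG)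
  qed
  have s\<gamma>: "smooth_on ?G (\<lambda>y. \<gamma> i (a.\<iota> (fst y)) (snd y))" if "i \<in> ?I" for i
    unfolding \<gamma>_def using that by (intro smooth_intros oG sg) auto
  have image: "c ` (D \<inter> D') = {y \<in> ?G. \<gamma> None (a.\<iota> (fst y)) (snd y) \<noteq> 0}"
  proof (intro set_eqI iffI)
    fix y assume "y \<in> c ` (D \<inter> D')"
    then obtain q where q: "q \<in> D" "q \<in> D'" "y = c q" by auto
    then obtain x z where x: "x \<in> S" "q = (x, span {a.generator x z})" unfolding D_def a.domain_iff by auto
    then show "y \<in> {y \<in> ?G. \<gamma> None (a.\<iota> (fst y)) (snd y) \<noteq> 0}"
      using q mem[OF x(1)] a.S(2) by (auto simp: c_def a.\<psi>_eq subset_iff)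
  next
    fix y assume "y \<in> {y \<in> ?G. \<gamma> None (a.\<iota> (fst y)) (snd y) \<noteq> 0}"
    then obtain x z where x: "x \<in> ?T" "y = (\<phi> x, z)" "\<gamma> None x z \<noteq> 0" using a.S(2) by (auto simp: subset_iff)
    then show "y \<in> c ` (D \<inter> D')"
      using mem[of x z] by (intro image_eqI[of _ _ "(x, span {a.generator x z})"]) (auto simp: c_def D_def a.\<psi>_eq a.domain_iff)
  qed
  have "open (?G \<inter> (\<lambda>y. \<gamma> None (a.\<iota> (fst y)) (snd y)) -` (- {0}))"
    using continuous_on_open_vimage[OF oG, THEN iffD1, OF smooth_on_continuous[OF s\<gamma>[of None]], THEN spec, of "- {0}"]
    by (simp add: Int_commute open_Compl)
  moreover have "?G \<inter> (\<lambda>y. \<gamma> None (a.\<iota> (fst y)) (snd y)) -` (- {0}) = c ` (D \<inter> D')"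
    unfolding image by auto
  ultimately show o: "open (c ` (D \<inter> D'))" by simp
  have "smooth_on (\<phi> ` ?T) (\<phi>' \<circ> a.\<iota>)"
    by (rule smooth_on_subset[OF smooth_transition[OF a.chart b.chart]]) (use a.S b.S in auto)
  then have s1: "smooth_on (c ` (D \<inter> D')) (\<lambda>y. (\<phi>' \<circ> a.\<iota>) (fst y))"
    by (rule smooth_on_compose[OF _ o oT smooth_on_fst[OF o smooth_on_ident[OF o]]]) (auto simp: image)
  have s2: "smooth_on (c ` (D \<inter> D')) (\<lambda>y. \<zeta> (a.\<iota> (fst y)) (snd y))"
    unfolding \<zeta>_def by (intro smooth_intros o smooth_on_subset[OF s\<gamma>])
      (auto simp: image o[unfolded image])
  show "smooth_on (c ` (D \<inter> D')) (c' \<circ> inv_into D c)"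
  proof (rule smooth_on_cong[OF smooth_on_Pair[OF o s1 s2] o])
    fix y assume "y \<in> c ` (D \<inter> D')"
    then obtain x z where x: "x \<in> ?T" "y = (\<phi> x, z)" "\<gamma> None x z \<noteq> 0" using a.S(2) by (auto simp: image subset_iff)
    have "inv_into D c y = (x, span {a.generator x z})" using x by (auto simp: D_def c_def a.inv_\<psi>)
    then have "(c' \<circ> inv_into D c) y = (\<phi>' x, \<zeta> x z)"
      using line[OF x(1,3)] x by (simp add: c'_def b.\<psi>_eq)
    then show "((\<phi>' \<circ> a.\<iota>) (fst y), \<zeta> (a.\<iota> (fst y)) (snd y)) = (c' \<circ> inv_into D c) y"
      using x a.S(2) by (auto simp: subset_iff)
  qed
qed

lemma (in smooth_atlas) smooth_atlas_proj_atlas: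
  "smooth_atlas (proj_atlas A H :: ('a lpoint, 'e \<times> 'f::euclidean_space) chart set)"
proof
  fix P \<xi> assume "(P, \<xi>) \<in> (proj_atlas A H :: ('a lpoint, 'e \<times> 'f) chart set)"
  then obtain U \<phi> e S where a: "affine_chart A U \<phi> H (e :: 'f option \<Rightarrow> 'a \<Rightarrow> 'a tvec) S"
    "P = affine_chart.domain U \<phi> e S" "\<xi> = affine_chart.\<psi> U \<phi> e S" by (rule proj_atlas_affine_chart)
  show "inj_on \<xi> P" unfolding a(2,3) by (rule affine_chart.inj_\<psi>[OF a(1)])
  fix P' \<xi>' assume "(P', \<xi>') \<in> (proj_atlas A H :: ('a lpoint, 'e \<times> 'f) chart set)"
  then obtain U' \<phi>' e' S' where b: "affine_chart A U' \<phi>' H (e' :: 'f option \<Rightarrow> 'a \<Rightarrow> 'a tvec) S'"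
    "P' = affine_chart.domain U' \<phi>' e' S'" "\<xi>' = affine_chart.\<psi> U' \<phi>' e' S'" by (rule proj_atlas_affine_chart)
  show "open (\<xi> ` (P \<inter> P'))" "smooth_on (\<xi> ` (P \<inter> P')) (\<xi>' \<circ> inv_into P \<xi>)"
    unfolding a(2,3) b(2,3) using affine_chart_transition[OF a(1) b(1)] by auto
qed

section \<open>Distributions and their characteristic systems\<close>

lemma characteristicD:
  "v \<in> characteristic A N C p \<Longrightarrow> one_form A S \<omega> \<Longrightarrow> p \<in> S \<Longrightarrow> S \<subseteq> N \<Longrightarrow>
    (\<And>q w. q \<in> S \<Longrightarrow> w \<in> C q \<Longrightarrow> \<omega> q w = 0) \<Longrightarrow> w \<in> C p \<Longrightarrow> ext_deriv A \<omega> p v w = 0"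
  unfolding characteristic_def by blast

context smooth_atlas
begin

lemma one_form_opens: "one_form A S \<omega> \<Longrightarrow> opens S"
  by (simp add: one_form_def)

lemma ext_deriv_coordinates:
  assumes "one_form A S \<omega>" "p \<in> S"
  obtains U \<phi> where "coordinates A U \<phi>" "p \<in> S \<inter> U"
proof -
  obtain U \<phi> where c: "(U, \<phi>) \<in> A" "p \<in> U" using opens_point_chart[OF one_form_opens[OF assms(1)] assms(2)] .
  interpret coordinates A U \<phi> by unfold_locales (rule c)
  show ?thesis using that[OF coordinates_axioms] c assms by auto
qed

lemma ext_deriv_self:
  assumes "one_form A S \<omega>" "p \<in> S" "v \<in> tangent A p"
  shows "ext_deriv A \<omega> p v v = 0"
proof -
  obtain U \<phi> where "coordinates A U \<phi>" and p: "p \<in> S \<inter> U" using ext_deriv_coordinates[OF assms(1,2)] .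
  then interpret coordinates A U \<phi> by simp
  show ?thesis by (simp add: ext_deriv_rep[OF assms(1) p assms(3,3)])
qed

lemma ext_deriv_swap:
  assumes "one_form A S \<omega>" "p \<in> S" "v \<in> tangent A p" "w \<in> tangent A p"
  shows "ext_deriv A \<omega> p w v = - ext_deriv A \<omega> p v w"
proof -
  obtain U \<phi> where "coordinates A U \<phi>" and p: "p \<in> S \<inter> U" using ext_deriv_coordinates[OF assms(1,2)] .
  then interpret coordinates A U \<phi> by simp
  show ?thesis by (simp add: ext_deriv_rep[OF assms(1) p assms(3,4)] ext_deriv_rep[OF assms(1) p assms(4,3)])
qed

lemma ext_deriv_linear:
  assumes "one_form A S \<omega>" "p \<in> S" "u \<in> tangent A p" "v \<in> tangent A p" "w \<in> tangent A p"
  shows "ext_deriv A \<omega> p u (a *\<^sub>R v + b *\<^sub>R w) = a * ext_deriv A \<omega> p u v + b * ext_deriv A \<omega> p u w"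
proof -
  obtain U \<phi> where "coordinates A U \<phi>" and p: "p \<in> S \<inter> U" using ext_deriv_coordinates[OF assms(1,2)] .
  then interpret coordinates A U \<phi> by simp
  have vw: "a *\<^sub>R v + b *\<^sub>R w \<in> tangent A p"
    using assms(4,5) by (intro subspace_add subspace_scale subspace_tangent)
  have l: "linear (frechet_derivative (form_rep \<omega>) (at (\<phi> p)))"
    by (rule linear_frechet_derivative_smooth[OF smooth_form_rep[OF assms(1)]]) (use p in auto)
  show ?thesis
    unfolding ext_deriv_rep[OF assms(1) p assms(3) vw] ext_deriv_rep[OF assms(1) p assms(3,4)]
      ext_deriv_rep[OF assms(1) p assms(3,5)]
    by (simp add: components_add components_scaleR linear_add[OF l] linear_cmul[OF l]
        inner_add_left inner_add_right algebra_simps)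
qed

lemma subspace_ext_deriv_kernel:
  assumes "one_form A S \<omega>" "p \<in> S" "u \<in> tangent A p"
  shows "subspace {v \<in> tangent A p. ext_deriv A \<omega> p u v = 0}"
proof (rule subspaceI)
  have "ext_deriv A \<omega> p u (0 *\<^sub>R u + 0 *\<^sub>R u) = 0"
    using ext_deriv_linear[OF assms assms(3,3), of 0 0] by simp
  then show "0 \<in> {v \<in> tangent A p. ext_deriv A \<omega> p u v = 0}"
    using subspace_0[OF subspace_tangent] by (simp only: scaleR_zero_left add_0_left) simp
next
  fix v w assume "v \<in> {v \<in> tangent A p. ext_deriv A \<omega> p u v = 0}" "w \<in> {v \<in> tangent A p. ext_deriv A \<omega> p u v = 0}"
  then show "v + w \<in> {v \<in> tangent A p. ext_deriv A \<omega> p u v = 0}"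
    using ext_deriv_linear[OF assms, of v w 1 1] subspace_add[OF subspace_tangent] by auto
next
  fix c v assume v: "v \<in> {v \<in> tangent A p. ext_deriv A \<omega> p u v = 0}"
  then have "ext_deriv A \<omega> p u (c *\<^sub>R v + 0 *\<^sub>R v) = 0"
    using ext_deriv_linear[OF assms, of v v c 0] by auto
  then show "c *\<^sub>R v \<in> {v \<in> tangent A p. ext_deriv A \<omega> p u v = 0}"
    using v subspace_scale[OF subspace_tangent] by (simp only: scaleR_zero_left add_0_right) auto
qed

lemma smooth_near_form: "one_form A S \<omega> \<Longrightarrow> vector_field A S X \<Longrightarrow> p \<in> S \<Longrightarrow> smooth_near A p (\<lambda>q. \<omega> q (X q))"
  unfolding one_form_def smooth_near_def by blast

text \<open>Smoothness is read off from the invariant formula for the exterior derivative.\<close>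

lemma contraction_one_form:
  assumes w: "one_form A S \<omega>" and X: "vector_field A S X"
  shows "one_form A S (\<lambda>p. ext_deriv A \<omega> p (X p))"
proof -
  have "smooth_fun A T (\<lambda>p. ext_deriv A \<omega> p (X p) (Z p))" if T: "T \<subseteq> S" and Z: "vector_field A T Z" for T Z
    unfolding smooth_fun_iff
  proof (intro conjI ballI)
    show o: "opens T" by (rule vector_field_opens[OF Z])
    note X' = vector_field_subset[OF X o T] and w' = one_form_subset[OF w o T]
    fix p assume p: "p \<in> T"
    show "smooth_near A p (\<lambda>p. ext_deriv A \<omega> p (X p) (Z p))"
      by (rule smooth_near_cong[OF o p ext_deriv_eq[OF w' X' Z, symmetric]])
         (intro smooth_near_diff vector_field_smooth_near[OF X' p] vector_field_smooth_near[OF Z p]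
           smooth_near_form[OF w'] bracket_vector_field X' Z p | assumption)+
  qed
  then show ?thesis
    using ext_deriv_linear[OF w _ vector_field_tangent[OF X]] one_form_opens[OF w]
    unfolding one_form_def by blast
qed

lemma vector_field_vanishing:
  assumes "vector_field A S X" "p \<in> S" "\<And>q. q \<in> S \<Longrightarrow> f q = 0"
  shows "X p f = 0"
proof -
  note S = vector_field_opens[OF assms(1)] and v = vector_field_tangent[OF assms(1,2)]
  have "X p (\<lambda>q. 0) = X p f"
    by (rule tangent_local[OF v S assms(2) _ smooth_near_const[OF S assms(2)]]) (use assms(3) in simp)
  then show ?thesis using tangent_const[OF v S assms(2)] by simp
qed

text \<open>On fields annihilated by \<open>\<omega>\<close>, the exterior derivative only sees the bracket.\<close>

lemma ext_deriv_annihilated: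
  assumes w: "one_form A S \<omega>" and X: "vector_field A S X" and Y: "vector_field A S Y" and p: "p \<in> S"
    and "\<And>q. q \<in> S \<Longrightarrow> \<omega> q (X q) = 0" "\<And>q. q \<in> S \<Longrightarrow> \<omega> q (Y q) = 0"
  shows "ext_deriv A \<omega> p (X p) (Y p) = - \<omega> p (bracket A X Y p)"
  using ext_deriv_eq[OF w X Y p] vector_field_vanishing[OF X p assms(6)] vector_field_vanishing[OF Y p assms(5)] by simp

lemma bracket_minus_right:
  assumes X: "vector_field A S X" and Z: "vector_field A S Z" and p: "p \<in> S"
  shows "bracket A X (\<lambda>q. - Z q) p = - bracket A X Z p"
proof
  fix f
  show "bracket A X (\<lambda>q. - Z q) p f = (- bracket A X Z p) f"
  proof (cases "smooth_near A p f")
    case True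
    have "X p (\<lambda>q. (-1) * Z q f) = (-1) * X p (\<lambda>q. Z q f)"
      using vector_field_smooth_near[OF Z p True] by (intro tangent_cmult[OF vector_field_tangent[OF X p]])
    then show ?thesis using True by (simp add: bracket_def)
  qed (simp add: bracket_def)
qed

lemma bracket_swap_inner:
  assumes "vector_field A S X" "vector_field A S Y" "vector_field A S Z" "p \<in> S"
  shows "bracket A X (bracket A Z Y) p = - bracket A X (bracket A Y Z) p"
proof -
  have "bracket A Z Y = (\<lambda>q. - bracket A Y Z q)" by (rule ext) (rule bracket_anticommute)
  then show ?thesis using bracket_minus_right[OF assms(1) bracket_vector_field[OF assms(2,3)] assms(4)] by simp
qed

lemma section_of_subset: "section_of A S C X \<Longrightarrow> opens T \<Longrightarrow> T \<subseteq> S \<Longrightarrow> section_of A T C X"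
  using vector_field_subset unfolding section_of_def by blast

lemma section_of_field: "section_of A S C X \<Longrightarrow> vector_field A S X"
  and section_of_mem: "section_of A S C X \<Longrightarrow> p \<in> S \<Longrightarrow> X p \<in> C p"
  by (auto simp: section_of_def)

lemma section_of_opens: "section_of A S C X \<Longrightarrow> opens S"
  using section_of_field vector_field_opens by blast

lemma subspace_bracket_span: "subspace (bracket_span A N U W p)"
  by (simp add: bracket_span_def)

lemma bracket_span_left: "p \<in> S \<Longrightarrow> S \<subseteq> N \<Longrightarrow> section_of A S U Y \<Longrightarrow> Y p \<in> bracket_span A N U W p"
  and bracket_span_right: "p \<in> S \<Longrightarrow> S \<subseteq> N \<Longrightarrow> section_of A S W X \<Longrightarrow> X p \<in> bracket_span A N U W p"
  and bracket_span_bracket: "p \<in> S \<Longrightarrow> S \<subseteq> N \<Longrightarrow> section_of A S U Y \<Longrightarrow> section_of A S W X \<Longrightarrow>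
    bracket A Y X p \<in> bracket_span A N U W p"
  unfolding bracket_span_def by (rule span_base, blast)+

lemma bracket_span_bracket': "p \<in> S \<Longrightarrow> S \<subseteq> N \<Longrightarrow> section_of A S U Y \<Longrightarrow> section_of A S W X \<Longrightarrow>
    bracket A X Y p \<in> bracket_span A N U W p"
  using subspace_neg[OF subspace_bracket_span bracket_span_bracket] bracket_anticommute by metis

text \<open>Only sections near the point matter.\<close>

lemma bracket_span_minimal:
  assumes R: "opens R" "p \<in> R" and Q: "subspace Q"
    and U: "\<And>S Y. p \<in> S \<Longrightarrow> S \<subseteq> N \<inter> R \<Longrightarrow> section_of A S U Y \<Longrightarrow> Y p \<in> Q"
    and W: "\<And>S X. p \<in> S \<Longrightarrow> S \<subseteq> N \<inter> R \<Longrightarrow> section_of A S W X \<Longrightarrow> X p \<in> Q"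
    and UW: "\<And>S X Y. p \<in> S \<Longrightarrow> S \<subseteq> N \<inter> R \<Longrightarrow> section_of A S U Y \<Longrightarrow> section_of A S W X \<Longrightarrow> bracket A Y X p \<in> Q"
  shows "bracket_span A N U W p \<subseteq> Q"
proof -
  have r: "p \<in> S \<inter> R" "S \<inter> R \<subseteq> N \<inter> R" "section_of A (S \<inter> R) C X"
    if "p \<in> S" "S \<subseteq> N" "section_of A S C X" for S C X
    using that R section_of_subset[OF that(3) openin_Int[OF section_of_opens[OF that(3)] R(1)]] by auto
  show ?thesis
    unfolding bracket_span_def
  proof (rule span_minimal[OF _ Q], safe)
    show "Y p \<in> Q" if "p \<in> S" "S \<subseteq> N" "section_of A S U Y" for Y S by (rule U[OF r[OF that]])
    show "X p \<in> Q" if "p \<in> S" "S \<subseteq> N" "section_of A S W X" for X S by (rule W[OF r[OF that]])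
    show "bracket A Y X p \<in> Q" if "p \<in> S" "S \<subseteq> N" "section_of A S U Y" "section_of A S W X" for X Y S
      using UW[OF r[OF that(1-3)] r(3)[OF that(1,2,4)]] .
  qed
qed

lemma line_bundle_frame:
  assumes "subbundle A N W 1" "p \<in> N"
  obtains T X where "p \<in> T" "T \<subseteq> N" "section_of A T W X" "\<forall>q\<in>T. W q = span {X q} \<and> X q \<noteq> 0"
proof -
  obtain T e where T: "p \<in> T" "T \<subseteq> N" "local_frame A T W {..<1::nat} e"
    using assms unfolding subbundle_def by blast
  have "{..<1::nat} = {0}" by auto
  then have e: "section_of A T W (e 0)" "\<And>q. q \<in> T \<Longrightarrow> independent {e 0 q} \<and> span {e 0 q} = W q"
    using T(3) by (auto simp: local_frame_def simp del: One_nat_def)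
  show thesis
  proof (rule that[OF T(1,2) e(1)])
    show "\<forall>q\<in>T. W q = span {e 0 q} \<and> e 0 q \<noteq> 0"
    proof (intro ballI conjI)
      show "W q = span {e 0 q}" if "q \<in> T" for q using e(2)[OF that] by simp
      show "e 0 q \<noteq> 0" if "q \<in> T" for q using e(2)[OF that] dependent_zero[of "{e 0 q}"] by auto
    qed
  qed
qed

lemma section_of_scaleR:
  assumes X: "section_of A S C X" and "\<And>q. q \<in> S \<Longrightarrow> subspace (C q)"
  shows "section_of A S C (\<lambda>q. c *\<^sub>R X q)"
  unfolding section_of_def
proof
  show "vector_field A S (\<lambda>q. c *\<^sub>R X q)"
  proof (rule vector_fieldI[OF section_of_opens[OF X]])
    show "c *\<^sub>R X p \<in> tangent A p" if "p \<in> S" for p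
      by (rule subspace_scale[OF subspace_tangent vector_field_tangent[OF section_of_field[OF X] that]])
    show "smooth_near A p (\<lambda>q. (c *\<^sub>R X q) f)" if "p \<in> S" "smooth_near A p f" for p f
      using smooth_near_cmult[OF vector_field_smooth_near[OF section_of_field[OF X] that], of c] by (simp add: scaleR_fun_def)
  qed
  show "\<forall>p\<in>S. c *\<^sub>R X p \<in> C p" using assms(2) section_of_mem[OF X] subspace_scale by blast
qed

text \<open>If \<open>\<omega>\<close> annihilates \<open>D\<close>, then \<open>d\<omega>(X, Y) = - \<omega>([X, Y])\<close> for sections \<open>X\<close> of \<open>W\<close> and \<open>Y\<close> of
  \<open>D\<close>, and \<open>d\<omega>\<close> is tensorial. So it suffices that the brackets of \<open>W\<close> with the
  generating sections of \<open>D\<close> lie in \<open>D\<close>: those with \<open>[\<Gamma>(U), \<Gamma>(W)]\<close> are the values of the double bracket.\<close>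

lemma line_bundle_le_characteristic:
  assumes W: "subbundle A N W 1"
    and dbl: "double_bracket_vanishes A N U W (bracket_span A N U W)" and p: "p \<in> N"
  shows "W p \<subseteq> characteristic A N (bracket_span A N U W) p"
proof
  let ?D = "bracket_span A N U W"
  fix w assume w: "w \<in> W p"
  obtain T e where T: "p \<in> T" "T \<subseteq> N" "section_of A T W e" and eW: "\<forall>q\<in>T. W q = span {e q} \<and> e q \<noteq> 0"
    using line_bundle_frame[OF W p] .
  have W_eq: "W q = span {e q}" if "q \<in> T" for q using eW that by simp
  obtain c where c: "w = c *\<^sub>R e p" using w W_eq[OF T(1)] by (auto simp: span_singleton)
  let ?X = "\<lambda>q. c *\<^sub>R e q"
  have X: "section_of A T W ?X" by (rule section_of_scaleR[OF T(3)]) (simp add: W_eq)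
  have "ext_deriv A \<omega> p w d = 0"
    if S: "p \<in> S" "S \<subseteq> N" and \<omega>: "one_form A S \<omega>" "\<forall>q\<in>S. \<forall>w\<in>?D q. \<omega> q w = 0" and d: "d \<in> ?D p" for S \<omega> d
  proof -
    let ?Q = "{v \<in> tangent A p. ext_deriv A \<omega> p w v = 0}"
    have oR: "opens (S \<inter> T)" "p \<in> S \<inter> T" using one_form_opens[OF \<omega>(1)] section_of_opens[OF X] S T by auto
    have wt: "w \<in> tangent A p" using vector_field_tangent[OF section_of_field[OF X] T(1)] c by simp
    have ann: "\<omega> q v = 0" if "q \<in> S" "v \<in> ?D q" for q v using \<omega>(2) that by blast
    have "?D p \<subseteq> ?Q"
    proof (rule bracket_span_minimal[OF oR subspace_ext_deriv_kernel[OF \<omega>(1) S(1) wt]])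
      fix S' Y assume S': "p \<in> S'" "S' \<subseteq> N \<inter> (S \<inter> T)" and Y: "section_of A S' U Y"
      have o: "opens S'" by (rule section_of_opens[OF Y])
      have X': "section_of A S' W ?X" by (rule section_of_subset[OF X o]) (use S' in auto)
      have "ext_deriv A \<omega> p (?X p) (Y p) = - \<omega> p (bracket A ?X Y p)"
        by (rule ext_deriv_annihilated[OF one_form_subset[OF \<omega>(1) o] section_of_field[OF X'] section_of_field[OF Y] S'(1)])
           (use S' in \<open>auto intro!: ann bracket_span_left[OF _ _ Y] bracket_span_right[OF _ _ X']\<close>)
      also have "\<omega> p (bracket A ?X Y p) = 0"
        by (intro ann S bracket_span_bracket'[OF S'(1) _ Y X']) (use S' in auto)
      finally show "Y p \<in> ?Q" using c vector_field_tangent[OF section_of_field[OF Y] S'(1)] by simp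
    next
      fix S' X' assume S': "p \<in> S'" "S' \<subseteq> N \<inter> (S \<inter> T)" and X': "section_of A S' W X'"
      have ep: "e p \<in> tangent A p" by (rule vector_field_tangent[OF section_of_field[OF T(3)] T(1)])
      obtain c' where c': "X' p = c' *\<^sub>R e p"
        using section_of_mem[OF X' S'(1)] W_eq[OF T(1)] by (auto simp: span_singleton)
      have "e p \<in> {v \<in> tangent A p. ext_deriv A \<omega> p (e p) v = 0}"
        using ep ext_deriv_self[OF \<omega>(1) S(1) ep] by simp
      then have "w \<in> {v \<in> tangent A p. ext_deriv A \<omega> p (e p) v = 0}"
        unfolding c by (rule subspace_scale[OF subspace_ext_deriv_kernel[OF \<omega>(1) S(1) ep]])
      then have "e p \<in> ?Q" using ext_deriv_swap[OF \<omega>(1) S(1) ep wt] ep by simp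
      then show "X' p \<in> ?Q"
        unfolding c' by (rule subspace_scale[OF subspace_ext_deriv_kernel[OF \<omega>(1) S(1) wt]])
    next
      fix S' X' Y assume S': "p \<in> S'" "S' \<subseteq> N \<inter> (S \<inter> T)" and Y: "section_of A S' U Y" and X': "section_of A S' W X'"
      have o: "opens S'" by (rule section_of_opens[OF Y])
      have XS: "section_of A S' W ?X" by (rule section_of_subset[OF X o]) (use S' in auto)
      note f = section_of_field[OF XS] section_of_field[OF Y] section_of_field[OF X']
      have "ext_deriv A \<omega> p (?X p) (bracket A Y X' p) = - \<omega> p (bracket A ?X (bracket A Y X') p)"
        by (rule ext_deriv_annihilated[OF one_form_subset[OF \<omega>(1) o] f(1) bracket_vector_field[OF f(2,3)] S'(1)])
           (use S' in \<open>auto intro!: ann bracket_span_right[OF _ _ XS] bracket_span_bracket[OF _ _ Y X']\<close>)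
      also have "\<omega> p (bracket A ?X (bracket A Y X') p) = 0"
      proof (rule ann[OF S(1)])
        have "residue_class (?D p) (bracket A ?X (bracket A X' Y) p) = ?D p"
          using dbl XS X' Y S' unfolding double_bracket_vanishes_def double_bracket_mod_def by blast
        moreover have "bracket A ?X (bracket A X' Y) p + 0 \<in> residue_class (?D p) (bracket A ?X (bracket A X' Y) p)"
          unfolding residue_class_def using subspace_0[OF subspace_bracket_span] by (rule imageI)
        ultimately have "bracket A ?X (bracket A X' Y) p \<in> ?D p" by simp
        then have "- bracket A ?X (bracket A X' Y) p \<in> ?D p" by (rule subspace_neg[OF subspace_bracket_span])
        then show "bracket A ?X (bracket A Y X') p \<in> ?D p"
          unfolding bracket_swap_inner[OF f(1) f(3) f(2) S'(1)] .
      qed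
      finally show "bracket A Y X' p \<in> ?Q" using c bracket_tangent[OF f(2,3) S'(1)] by simp
    qed
    then show ?thesis using d by auto
  qed
  moreover have "w \<in> ?D p" using bracket_span_right[OF T(1,2) X] c by simp
  ultimately show "w \<in> characteristic A N ?D p" unfolding characteristic_def by blast
qed

end

section \<open>The canonical bundles in affine coordinates\<close>

context affine_chart
begin

sublocale P: coordinates "proj_atlas A H :: ('a lpoint, 'e \<times> 'f) chart set" domain \<psi>
proof -
  interpret P: smooth_atlas "proj_atlas A H :: ('a lpoint, 'e \<times> 'f) chart set" by (rule smooth_atlas_proj_atlas)
  show "coordinates (proj_atlas A H :: ('a lpoint, 'e \<times> 'f) chart set) domain \<psi>"
    by unfold_locales (rule chart_mem)
qed

abbreviation \<B> :: "('a lpoint, 'e \<times> 'f) chart set" where "\<B> \<equiv> proj_atlas A H"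

text \<open>On the fibre over \<open>u\<close>, the vector \<open>frame_part u k\<close> represents the value on the normalized generator of the
  line of the homomorphism \<open>L \<rightarrow> H/L\<close> that corresponds to the vertical vector \<open>(0, k)\<close>.\<close>

definition frame_part :: "'e \<Rightarrow> 'f \<Rightarrow> 'e" where
  "frame_part u k = (\<Sum>b\<in>Basis. (k \<bullet> b) *\<^sub>R field_rep (e (Some b)) u)"

definition line_rep :: "'e \<times> 'f \<Rightarrow> 'e" where
  "line_rep y = field_rep (e None) (fst y) + frame_part (fst y) (snd y)"

definition point_generator :: "'a lpoint \<Rightarrow> 'a tvec" where
  "point_generator q = generator (fst q) (snd (\<psi> q))"

lemma domain_point:
  assumes "q \<in> domain"
  shows "fst q \<in> S" "fst q \<in> U" "snd q = span {point_generator q}" "fst (\<psi> q) = \<phi> (fst q)"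
proof -
  obtain x z where "x \<in> S" "q = (x, span {generator x z})" using assms by (auto simp: domain_iff)
  then show "fst q \<in> S" "fst q \<in> U" "snd q = span {point_generator q}" "fst (\<psi> q) = \<phi> (fst q)"
    using S(2) by (auto simp: \<psi>_eq point_generator_def)
qed

lemma linear_frame_part: "linear (frame_part u)"
  by (rule linearI) (auto simp: frame_part_def inner_add_left scaleR_add_left sum.distrib scaleR_sum_right)

lemma components_frame_sum:
  assumes "x \<in> S"
  shows "components (\<Sum>b\<in>Basis. (k \<bullet> b) *\<^sub>R e (Some b) x) = frame_part (\<phi> x) k"
  using assms S(2) by (auto simp: frame_part_def linear_sum[OF linear_components] components_scaleR field_rep_at)

lemma components_generator: "x \<in> S \<Longrightarrow> components (generator x z) = line_rep (\<phi> x, z)"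
  using S(2) by (auto simp: generator_def components_add components_frame_sum line_rep_def field_rep_at)

lemma components_point_generator: "q \<in> domain \<Longrightarrow> components (point_generator q) = line_rep (\<psi> q)"
  using components_generator[OF domain_point(1)] by (simp add: point_generator_def flip: domain_point(4))

lemma H_subset_tangent: "x \<in> S \<Longrightarrow> H x \<subseteq> tangent A x"
proof
  fix v assume x: "x \<in> S" and "v \<in> H x"
  then obtain c where "v = (\<Sum>i\<in>frame_indices. c i *\<^sub>R e i x)" by (rule local_frame_span[OF frame finite_frame_indices])
  then show "v \<in> tangent A x"
    using vector_field_tangent[OF local_frame_field[OF frame] x]
    by (auto intro!: subspace_sum subspace_scale subspace_tangent simp del: sum.insert)
qed

lemma open_\<phi>S: "open (\<phi> ` S)"
  using open_image[OF S(1)] S(2) by (simp add: Int_absorb2)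

lemma smooth_frame_rep: "i \<in> frame_indices \<Longrightarrow> smooth_on (\<phi> ` S) (field_rep (e i))"
  using smooth_field_rep[OF local_frame_field[OF frame]] S(2) by (simp add: Int_absorb2)

lemma smooth_on_base:
  fixes F :: "'e \<Rightarrow> 'g::real_normed_vector"
  assumes "smooth_on (\<phi> ` S) F" "open G" "G \<subseteq> coord_domain"
  shows "smooth_on G (\<lambda>y. F (fst y))"
  by (rule smooth_on_compose[OF assms(1,2) open_\<phi>S]) (use assms in \<open>auto intro!: smooth_intros\<close>)

lemma smooth_frame_part:
  assumes "open G" "G \<subseteq> coord_domain" "smooth_on G k"
  shows "smooth_on G (\<lambda>y. frame_part (fst y) (k y))"
  unfolding frame_part_def
  by (intro smooth_intros smooth_on_base assms smooth_frame_rep) auto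

lemma smooth_line_rep: "open G \<Longrightarrow> G \<subseteq> coord_domain \<Longrightarrow> smooth_on G line_rep"
  unfolding line_rep_def[abs_def]
  by (intro smooth_intros smooth_on_base smooth_frame_part smooth_frame_rep) auto

lemma line_rep_shift: "line_rep (u, z + s *\<^sub>R k) = line_rep (u, z) + s *\<^sub>R frame_part u k"
  by (simp add: line_rep_def linear_add[OF linear_frame_part] linear_cmul[OF linear_frame_part])

lemma frame_rep_sum:
  "(\<Sum>i\<in>frame_indices. \<gamma> i *\<^sub>R field_rep (e i) u) =
    \<gamma> None *\<^sub>R line_rep (u, z) + frame_part u (\<Sum>b\<in>Basis. (\<gamma> (Some b) - \<gamma> None * (z \<bullet> b)) *\<^sub>R b)"
proof -
  have "frame_part u (\<Sum>b\<in>Basis. (\<gamma> (Some b) - \<gamma> None * (z \<bullet> b)) *\<^sub>R b) =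
      (\<Sum>b\<in>Basis. (\<gamma> (Some b) - \<gamma> None * (z \<bullet> b)) *\<^sub>R field_rep (e (Some b)) u)"
    by (simp add: frame_part_def)
  then show ?thesis
    unfolding sum_frame_indices
    by (simp add: line_rep_def frame_part_def scaleR_add_right scaleR_sum_right scaleR_diff_left sum_subtractf)
qed

lemma frame_rep_combination_zero:
  assumes "u \<in> \<phi> ` S" "c *\<^sub>R line_rep (u, z) + frame_part u k = 0"
  shows "c = 0" "k = 0"
proof -
  let ?c = "\<lambda>i. case i of None \<Rightarrow> c | Some b \<Rightarrow> c * (z \<bullet> b) + k \<bullet> b"
  have "(\<Sum>i\<in>frame_indices. ?c i *\<^sub>R field_rep (e i) u) = c *\<^sub>R line_rep (u, z) + frame_part u k"
    unfolding sum_frame_indices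
    by (simp add: line_rep_def frame_part_def scaleR_add_right scaleR_add_left scaleR_sum_right sum.distrib)
  then have "?c i = 0" if "i \<in> frame_indices" for i
    using field_rep_frame_independent[OF frame finite_frame_indices _ _ that, of u ?c] assms S(2) by (simp add: Int_absorb2)
  from this[of None] this[of "Some _"] show "c = 0" "k = 0"
    by (auto intro!: euclidean_eqI[of k])
qed

lemma line_rep_nonzero: "u \<in> \<phi> ` S \<Longrightarrow> line_rep (u, z) \<noteq> 0"
  using frame_rep_combination_zero(1)[of u 1 z 0] by (auto simp: linear_0[OF linear_frame_part])

lemma smooth_near_pullback:
  assumes "q \<in> domain" "smooth_near A (fst q) g"
  shows "smooth_near \<B> q (g \<circ> fst)"
proof -
  obtain G where G: "open G" "\<phi> (fst q) \<in> G" "G \<subseteq> \<phi> ` U" "smooth_on G (g \<circ> \<iota>)"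
    using smooth_nearD[OF assms(2) domain_point(2)[OF assms(1)]] .
  let ?G = "(G \<inter> \<phi> ` S) \<times> (UNIV :: 'f set)"
  have o: "open ?G" using G(1) open_\<phi>S by (intro open_Times open_Int) auto
  show ?thesis
  proof (rule P.smooth_nearI[OF assms(1) o])
    show "smooth_on ?G (\<lambda>y. (g \<circ> \<iota>) (fst y))"
      by (rule smooth_on_compose[OF G(4) o G(1)]) (auto intro!: smooth_intros o)
    show "(g \<circ> fst) (P.\<iota> y) = (g \<circ> \<iota>) (fst y)" if "y \<in> ?G" for y
      using that S(2) by (auto simp: inv_\<psi> subset_iff)
    show "\<psi> q \<in> ?G" using G(2) domain_point[OF assms(1)] by (auto simp: mem_Times_iff)
    show "?G \<subseteq> \<psi> ` domain" unfolding \<psi>_domain by auto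
  qed
qed

lemma pushforward_eq:
  assumes q: "q \<in> domain" and v: "v \<in> tangent \<B> q"
  shows "pushforward A fst q v = tangent_of (fst q) (fst (P.components v))"
proof
  fix g
  show "pushforward A fst q v g = tangent_of (fst q) (fst (P.components v)) g"
  proof (cases "smooth_near A (fst q) g")
    case True
    obtain G where G: "open G" "\<phi> (fst q) \<in> G" "G \<subseteq> \<phi> ` U" "smooth_on G (g \<circ> \<iota>)"
      using smooth_nearD[OF True domain_point(2)[OF q]] .
    have \<psi>q: "\<psi> q \<in> coord_domain" using q \<psi>_domain by blast
    have "v (g \<circ> fst) = frechet_derivative ((g \<circ> fst) \<circ> P.\<iota>) (at (\<psi> q)) (P.components v)"
      by (rule P.tangent_apply[OF q v smooth_near_pullback[OF q True]])
    also have "frechet_derivative ((g \<circ> fst) \<circ> P.\<iota>) (at (\<psi> q)) = frechet_derivative (\<lambda>y. (g \<circ> \<iota>) (fst y)) (at (\<psi> q))"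
      by (rule frechet_derivative_cong_open[OF open_coord_domain \<psi>q]) (use S(2) in \<open>auto simp: inv_\<psi> subset_iff\<close>)
    also have "\<dots> = (\<lambda>v. frechet_derivative (g \<circ> \<iota>) (at (fst (\<psi> q))) (fst v))"
      by (rule frechet_derivative_eqI[OF smooth_on_compose_has_derivative[OF G(4)]])
         (use G(2) domain_point[OF q] in \<open>auto intro!: derivative_eq_intros\<close>)
    finally show ?thesis using True domain_point[OF q] by (simp add: pushforward_def tangent_of_def o_def)
  qed (simp add: pushforward_def tangent_of_def)
qed

lemma pushforward_components:
  assumes "q \<in> domain" "v \<in> tangent \<B> q"
  shows "pushforward A fst q v \<in> tangent A (fst q)" "components (pushforward A fst q v) = fst (P.components v)"
  using assms domain_point[OF assms(1)] by (auto simp: pushforward_eq tangent_of_tangent)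

lemma V_bundle_iff:
  assumes "q \<in> domain"
  shows "v \<in> V_bundle A \<B> q \<longleftrightarrow> v \<in> tangent \<B> q \<and> fst (P.components v) = 0"
proof -
  have "pushforward A fst q v = 0 \<longleftrightarrow> fst (P.components v) = 0" if "v \<in> tangent \<B> q"
    using components_eq_iff[OF domain_point(2)[OF assms] pushforward_components(1)[OF assms that] subspace_0[OF subspace_tangent]]
    unfolding pushforward_components(2)[OF assms that] by simp
  then show ?thesis by (auto simp: V_bundle_def)
qed

lemma E_bundleD:
  assumes "q \<in> domain" "v \<in> E_bundle A \<B> q"
  obtains c where "v \<in> tangent \<B> q" "fst (P.components v) = c *\<^sub>R line_rep (\<psi> q)"
proof -
  have v: "v \<in> tangent \<B> q" "pushforward A fst q v \<in> snd q" using assms(2) by (auto simp: E_bundle_def)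
  then obtain c where "pushforward A fst q v = c *\<^sub>R point_generator q"
    using domain_point(3)[OF assms(1)] by (auto simp: span_singleton)
  then have "fst (P.components v) = c *\<^sub>R line_rep (\<psi> q)"
    using pushforward_components(2)[OF assms(1) v(1)] components_point_generator[OF assms(1)] by (simp add: components_scaleR)
  then show ?thesis using that v(1) by blast
qed

text \<open>The line spanned by \<open>l + t h(l)\<close> has the affine coordinates \<open>(z\<^sub>b + t \<mu>\<^sub>b) / (1 + t \<mu>\<^sub>0)\<close>, where \<open>\<mu>\<close> are the
  coefficients of \<open>h(l)\<close>; differentiate at \<open>t = 0\<close>.\<close>

lemma hom_to_vertical_eq:
  assumes q: "q \<in> domain" and h: "linear h"
    and \<mu>: "h (point_generator q) = (\<Sum>i\<in>frame_indices. \<mu> i *\<^sub>R e i (fst q))"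
  shows "hom_to_vertical \<B> q h =
    P.tangent_of q (0, \<Sum>b\<in>Basis. (\<mu> (Some b) - \<mu> None * (snd (\<psi> q) \<bullet> b)) *\<^sub>R b)"
proof
  fix f
  define x z where "x = fst q" and "z = snd (\<psi> q)"
  have x: "x \<in> S" using domain_point(1)[OF q] by (simp add: x_def)
  let ?m = "\<mu> None"
  let ?k = "\<Sum>b\<in>Basis. (\<mu> (Some b) - ?m * (z \<bullet> b)) *\<^sub>R b"
  let ?\<gamma> = "\<lambda>t. (fst q, (\<lambda>l. l + t *\<^sub>R h l) ` snd q)"
  let ?z = "\<lambda>t. \<Sum>b\<in>Basis. ((z \<bullet> b + t * \<mu> (Some b)) / (1 + t * ?m)) *\<^sub>R b"
  let ?g = "\<lambda>t. (\<phi> x, ?z t)"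
  have \<gamma>_g: "?\<gamma> t = P.\<iota> (?g t)" if t: "1 + t * ?m \<noteq> 0" for t
  proof -
    have "linear (\<lambda>l. l + t *\<^sub>R h l)"
      using h by (auto intro!: linearI simp: linear_add[OF h] linear_cmul[OF h] algebra_simps)
    then have "(\<lambda>l. l + t *\<^sub>R h l) ` snd q = span {point_generator q + t *\<^sub>R h (point_generator q)}"
      unfolding domain_point(3)[OF q] using linear_span_image[of "\<lambda>l. l + t *\<^sub>R h l" "{point_generator q}"] by simp
    also have "point_generator q + t *\<^sub>R h (point_generator q) =
        (1 + t * ?m) *\<^sub>R e None x + (\<Sum>b\<in>Basis. (z \<bullet> b + t * \<mu> (Some b)) *\<^sub>R e (Some b) x)"
      unfolding \<mu> sum_frame_indices
      unfolding point_generator_def generator_def x_def[symmetric] z_def[symmetric]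
      by (simp add: scaleR_add_right scaleR_add_left scaleR_sum_right sum.distrib)
    also have "\<dots> = (1 + t * ?m) *\<^sub>R generator x (?z t)"
      using t by (simp add: generator_def scaleR_add_right scaleR_sum_right)
    also have "span {\<dots>} = span {generator x (?z t)}" by (rule span_scaleR_singleton[OF t])
    finally have s: "(\<lambda>l. l + t *\<^sub>R h l) ` snd q = span {generator x (?z t)}" .
    show ?thesis unfolding inv_\<psi>[OF x] s by (simp only: x_def)
  qed
  have g0: "?g 0 = \<psi> q"
    using domain_point(4)[OF q] by (simp add: euclidean_representation prod_eq_iff z_def x_def)
  have \<gamma>0: "?\<gamma> 0 = q" using \<gamma>_g[of 0] g0 q by simp
  show "hom_to_vertical \<B> q h f =
    P.tangent_of q (0, \<Sum>b\<in>Basis. (\<mu> (Some b) - \<mu> None * (snd (\<psi> q) \<bullet> b)) *\<^sub>R b) f"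
  proof (cases "smooth_near \<B> q f")
    case True
    obtain G where G: "open G" "\<psi> q \<in> G" "G \<subseteq> \<psi> ` domain" "smooth_on G (f \<circ> P.\<iota>)"
      using P.smooth_nearD[OF True q] .
    have "((\<lambda>t. (z \<bullet> b + t * \<mu> (Some b)) / (1 + t * ?m)) has_derivative (\<lambda>s. s * (\<mu> (Some b) - ?m * (z \<bullet> b)))) (at 0)" for b
      by (auto intro!: derivative_eq_intros simp: algebra_simps)
    then have "(?z has_derivative (\<lambda>s. \<Sum>b\<in>Basis. (s * (\<mu> (Some b) - ?m * (z \<bullet> b))) *\<^sub>R b)) (at 0)"
      by (intro has_derivative_sum has_derivative_scaleR_left)
    then have "(?g has_derivative (\<lambda>s. (0, \<Sum>b\<in>Basis. (s * (\<mu> (Some b) - ?m * (z \<bullet> b))) *\<^sub>R b))) (at 0)"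
      by (intro has_derivative_Pair has_derivative_const)
    also have "(\<lambda>s. (0 :: 'e, \<Sum>b\<in>Basis. (s * (\<mu> (Some b) - ?m * (z \<bullet> b))) *\<^sub>R b)) = (\<lambda>s. s *\<^sub>R (0, ?k))"
      by (simp add: scaleR_sum_right)
    finally have "((\<lambda>t. (f \<circ> P.\<iota>) (?g t)) has_derivative (\<lambda>s. frechet_derivative (f \<circ> P.\<iota>) (at (?g 0)) (s *\<^sub>R (0, ?k)))) (at 0)"
      by (rule smooth_on_compose_has_derivative[OF G(4)]) (use G(2) g0 in auto)
    then have d: "((\<lambda>t. (f \<circ> P.\<iota>) (?g t)) has_derivative (\<lambda>s. s * frechet_derivative (f \<circ> P.\<iota>) (at (\<psi> q)) (0, ?k))) (at 0)"
      unfolding g0 linear_cmul[OF linear_frechet_derivative_smooth[OF G(4,2)]] by simp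
    have o: "open {t. 1 + t * ?m \<noteq> 0}" by (intro open_Collect_neq continuous_intros)
    have "((\<lambda>t. f (?\<gamma> t)) has_derivative (\<lambda>s. s * frechet_derivative (f \<circ> P.\<iota>) (at (\<psi> q)) (0, ?k))) (at 0)"
      by (rule has_derivative_transform_within_open[OF d o]) (use \<gamma>_g in auto)
    then have "((\<lambda>t. f (?\<gamma> t)) has_field_derivative frechet_derivative (f \<circ> P.\<iota>) (at (\<psi> q)) (0, ?k)) (at 0)"
      by (rule has_derivative_imp_has_field_derivative) simp
    then have "deriv (\<lambda>t. f (?\<gamma> t)) 0 = frechet_derivative (f \<circ> P.\<iota>) (at (\<psi> q)) (0, ?k)"
      by (rule DERIV_imp_deriv)
    then show ?thesis
      unfolding hom_to_vertical_def velocity_def \<gamma>0 using True by (simp add: P.tangent_of_def z_def)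
  next
    case False
    then show ?thesis unfolding hom_to_vertical_def velocity_def \<gamma>0 by (simp add: P.tangent_of_def)
  qed
qed

end

section \<open>Contact forms in coordinates\<close>

lemma contact_form_kernel: "contact_form A H S \<theta> \<Longrightarrow> x \<in> S \<Longrightarrow> v \<in> H x \<longleftrightarrow> v \<in> tangent A x \<and> \<theta> x v = 0"
  unfolding contact_form_def by (elim conjE, drule bspec, assumption, elim conjE, simp)

lemma (in smooth_atlas) contact_form_subset:
  assumes "contact_form A H S \<theta>" "opens T" "T \<subseteq> S"
  shows "contact_form A H T \<theta>"
proof -
  have restrict: "\<forall>x\<in>T. Q x" if "\<forall>x\<in>S. Q x" for Q using that assms(3) by blast
  note c = assms(1)[unfolded contact_form_def]
  show ?thesis
    unfolding contact_form_def
    by (rule conjI[OF one_form_subset[OF conjunct1[OF c] assms(2,3)] restrict[OF conjunct2[OF c]]])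
qed

locale contact_chart = affine_chart A U \<phi> H e S
  for A :: "('a, 'e::euclidean_space) chart set" and U \<phi> H and e :: "'f::euclidean_space option \<Rightarrow> 'a \<Rightarrow> 'a tvec" and S +
  fixes \<theta> :: "'a \<Rightarrow> 'a tvec \<Rightarrow> real"
  assumes contact: "contact_form A H S \<theta>"
begin

lemma one_form_\<theta>: "one_form A S \<theta>"
  using contact by (simp add: contact_form_def)

definition contact_rep :: "'e \<Rightarrow> 'e" where "contact_rep = form_rep \<theta>"

text \<open>The exterior derivative of the contact form, in coordinates.\<close>

definition \<Omega> :: "'e \<Rightarrow> 'e \<Rightarrow> 'e \<Rightarrow> real" where
  "\<Omega> u a b = frechet_derivative contact_rep (at u) a \<bullet> b - frechet_derivative contact_rep (at u) b \<bullet> a"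

lemma smooth_contact_rep: "smooth_on (\<phi> ` S) contact_rep"
  using smooth_form_rep[OF one_form_\<theta>] S(2) by (simp add: contact_rep_def Int_absorb2)

lemma linear_D_contact_rep: "u \<in> \<phi> ` S \<Longrightarrow> linear (frechet_derivative contact_rep (at u))"
  by (rule linear_frechet_derivative_smooth[OF smooth_contact_rep])

lemma \<Omega>_add_right: "u \<in> \<phi> ` S \<Longrightarrow> \<Omega> u a (b + c) = \<Omega> u a b + \<Omega> u a c"
  and \<Omega>_scale_right: "u \<in> \<phi> ` S \<Longrightarrow> \<Omega> u a (r *\<^sub>R b) = r * \<Omega> u a b"
  and \<Omega>_swap: "\<Omega> u b a = - \<Omega> u a b"
  and \<Omega>_self: "\<Omega> u a a = 0"
  by (auto simp: \<Omega>_def linear_add[OF linear_D_contact_rep] linear_cmul[OF linear_D_contact_rep]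
      inner_add_left inner_add_right algebra_simps)

lemma \<Omega>_add_left: "u \<in> \<phi> ` S \<Longrightarrow> \<Omega> u (b + c) a = \<Omega> u b a + \<Omega> u c a"
  and \<Omega>_scale_left: "u \<in> \<phi> ` S \<Longrightarrow> \<Omega> u (r *\<^sub>R b) a = r * \<Omega> u b a"
  using \<Omega>_add_right[of u a b c] \<Omega>_scale_right[of u a r b] \<Omega>_swap[of u _ a] by auto

lemma \<Omega>_diff_right: "u \<in> \<phi> ` S \<Longrightarrow> \<Omega> u a (b - c) = \<Omega> u a b - \<Omega> u a c"
  using \<Omega>_add_right[of u a b "(-1) *\<^sub>R c"] \<Omega>_scale_right[of u a "-1" c] by simp

lemma \<Omega>_diff_left: "u \<in> \<phi> ` S \<Longrightarrow> \<Omega> u (b - c) a = \<Omega> u b a - \<Omega> u c a"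
  using \<Omega>_diff_right[of u a b c] \<Omega>_swap[of u _ a] by auto

lemma smooth_\<Omega>:
  assumes G: "open G" "G \<subseteq> coord_domain" and a: "smooth_on G a" and b: "smooth_on G b"
  shows "smooth_on G (\<lambda>y. \<Omega> (fst y) (a y) (b y))"
proof -
  have *: "smooth_on G (\<lambda>y. frechet_derivative contact_rep (at (fst y)) (c y))" if c: "smooth_on G c" for c
  proof -
    have "smooth_on G (\<lambda>y. \<Sum>i\<in>Basis. (c y \<bullet> i) *\<^sub>R frechet_derivative contact_rep (at (fst y)) i)"
      by (intro smooth_intros G c smooth_on_base smooth_on_frechet_derivative smooth_contact_rep)
    then show ?thesis
    proof (rule smooth_on_cong[OF _ G(1)])
      fix y assume "y \<in> G"
      then have "fst y \<in> \<phi> ` S" using G(2) by auto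
      from linear_euclidean_sum[OF linear_D_contact_rep[OF this], of "c y"]
      show "(\<Sum>i\<in>Basis. (c y \<bullet> i) *\<^sub>R frechet_derivative contact_rep (at (fst y)) i) =
        frechet_derivative contact_rep (at (fst y)) (c y)" by simp
    qed
  qed
  show ?thesis unfolding \<Omega>_def by (intro smooth_intros G(1) * a b)
qed

lemma \<theta>_eq: "x \<in> S \<Longrightarrow> v \<in> tangent A x \<Longrightarrow> \<theta> x v = contact_rep (\<phi> x) \<bullet> components v"
  using form_eq_rep[OF one_form_\<theta>, of x v] S(2) by (auto simp: contact_rep_def)

lemma ext_deriv_\<theta>: "x \<in> S \<Longrightarrow> v \<in> tangent A x \<Longrightarrow> w \<in> tangent A x \<Longrightarrow>
    ext_deriv A \<theta> x v w = \<Omega> (\<phi> x) (components v) (components w)"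
  using ext_deriv_rep[OF one_form_\<theta>, of x v w] S(2) by (auto simp: contact_rep_def \<Omega>_def)

lemma H_iff: "x \<in> S \<Longrightarrow> v \<in> H x \<longleftrightarrow> v \<in> tangent A x \<and> contact_rep (\<phi> x) \<bullet> components v = 0"
  using contact \<theta>_eq[of x v] by (auto simp: contact_form_def)

lemma \<Omega>_nondegenerate:
  assumes u: "u \<in> \<phi> ` S" and a: "contact_rep u \<bullet> a = 0"
    and ann: "\<And>b. contact_rep u \<bullet> b = 0 \<Longrightarrow> \<Omega> u a b = 0"
  shows "a = 0"
proof -
  obtain x where x: "x \<in> S" "x \<in> U" "u = \<phi> x" using u S(2) by auto
  let ?v = "tangent_of x a"
  have v: "?v \<in> H x" using x a by (simp add: H_iff tangent_of_tangent)
  have "ext_deriv A \<theta> x ?v w = 0" if "w \<in> H x" for w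
    using that x ann tangent_of_tangent[OF x(2)] by (simp add: H_iff ext_deriv_\<theta>)
  then have "?v = 0" using contact x(1) v unfolding contact_form_def by blast
  then show ?thesis using components_tangent_of[OF x(2), of a] by simp
qed

lemma contact_frame: "u \<in> \<phi> ` S \<Longrightarrow> contact_rep u \<bullet> frame_part u k = 0"
  and contact_line: "u \<in> \<phi> ` S \<Longrightarrow> contact_rep u \<bullet> line_rep (u, z) = 0"
proof -
  assume "u \<in> \<phi> ` S"
  then obtain x where x: "x \<in> S" "u = \<phi> x" by auto
  have "(\<Sum>b\<in>Basis. (k \<bullet> b) *\<^sub>R e (Some b) x) \<in> H x"
    using x(1) by (intro subspace_sum subspace_scale local_frame_subspace[OF frame] local_frame_mem[OF frame]) auto
  then show "contact_rep u \<bullet> frame_part u k = 0"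
    using x by (simp add: H_iff components_frame_sum)
  show "contact_rep u \<bullet> line_rep (u, z) = 0"
    using generator_mem[OF x(1), of z] x by (simp add: H_iff components_generator)
qed

lemma contact_hyperplane_decomposition:
  assumes u: "u \<in> \<phi> ` S" and a: "contact_rep u \<bullet> a = 0"
  obtains c k where "a = c *\<^sub>R line_rep (u, z) + frame_part u k"
proof -
  obtain x where x: "x \<in> S" "x \<in> U" "u = \<phi> x" using u S(2) by auto
  have "tangent_of x a \<in> H x" using x a by (simp add: H_iff tangent_of_tangent)
  then obtain \<gamma> where \<gamma>: "tangent_of x a = (\<Sum>i\<in>frame_indices. \<gamma> i *\<^sub>R e i x)"
    by (rule local_frame_span[OF frame finite_frame_indices x(1)])
  have "a = components (tangent_of x a)" using x(2) by simp
  also have "\<dots> = (\<Sum>i\<in>frame_indices. \<gamma> i *\<^sub>R field_rep (e i) u)"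
    unfolding \<gamma> linear_sum[OF linear_components] components_scaleR x(3) using field_rep_at[OF x(2)] by simp
  also have "\<dots> = \<gamma> None *\<^sub>R line_rep (u, z) + frame_part u (\<Sum>b\<in>Basis. (\<gamma> (Some b) - \<gamma> None * (z \<bullet> b)) *\<^sub>R b)"
    by (rule frame_rep_sum)
  finally show ?thesis by (rule that)
qed

lemma line_pairing_nonzero:
  assumes u: "u \<in> \<phi> ` S"
  obtains k where "\<Omega> u (line_rep (u, z)) (frame_part u k) \<noteq> 0"
proof -
  obtain b where b: "contact_rep u \<bullet> b = 0" "\<Omega> u (line_rep (u, z)) b \<noteq> 0"
    using \<Omega>_nondegenerate[OF u contact_line[OF u]] line_rep_nonzero[OF u] by metis
  obtain c k where "b = c *\<^sub>R line_rep (u, z) + frame_part u k"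
    by (rule contact_hyperplane_decomposition[OF u b(1)])
  then show ?thesis using that[of k] b(2) u by (simp add: \<Omega>_add_right \<Omega>_scale_right \<Omega>_self)
qed

text \<open>The double skew complement of a line is the line: subtract from \<open>a\<close> the multiple of the generator that makes it
  orthogonal to one fixed vector outside the complement of the line; the difference is orthogonal to the whole
  hyperplane.\<close>

lemma proportional_line_rep:
  assumes u: "u \<in> \<phi> ` S" and a: "contact_rep u \<bullet> a = 0"
    and perp: "\<Omega> u (line_rep (u, z)) a = 0"
    and ann: "\<And>k. \<Omega> u (line_rep (u, z)) (frame_part u k) = 0 \<Longrightarrow> \<Omega> u a (frame_part u k) = 0"
  obtains c where "a = c *\<^sub>R line_rep (u, z)"
proof -
  let ?l = "line_rep (u, z)"
  obtain k0 where k0: "\<Omega> u ?l (frame_part u k0) \<noteq> 0" using line_pairing_nonzero[OF u] .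
  let ?h = "frame_part u k0"
  let ?s = "\<Omega> u a ?h / \<Omega> u ?l ?h"
  have "a - ?s *\<^sub>R ?l = 0"
  proof (rule \<Omega>_nondegenerate[OF u])
    show "contact_rep u \<bullet> (a - ?s *\<^sub>R ?l) = 0" using a contact_line[OF u] by (simp add: inner_diff_right)
    fix b assume b: "contact_rep u \<bullet> b = 0"
    let ?r = "\<Omega> u ?l b / \<Omega> u ?l ?h"
    have "contact_rep u \<bullet> (b - ?r *\<^sub>R ?h) = 0" using b contact_frame[OF u] by (simp add: inner_diff_right)
    then obtain c k where ck: "b - ?r *\<^sub>R ?h = c *\<^sub>R ?l + frame_part u k" by (rule contact_hyperplane_decomposition[OF u])
    have "\<Omega> u ?l (b - ?r *\<^sub>R ?h) = 0" using k0 by (simp add: \<Omega>_diff_right[OF u] \<Omega>_scale_right[OF u])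
    then have "\<Omega> u ?l (frame_part u k) = 0" unfolding ck by (simp add: \<Omega>_add_right[OF u] \<Omega>_scale_right[OF u] \<Omega>_self)
    then have 1: "\<Omega> u a (b - ?r *\<^sub>R ?h) = 0" "\<Omega> u ?l (b - ?r *\<^sub>R ?h) = 0"
      unfolding ck using ann \<Omega>_swap[of u a ?l] perp by (simp_all add: \<Omega>_add_right[OF u] \<Omega>_scale_right[OF u] \<Omega>_self)
    then show "\<Omega> u (a - ?s *\<^sub>R ?l) b = 0"
      using k0 by (simp add: \<Omega>_diff_right[OF u] \<Omega>_scale_right[OF u] \<Omega>_diff_left[OF u] \<Omega>_scale_left[OF u] field_simps)
  qed
  then show ?thesis using that by simp
qed

text \<open>For sections of \<open>H\<close>, \<open>d\<theta>(v, w) = 0\<close> says that their bracket stays in \<open>H\<close>, whichever contact form is used.\<close>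

lemma ext_deriv_contact_form_independent:
  assumes x: "x \<in> S" and v: "v \<in> H x" and w: "w \<in> H x" and \<theta>': "x \<in> S'" "contact_form A H S' \<theta>'"
    and zero: "ext_deriv A \<theta> x v w = 0"
  shows "ext_deriv A \<theta>' x v w = 0"
proof -
  have "\<exists>V. vector_field A S V \<and> V x = v \<and> (\<forall>q\<in>S. V q \<in> H q)" if v: "v \<in> H x" for v
  proof -
    obtain c where c: "v = (\<Sum>i\<in>frame_indices. c i *\<^sub>R e i x)"
      by (rule local_frame_span[OF frame finite_frame_indices x v])
    let ?V = "\<lambda>q. tangent_of q (\<Sum>i\<in>frame_indices. c i *\<^sub>R field_rep (e i) (\<phi> q))"
    have V: "?V q = (\<Sum>i\<in>frame_indices. c i *\<^sub>R e i q)" if q: "q \<in> S" for q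
    proof -
      have qU: "q \<in> U" using q S(2) by auto
      have "tangent_of q (field_rep (e i) (\<phi> q)) = e i q" if "i \<in> frame_indices" for i
        using vector_field_tangent[OF local_frame_field[OF frame that] q] qU by (simp add: field_rep_at)
      then show ?thesis
        unfolding linear_sum[OF linear_tangent_of[OF qU]] linear_cmul[OF linear_tangent_of[OF qU]]
        by (intro sum.cong) auto
    qed
    have "vector_field A S ?V"
      by (rule vector_field_of_rep[OF S]) (intro smooth_intros open_\<phi>S smooth_frame_rep)
    moreover have "?V q \<in> H q" if "q \<in> S" for q
      unfolding V[OF that]
      by (intro subspace_sum subspace_scale local_frame_subspace[OF frame] local_frame_mem[OF frame] that)
    ultimately show ?thesis using V[OF x] c by auto
  qed
  then obtain V V' where V: "vector_field A S V" "V x = v" "\<forall>q\<in>S. V q \<in> H q"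
    "vector_field A S V'" "V' x = w" "\<forall>q\<in>S. V' q \<in> H q" using v w by metis
  let ?R = "S \<inter> S'"
  have \<theta>'f: "one_form A S' \<theta>'" using \<theta>'(2) by (simp add: contact_form_def)
  have R: "opens ?R" using S(1) one_form_opens[OF \<theta>'f] by auto
  have HR: "\<theta> q a = 0 \<longleftrightarrow> a \<in> H q" "\<theta>' q a = 0 \<longleftrightarrow> a \<in> H q" if "q \<in> ?R" "a \<in> tangent A q" for q a
    using that contact_form_kernel[OF contact] contact_form_kernel[OF \<theta>'(2)] by auto
  have vf: "vector_field A ?R V" "vector_field A ?R V'" using vector_field_subset R V by auto
  have t: "V q \<in> tangent A q" "V' q \<in> tangent A q" if "q \<in> ?R" for q using vector_field_tangent vf that by auto
  have xR: "x \<in> ?R" using x \<theta>'(1) by simp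
  have "ext_deriv A \<theta> x (V x) (V' x) = - \<theta> x (bracket A V V' x)"
    by (rule ext_deriv_annihilated[OF one_form_subset[OF one_form_\<theta> R] vf xR]) (use V HR t in auto)
  moreover have "ext_deriv A \<theta>' x (V x) (V' x) = - \<theta>' x (bracket A V V' x)"
    by (rule ext_deriv_annihilated[OF one_form_subset[OF \<theta>'f R] vf xR]) (use V HR t in auto)
  ultimately show ?thesis using zero HR[OF xR bracket_tangent[OF vf xR]] V by simp
qed

lemma skew_complement_iff:
  assumes x: "x \<in> S" and l: "l \<in> H x"
  shows "v \<in> skew_complement A H x (span {l}) \<longleftrightarrow>
    v \<in> tangent A x \<and> contact_rep (\<phi> x) \<bullet> components v = 0 \<and> \<Omega> (\<phi> x) (components l) (components v) = 0"
proof
  have \<phi>x: "\<phi> x \<in> \<phi> ` S" using x by auto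
  have lt: "l \<in> tangent A x" using l H_iff[OF x] by simp
  {
    assume v: "v \<in> skew_complement A H x (span {l})"
    then have "v \<in> H x" "ext_deriv A \<theta> x v l = 0"
      using x contact span_base[of l "{l}"] by (auto simp: skew_complement_def)
    then show "v \<in> tangent A x \<and> contact_rep (\<phi> x) \<bullet> components v = 0 \<and> \<Omega> (\<phi> x) (components l) (components v) = 0"
      using H_iff[OF x] ext_deriv_\<theta>[OF x _ lt] \<Omega>_swap[of "\<phi> x" "components l" "components v"] by auto
  next
    assume v: "v \<in> tangent A x \<and> contact_rep (\<phi> x) \<bullet> components v = 0 \<and> \<Omega> (\<phi> x) (components l) (components v) = 0"
    then have vH: "v \<in> H x" using H_iff[OF x] by simp
    have "ext_deriv A \<theta>' x v w = 0" if S': "x \<in> S'" "contact_form A H S' \<theta>'" and w: "w \<in> span {l}" for S' \<theta>' w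
    proof (rule ext_deriv_contact_form_independent[OF x vH _ S'])
      obtain c where c: "w = c *\<^sub>R l" using w by (auto simp: span_singleton)
      show "w \<in> H x" unfolding c by (rule subspace_scale[OF local_frame_subspace[OF frame x] l])
      have "w \<in> tangent A x" unfolding c by (rule subspace_scale[OF subspace_tangent lt])
      then show "ext_deriv A \<theta> x v w = 0"
        using v c \<Omega>_swap[of "\<phi> x" "components v" "components l"]
        by (simp add: ext_deriv_\<theta>[OF x] components_scaleR \<Omega>_scale_right[OF \<phi>x])
    qed
    then show "v \<in> skew_complement A H x (span {l})" using vH by (auto simp: skew_complement_def)
  }
qed

lemma skew_complement_point_iff:
  assumes q: "q \<in> domain"
  shows "v \<in> skew_complement A H (fst q) (snd q) \<longleftrightarrow>
    v \<in> tangent A (fst q) \<and> contact_rep (fst (\<psi> q)) \<bullet> components v = 0 \<and>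
    \<Omega> (fst (\<psi> q)) (line_rep (\<psi> q)) (components v) = 0"
  using skew_complement_iff[OF domain_point(1)[OF q], of "point_generator q"]
    generator_mem[OF domain_point(1)[OF q], of "snd (\<psi> q)"]
  by (simp add: domain_point(3,4)[OF q] point_generator_def[symmetric] components_point_generator[OF q])

lemma Eperp_bundle_iff:
  assumes q: "q \<in> domain"
  shows "v \<in> Eperp_bundle A H \<B> q \<longleftrightarrow> v \<in> tangent \<B> q \<and>
    contact_rep (fst (\<psi> q)) \<bullet> fst (P.components v) = 0 \<and>
    \<Omega> (fst (\<psi> q)) (line_rep (\<psi> q)) (fst (P.components v)) = 0"
  using pushforward_components[OF q] skew_complement_point_iff[OF q] by (auto simp: Eperp_bundle_def)

text \<open>Under the identification of vertical vectors with \<open>Hom(L, H/L)\<close>, the vector \<open>(0, k)\<close> maps a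
  generator of \<open>L\<close> to the class of \<open>\<Sum>b. k\<^sub>b e\<^sub>b\<close>.\<close>

lemma U_bundle_iff:
  assumes q: "q \<in> domain"
  shows "v \<in> U_bundle A H \<B> q \<longleftrightarrow> v \<in> tangent \<B> q \<and> fst (P.components v) = 0 \<and>
    \<Omega> (fst (\<psi> q)) (line_rep (\<psi> q)) (frame_part (fst (\<psi> q)) (snd (P.components v))) = 0"
proof
  let ?x = "fst q" and ?u = "fst (\<psi> q)" and ?z = "snd (\<psi> q)"
  note x = domain_point(1)[OF q]
  have u: "?u \<in> \<phi> ` S" using x domain_point(4)[OF q] by auto
  have lp: "line_rep (\<psi> q) = line_rep (?u, ?z)" by simp
  {
    assume "v \<in> U_bundle A H \<B> q"
    then obtain h where h: "v = hom_to_vertical \<B> q h" "linear h" "h ` snd q \<subseteq> skew_complement A H ?x (snd q)"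
      unfolding U_bundle_def by blast
    have "point_generator q \<in> snd q" using domain_point(3)[OF q] span_base by blast
    then have m: "h (point_generator q) \<in> skew_complement A H ?x (snd q)" using h(3) by blast
    then have "h (point_generator q) \<in> H ?x" by (simp add: skew_complement_def)
    then obtain \<mu> where \<mu>: "h (point_generator q) = (\<Sum>i\<in>frame_indices. \<mu> i *\<^sub>R e i ?x)"
      by (rule local_frame_span[OF frame finite_frame_indices x])
    let ?k = "\<Sum>b\<in>Basis. (\<mu> (Some b) - \<mu> None * (?z \<bullet> b)) *\<^sub>R b"
    have v: "v = P.tangent_of q (0, ?k)" unfolding h(1) by (rule hom_to_vertical_eq[OF q h(2) \<mu>])
    have "components (h (point_generator q)) = (\<Sum>i\<in>frame_indices. \<mu> i *\<^sub>R field_rep (e i) ?u)"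
      unfolding \<mu> linear_sum[OF linear_components] components_scaleR domain_point(4)[OF q]
      using field_rep_at[OF domain_point(2)[OF q]] by simp
    also have "\<dots> = \<mu> None *\<^sub>R line_rep (?u, ?z) + frame_part ?u ?k"
      by (rule frame_rep_sum)
    finally have "\<Omega> ?u (line_rep (\<psi> q)) (frame_part ?u ?k) = \<Omega> ?u (line_rep (\<psi> q)) (components (h (point_generator q)))"
      by (simp add: \<Omega>_add_right[OF u] \<Omega>_scale_right[OF u] \<Omega>_self)
    also have "\<dots> = 0" using m skew_complement_point_iff[OF q] by blast
    finally show "v \<in> tangent \<B> q \<and> fst (P.components v) = 0 \<and>
      \<Omega> ?u (line_rep (\<psi> q)) (frame_part ?u (snd (P.components v))) = 0"
      using v P.tangent_of_tangent[OF q] q by simp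
  next
    assume v: "v \<in> tangent \<B> q \<and> fst (P.components v) = 0 \<and>
      \<Omega> ?u (line_rep (\<psi> q)) (frame_part ?u (snd (P.components v))) = 0"
    let ?k = "snd (P.components v)"
    let ?m = "\<Sum>b\<in>Basis. (?k \<bullet> b) *\<^sub>R e (Some b) ?x"
    have "independent {point_generator q}"
      using generator_nonzero[OF x] by (simp add: point_generator_def dependent_single)
    then obtain h where h: "linear h" "h (point_generator q) = ?m"
      using linear_independent_extend[of "{point_generator q}" "\<lambda>_. ?m"] by auto
    have mH: "?m \<in> H ?x"
      using x by (intro subspace_sum subspace_scale local_frame_subspace[OF frame] local_frame_mem[OF frame]) auto
    have "h l \<in> skew_complement A H ?x (snd q)" if l: "l \<in> snd q" for l
    proof -
      obtain c where "l = c *\<^sub>R point_generator q" using l domain_point(3)[OF q] by (auto simp: span_singleton)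
      then have hl: "h l = c *\<^sub>R ?m" using linear_cmul[OF h(1)] h(2) by simp
      have "h l \<in> tangent A ?x" unfolding hl using mH H_subset_tangent[OF x] by (intro subspace_scale subspace_tangent) auto
      moreover have "components (h l) = c *\<^sub>R frame_part ?u ?k"
        unfolding hl components_scaleR components_frame_sum[OF x] domain_point(4)[OF q] ..
      ultimately show ?thesis
        using v by (simp add: skew_complement_point_iff[OF q] contact_frame[OF u] \<Omega>_scale_right[OF u])
    qed
    moreover have "hom_to_vertical \<B> q h = v"
    proof -
      let ?\<mu> = "\<lambda>i. case i of None \<Rightarrow> 0 | Some b \<Rightarrow> ?k \<bullet> b"
      have "h (point_generator q) = (\<Sum>i\<in>frame_indices. ?\<mu> i *\<^sub>R e i ?x)"
        unfolding sum_frame_indices h(2) by simp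
      from hom_to_vertical_eq[OF q h(1) this]
      have "hom_to_vertical \<B> q h = P.tangent_of q (0, ?k)" by (simp add: euclidean_representation)
      also have "(0, ?k) = P.components v" using v by (simp add: prod_eq_iff)
      finally show ?thesis using v q by simp
    qed
    ultimately show "v \<in> U_bundle A H \<B> q"
      unfolding U_bundle_def using h(1) by blast
  }
qed

end

section \<open>Two one-forms annihilating the bundle spanned by brackets\<close>

context contact_chart
begin

lemma line_rep_fibre_shift: "line_rep (y + s *\<^sub>R (0, k)) = line_rep y + s *\<^sub>R frame_part (fst y) k"
  by (cases y) (simp add: line_rep_shift)

lemma domain_base: "q \<in> domain \<Longrightarrow> fst (\<psi> q) \<in> \<phi> ` S"
  using domain_point(1,4) by auto

text \<open>The pullback of the contact form.\<close>

definition base_form :: "'a lpoint \<Rightarrow> 'a lpoint tvec \<Rightarrow> real" where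
  "base_form q v = (contact_rep (fst (\<psi> q)), 0) \<bullet> P.components v"

definition line_form_rep :: "'e \<times> 'f \<Rightarrow> 'e \<times> 'f" where
  "line_form_rep y = (\<Sum>b\<in>Basis. \<Omega> (fst y) (line_rep y) b *\<^sub>R b, 0)"

text \<open>The form \<open>d\<theta>(l, \<pi>\<^sub>* _)\<close>, with \<open>l\<close> the normalized generator of the line.\<close>

definition line_form :: "'a lpoint \<Rightarrow> 'a lpoint tvec \<Rightarrow> real" where
  "line_form q v = line_form_rep (\<psi> q) \<bullet> P.components v"

lemma \<Omega>_sum_Basis:
  assumes "u \<in> \<phi> ` S"
  shows "(\<Sum>b\<in>Basis. \<Omega> u a b *\<^sub>R b) \<bullet> w = \<Omega> u a w"
proof -
  have "linear (\<Omega> u a)" using assms by (auto intro!: linearI simp: \<Omega>_add_right \<Omega>_scale_right)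
  from linear_euclidean_sum[OF this, of w] show ?thesis
    by (simp add: inner_sum_left mult.commute inner_commute[of w])
qed

lemma base_form_eq: "base_form q v = contact_rep (fst (\<psi> q)) \<bullet> fst (P.components v)"
  by (simp add: base_form_def inner_prod_def)

lemma line_form_eq:
  "q \<in> domain \<Longrightarrow> line_form q v = \<Omega> (fst (\<psi> q)) (line_rep (\<psi> q)) (fst (P.components v))"
  by (simp add: line_form_def line_form_rep_def inner_prod_def \<Omega>_sum_Basis domain_base)

lemma one_form_base: "one_form \<B> domain base_form"
proof -
  have "smooth_on (\<psi> ` domain) (\<lambda>y. (contact_rep (fst y), 0 :: 'f))"
    unfolding \<psi>_domain
    by (intro smooth_intros smooth_on_base smooth_contact_rep open_coord_domain order_refl)
  from P.one_form_of_rep[OF P.opens_domain order_refl this] show ?thesis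
    unfolding base_form_def[abs_def] .
qed

lemma smooth_line_form_rep: "smooth_on coord_domain line_form_rep"
  unfolding line_form_rep_def[abs_def]
  by (intro smooth_intros smooth_\<Omega> smooth_line_rep open_coord_domain order_refl)

lemma one_form_line: "one_form \<B> domain line_form"
  using P.one_form_of_rep[OF P.opens_domain order_refl smooth_line_form_rep[folded \<psi>_domain]]
  unfolding line_form_def[abs_def] .

lemma Eperp_bundle_eq_kernel:
  "q \<in> domain \<Longrightarrow> v \<in> Eperp_bundle A H \<B> q \<longleftrightarrow> v \<in> tangent \<B> q \<and> base_form q v = 0 \<and> line_form q v = 0"
  by (simp add: Eperp_bundle_iff base_form_eq line_form_eq)

lemma subspace_Eperp_bundle: "q \<in> domain \<Longrightarrow> subspace (Eperp_bundle A H \<B> q)"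
  unfolding subspace_def
  by (auto simp: Eperp_bundle_eq_kernel base_form_def line_form_def P.components_add P.components_scaleR
      inner_add_right subspace_add subspace_scale subspace_0 P.subspace_tangent)

lemma ext_deriv_base_form:
  assumes q: "q \<in> domain" and v: "v \<in> tangent \<B> q" and w: "w \<in> tangent \<B> q"
  shows "ext_deriv \<B> base_form q v w = \<Omega> (fst (\<psi> q)) (fst (P.components v)) (fst (P.components w))"
proof -
  have \<psi>q: "\<psi> q \<in> coord_domain" using q \<psi>_domain by blast
  have "frechet_derivative (P.form_rep base_form) (at (\<psi> q)) =
      frechet_derivative (\<lambda>y. (contact_rep (fst y), 0 :: 'f)) (at (\<psi> q))"
    by (rule frechet_derivative_cong_open[OF open_coord_domain \<psi>q])
       (simp add: base_form_def[abs_def] P.form_rep_of_rep[where w="\<lambda>y. (contact_rep (fst y), 0)"] \<psi>_domain)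
  also have "\<dots> = (\<lambda>v. (frechet_derivative contact_rep (at (fst (\<psi> q))) (fst v), 0))"
    by (rule frechet_derivative_eqI, rule has_derivative_Pair,
        rule smooth_on_compose_has_derivative[OF smooth_contact_rep])
       (use domain_base[OF q] in \<open>auto intro!: derivative_eq_intros\<close>)
  finally show ?thesis
    using q by (simp add: P.ext_deriv_rep[OF one_form_base _ v w] \<Omega>_def inner_prod_def)
qed

text \<open>Along the fibres, the coefficients of the form are affine in the fibre coordinate.\<close>

lemma ext_deriv_line_form_vertical:
  assumes q: "q \<in> domain" and v: "v \<in> tangent \<B> q" "fst (P.components v) = 0" and w: "w \<in> tangent \<B> q"
  shows "ext_deriv \<B> line_form q v w =
    \<Omega> (fst (\<psi> q)) (frame_part (fst (\<psi> q)) (snd (P.components v))) (fst (P.components w))"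
proof -
  have \<psi>q: "\<psi> q \<in> coord_domain" using q \<psi>_domain by blast
  let ?u = "fst (\<psi> q)"
  let ?D = "frechet_derivative line_form_rep (at (\<psi> q))"
  have u: "?u \<in> \<phi> ` S" by (rule domain_base[OF q])
  have d: "(line_form_rep has_derivative ?D) (at (\<psi> q))"
    by (rule smooth_on_has_derivative[OF smooth_line_form_rep \<psi>q])
  obtain k where cv: "P.components v = (0, k)" using v(2) by (cases "P.components v") auto
  have 1: "?D (0, k) = (\<Sum>b\<in>Basis. \<Omega> ?u (frame_part ?u k) b *\<^sub>R b, 0)"
  proof (rule frechet_derivative_affine_line[OF d])
    fix s
    show "line_form_rep (\<psi> q + s *\<^sub>R (0, k)) =
        line_form_rep (\<psi> q) + s *\<^sub>R (\<Sum>b\<in>Basis. \<Omega> ?u (frame_part ?u k) b *\<^sub>R b, 0)"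
      unfolding line_form_rep_def line_rep_fibre_shift
      by (simp add: \<Omega>_add_left[OF u] \<Omega>_scale_left[OF u] scaleR_add_left sum.distrib scaleR_sum_right)
  qed
  have "((\<lambda>y. snd (line_form_rep y)) has_derivative (\<lambda>v. snd (?D v))) (at (\<psi> q))"
    by (rule has_derivative_snd[OF d])
  then have "((\<lambda>y. 0 :: 'f) has_derivative (\<lambda>v. snd (?D v))) (at (\<psi> q))"
    by (simp add: line_form_rep_def)
  then have 2: "snd (?D w) = 0" for w
    using has_derivative_unique[OF _ has_derivative_const] by metis
  have "frechet_derivative (P.form_rep line_form) (at (\<psi> q)) = ?D"
    by (rule frechet_derivative_cong_open[OF open_coord_domain \<psi>q])
       (simp add: line_form_def[abs_def] \<psi>_domain)
  then show ?thesis
    using q 2[of "P.components w"] \<Omega>_sum_Basis[OF u, of "frame_part ?u k" "fst (P.components w)"]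
    unfolding P.ext_deriv_rep[OF one_form_line IntI[OF q q] v(1) w] cv
    by (simp add: inner_prod_def 1)
qed

text \<open>A vertical vector in \<open>U\<close> extends to a section of \<open>U\<close>: correct the constant extension by a
  multiple of a vertical field transversal to \<open>U\<close>.\<close>

lemma U_bundle_extension:
  assumes q: "q \<in> domain" "q \<in> N" and N: "P.opens N" and v: "v \<in> U_bundle A H \<B> q"
  obtains R Y where "q \<in> R" "R \<subseteq> N" "section_of \<B> R (U_bundle A H \<B>) Y" "Y q = v"
proof -
  let ?u = "fst (\<psi> q)" and ?k = "snd (P.components v)"
  have u: "?u \<in> \<phi> ` S" by (rule domain_base[OF q(1)])
  obtain k0 where k0: "\<Omega> ?u (line_rep (\<psi> q)) (frame_part ?u k0) \<noteq> 0"
    using line_pairing_nonzero[OF u, of "snd (\<psi> q)"] by auto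
  define g where "g k y = \<Omega> (fst y) (line_rep y) (frame_part (fst y) k)" for k y
  have g: "smooth_on coord_domain (g k)" for k
    unfolding g_def[abs_def] by (intro smooth_\<Omega> smooth_line_rep smooth_frame_part open_coord_domain order_refl smooth_intros)
  define G where "G = \<psi> ` (N \<inter> domain) \<inter> (coord_domain \<inter> g k0 -` (- {0}))"
  have "open (coord_domain \<inter> g k0 -` (- {0}))"
    using continuous_on_open_vimage[OF open_coord_domain, THEN iffD1, OF smooth_on_continuous[OF g[of k0]], THEN spec, of "- {0}"]
    by (simp add: Int_commute open_Compl)
  then have oG: "open G" unfolding G_def by (rule open_Int[OF P.open_image[OF N]])
  have GD: "G \<subseteq> coord_domain" by (auto simp: G_def)
  let ?R = "P.\<iota> ` G"
  have R: "P.opens ?R" by (rule P.opens_chart_inverse[OF P.chart oG]) (use GD \<psi>_domain in simp)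
  have \<psi>G: "\<psi> (P.\<iota> y) = y" "P.\<iota> y \<in> domain" if "y \<in> G" for y
  proof -
    have "y \<in> \<psi> ` domain" using that GD unfolding \<psi>_domain by blast
    then show "\<psi> (P.\<iota> y) = y" "P.\<iota> y \<in> domain" by (rule f_inv_into_f, rule inv_into_into)
  qed
  have RN: "?R \<subseteq> N" "?R \<subseteq> domain" unfolding G_def by auto
  have \<psi>R: "\<psi> ` ?R = G" using \<psi>G by (auto simp: image_image)
  define \<kappa> where "\<kappa> y = ?k - (g ?k y / g k0 y) *\<^sub>R k0" for y
  have \<kappa>: "smooth_on (\<psi> ` ?R) (\<lambda>y. (0 :: 'e, \<kappa> y))"
    unfolding \<psi>R \<kappa>_def by (intro smooth_intros oG smooth_on_subset[OF g GD]) (auto simp: G_def)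
  let ?Y = "\<lambda>p. P.tangent_of p (0, \<kappa> (\<psi> p))"
  have Y: "section_of \<B> ?R (U_bundle A H \<B>) ?Y"
    unfolding section_of_def
  proof (intro conjI ballI)
    show "vector_field \<B> ?R ?Y" by (rule P.vector_field_of_rep[OF R RN(2) \<kappa>])
    fix p assume p: "p \<in> ?R"
    then have pd: "p \<in> domain" and nz: "g k0 (\<psi> p) \<noteq> 0" using RN \<psi>R by (auto simp: G_def)
    have "\<Omega> (fst (\<psi> p)) (line_rep (\<psi> p)) (frame_part (fst (\<psi> p)) (\<kappa> (\<psi> p))) =
        g ?k (\<psi> p) - g ?k (\<psi> p) / g k0 (\<psi> p) * g k0 (\<psi> p)"
      unfolding \<kappa>_def linear_diff[OF linear_frame_part] linear_cmul[OF linear_frame_part]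
        \<Omega>_diff_right[OF domain_base[OF pd]] \<Omega>_scale_right[OF domain_base[OF pd]] by (simp add: g_def)
    also have "\<dots> = 0" using nz by simp
    finally show "?Y p \<in> U_bundle A H \<B> p"
      using pd by (simp add: U_bundle_iff P.tangent_of_tangent)
  qed
  have \<psi>qG: "\<psi> q \<in> G" using q k0 \<psi>_domain by (auto simp: G_def g_def)
  have v': "v \<in> tangent \<B> q" "fst (P.components v) = 0" "g ?k (\<psi> q) = 0"
    using v U_bundle_iff[OF q(1)] by (auto simp: g_def)
  have "(0, \<kappa> (\<psi> q)) = P.components v" using v' by (simp add: \<kappa>_def prod_eq_iff)
  then have "?Y q = v" using v'(1) q(1) by simp
  moreover have "q \<in> ?R" using \<psi>qG q(1) by (metis P.inverse_chart image_eqI)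
  ultimately show ?thesis using that[of ?R ?Y] RN(1) Y by blast
qed

end

section \<open>Contact path geometries\<close>

abbreviation (input) bracket_bundle where
  "bracket_bundle A H B N W \<equiv> bracket_span B N (U_bundle A H B) W"

locale contact_path_chart = contact_chart A U \<phi> H e S \<theta>
  for A :: "('a, 'e::euclidean_space) chart set" and U \<phi> H and e :: "'f::euclidean_space option \<Rightarrow> 'a \<Rightarrow> 'a tvec" and S \<theta> +
  fixes N :: "'a lpoint set" and W :: "'a lpoint \<Rightarrow> 'a lpoint tvec set"
  assumes path_geometry: "contact_path_geometry A H (proj_atlas A H :: ('a lpoint, 'e \<times> 'f) chart set) N W"
begin

lemma opens_N: "P.opens N" and line_bundle_W: "subbundle \<B> N W 1"
  using path_geometry by (auto simp: contact_path_geometry_def)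

lemma W_le_E: "q \<in> N \<Longrightarrow> w \<in> W q \<Longrightarrow> w \<in> E_bundle A \<B> q"
  and V_inter_W: "q \<in> N \<Longrightarrow> w \<in> W q \<Longrightarrow> w \<in> V_bundle A \<B> q \<Longrightarrow> w = 0"
  using path_geometry unfolding contact_path_geometry_def by blast+

lemma W_nonvertical:
  assumes "q \<in> domain" "q \<in> N" "w \<in> W q" "w \<noteq> 0"
  obtains c where "c \<noteq> 0" "fst (P.components w) = c *\<^sub>R line_rep (\<psi> q)"
proof -
  obtain c where c: "w \<in> tangent \<B> q" "fst (P.components w) = c *\<^sub>R line_rep (\<psi> q)"
    using E_bundleD[OF assms(1) W_le_E[OF assms(2,3)]] .
  have "c \<noteq> 0" using c assms(4) V_inter_W[OF assms(2,3)] V_bundle_iff[OF assms(1)] by auto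
  then show ?thesis using that c by blast
qed

text \<open>Modulo \<open>L\<close>, the bracket of a section of \<open>U\<close> with a section of \<open>W\<close> projects to the value of the
  corresponding homomorphism \<open>L \<rightarrow> L\<^sup>\<bottom>/L\<close>: differentiate the generator of the line along the fibre.\<close>

lemma bracket_U_W_components:
  assumes q: "q \<in> R" "q \<in> domain" and R: "R \<subseteq> N"
    and Y: "section_of \<B> R (U_bundle A H \<B>) Y" and X: "section_of \<B> R W X"
    and c: "fst (P.components (X q)) = c *\<^sub>R line_rep (\<psi> q)"
  obtains \<mu> where "fst (P.components (bracket \<B> Y X q)) =
    c *\<^sub>R frame_part (fst (\<psi> q)) (snd (P.components (Y q))) + \<mu> *\<^sub>R line_rep (\<psi> q)"
proof -
  note Xf = P.section_of_field[OF X] and Yf = P.section_of_field[OF Y]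
  let ?G = "\<psi> ` (R \<inter> domain)"
  have oG: "open ?G" by (rule P.open_image[OF P.section_of_opens[OF X]])
  have GD: "?G \<subseteq> coord_domain" using \<psi>_domain by blast
  have qG: "\<psi> q \<in> ?G" using q by blast
  let ?u = "fst (\<psi> q)" and ?k = "snd (P.components (Y q))"
  let ?DX = "frechet_derivative (P.field_rep X) (at (\<psi> q))" and ?DY = "frechet_derivative (P.field_rep Y) (at (\<psi> q))"
  \<comment> \<open>the factor with \<open>\<pi>\<^sub>*X = l \<cdot> line_rep\<close>, written so that it is visibly smooth\<close>
  define l where "l y = (fst (P.field_rep X y) \<bullet> line_rep y) / (line_rep y \<bullet> line_rep y)" for y
  have nz: "line_rep y \<noteq> 0" if "y \<in> ?G" for y
    using line_rep_nonzero[of "fst y" "snd y"] that GD by auto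
  have l: "smooth_on ?G l"
    unfolding l_def[abs_def] using nz
    by (intro smooth_intros oG P.smooth_field_rep[OF Xf] smooth_line_rep[OF oG GD]) auto
  have Xrep: "fst (P.field_rep X y) = l y *\<^sub>R line_rep y" if y: "y \<in> ?G" for y
  proof -
    obtain p where p: "p \<in> R" "p \<in> domain" "y = \<psi> p" using y by blast
    then obtain d where "fst (P.components (X p)) = d *\<^sub>R line_rep (\<psi> p)"
      using E_bundleD[OF p(2) W_le_E] P.section_of_mem[OF X p(1)] R by blast
    then have "fst (P.field_rep X y) = d *\<^sub>R line_rep y" using p by (simp add: P.field_rep_at)
    then show ?thesis using nz[OF y] by (simp add: l_def)
  qed
  have lq: "l (\<psi> q) = c"
    using Xrep[OF qG] c nz[OF qG] q by (simp add: P.field_rep_at)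
  have Yrep: "fst (P.field_rep Y y) = 0" if y: "y \<in> ?G" for y
  proof -
    obtain p where p: "p \<in> R" "p \<in> domain" "y = \<psi> p" using y by blast
    then show ?thesis using P.section_of_mem[OF Y p(1)] by (simp add: P.field_rep_at U_bundle_iff)
  qed
  have cY: "P.components (Y q) = (0, ?k)" using Yrep[OF qG] q by (simp add: P.field_rep_at prod_eq_iff)
  have dX: "((\<lambda>y. fst (P.field_rep X y)) has_derivative (\<lambda>v. fst (?DX v))) (at (\<psi> q))"
    by (rule has_derivative_fst[OF smooth_on_has_derivative[OF P.smooth_field_rep[OF Xf] qG]])
  have dY: "((\<lambda>y. fst (P.field_rep Y y)) has_derivative (\<lambda>v. fst (?DY v))) (at (\<psi> q))"
    by (rule has_derivative_fst[OF smooth_on_has_derivative[OF P.smooth_field_rep[OF Yf] qG]])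
  have "((\<lambda>y. 0) has_derivative (\<lambda>v. fst (?DY v))) (at (\<psi> q))"
    by (rule has_derivative_transform_within_open[OF dY oG qG]) (rule Yrep)
  then have Y0: "fst (?DY v) = 0" for v
    using has_derivative_unique[OF _ has_derivative_const] by metis
  have dL: "(line_rep has_derivative frechet_derivative line_rep (at (\<psi> q))) (at (\<psi> q))"
    by (rule smooth_on_has_derivative[OF smooth_line_rep[OF oG GD] qG])
  have L: "frechet_derivative line_rep (at (\<psi> q)) (0, ?k) = frame_part ?u ?k"
    by (rule frechet_derivative_affine_line[OF dL line_rep_fibre_shift])
  have "((\<lambda>y. l y *\<^sub>R line_rep y) has_derivative (\<lambda>v. fst (?DX v))) (at (\<psi> q))"
    by (rule has_derivative_transform_within_open[OF dX oG qG]) (rule Xrep)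
  moreover have "((\<lambda>y. l y *\<^sub>R line_rep y) has_derivative
      (\<lambda>v. l (\<psi> q) *\<^sub>R frechet_derivative line_rep (at (\<psi> q)) v + frechet_derivative l (at (\<psi> q)) v *\<^sub>R line_rep (\<psi> q))) (at (\<psi> q))"
    by (rule has_derivative_scaleR[OF smooth_on_has_derivative[OF l qG] dL])
  ultimately have "(\<lambda>v. fst (?DX v)) =
      (\<lambda>v. l (\<psi> q) *\<^sub>R frechet_derivative line_rep (at (\<psi> q)) v + frechet_derivative l (at (\<psi> q)) v *\<^sub>R line_rep (\<psi> q))"
    by (rule has_derivative_unique)
  then have "fst (?DX (0, ?k)) = c *\<^sub>R frame_part ?u ?k + frechet_derivative l (at (\<psi> q)) (0, ?k) *\<^sub>R line_rep (\<psi> q)"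
    using L lq by (simp add: fun_eq_iff)
  moreover have "fst (P.components (bracket \<B> Y X q)) = fst (?DX (0, ?k))"
    using P.components_bracket[OF Yf Xf, of q] q Y0 cY by simp
  ultimately have "fst (P.components (bracket \<B> Y X q)) =
      c *\<^sub>R frame_part ?u ?k + frechet_derivative l (at (\<psi> q)) (0, ?k) *\<^sub>R line_rep (\<psi> q)"
    by simp
  then show ?thesis by (rule that)
qed

lemma W_le_Eperp:
  assumes q: "q \<in> domain" "q \<in> N" and w: "w \<in> W q"
  shows "w \<in> Eperp_bundle A H \<B> q"
proof -
  obtain c where c: "w \<in> tangent \<B> q" "fst (P.components w) = c *\<^sub>R line_rep (\<psi> q)"
    using E_bundleD[OF q(1) W_le_E[OF q(2) w]] .
  then show ?thesis
    using domain_base[OF q(1)] contact_line[OF domain_base[OF q(1)], of "snd (\<psi> q)"]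
    by (simp add: Eperp_bundle_iff[OF q(1)] \<Omega>_scale_right \<Omega>_self)
qed

lemma bracket_span_le_Eperp:
  assumes q: "q \<in> domain" "q \<in> N"
  shows "bracket_bundle A H \<B> N W q \<subseteq> Eperp_bundle A H \<B> q"
proof (rule P.bracket_span_minimal[OF P.opens_domain q(1) subspace_Eperp_bundle[OF q(1)]])
  note u = domain_base[OF q(1)]
  fix R Y assume R: "q \<in> R" "R \<subseteq> N \<inter> domain" and Y: "section_of \<B> R (U_bundle A H \<B>) Y"
  show "Y q \<in> Eperp_bundle A H \<B> q"
    using P.section_of_mem[OF Y R(1)] U_bundle_iff[OF q(1)] \<Omega>_scale_right[OF u, of "line_rep (\<psi> q)" 0 0]
    by (simp add: Eperp_bundle_iff[OF q(1)])
  fix X assume X: "section_of \<B> R W X"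
  obtain c where c: "fst (P.components (X q)) = c *\<^sub>R line_rep (\<psi> q)"
    using E_bundleD[OF q(1) W_le_E[OF q(2) P.section_of_mem[OF X R(1)]]] by blast
  obtain \<mu> where "fst (P.components (bracket \<B> Y X q)) =
      c *\<^sub>R frame_part (fst (\<psi> q)) (snd (P.components (Y q))) + \<mu> *\<^sub>R line_rep (\<psi> q)"
    by (rule bracket_U_W_components[OF R(1) q(1) _ Y X c]) (use R in auto)
  moreover have "bracket \<B> Y X q \<in> tangent \<B> q"
    by (rule P.bracket_tangent[OF P.section_of_field[OF Y] P.section_of_field[OF X] R(1)])
  ultimately show "bracket \<B> Y X q \<in> Eperp_bundle A H \<B> q"
    using P.section_of_mem[OF Y R(1)] contact_frame[OF u] contact_line[OF u, of "snd (\<psi> q)"]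
    by (simp add: Eperp_bundle_iff[OF q(1)] U_bundle_iff[OF q(1)] \<Omega>_add_right[OF u] \<Omega>_scale_right[OF u] \<Omega>_self inner_add_right)
next
  fix R X assume R: "q \<in> R" "R \<subseteq> N \<inter> domain" and X: "section_of \<B> R W X"
  show "X q \<in> Eperp_bundle A H \<B> q" by (rule W_le_Eperp[OF q P.section_of_mem[OF X R(1)]])
qed

lemma forms_annihilate_bracket_span:
  assumes "q \<in> domain" "q \<in> N" "d \<in> bracket_bundle A H \<B> N W q"
  shows "d \<in> tangent \<B> q" "base_form q d = 0" "line_form q d = 0"
  using bracket_span_le_Eperp[OF assms(1,2)] assms(3) Eperp_bundle_eq_kernel[OF assms(1)] by auto

end

section \<open>The characteristic system under vanishing contact torsion\<close>

locale torsion_free_chart = contact_path_chart A U \<phi> H e S \<theta> N W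
  for A :: "('a, 'e::euclidean_space) chart set" and U \<phi> H and e :: "'f::euclidean_space option \<Rightarrow> 'a \<Rightarrow> 'a tvec" and S \<theta> N W +
  assumes torsion: "contact_torsion_vanishes A H (proj_atlas A H :: ('a lpoint, 'e \<times> 'f) chart set) N W"
begin

lemma double_bracket_Eperp:
  assumes q: "q \<in> R" "q \<in> domain" and R: "R \<subseteq> N"
    and X: "section_of \<B> R W X" and X': "section_of \<B> R W X'" and Y: "section_of \<B> R (U_bundle A H \<B>) Y"
  shows "bracket \<B> X (bracket \<B> X' Y) q \<in> Eperp_bundle A H \<B> q"
proof -
  have "residue_class (Eperp_bundle A H \<B> q) (bracket \<B> X (bracket \<B> X' Y) q) = Eperp_bundle A H \<B> q"
    using torsion q R X X' Y
    unfolding contact_torsion_vanishes_def double_bracket_vanishes_def double_bracket_mod_def by blast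
  moreover have "bracket \<B> X (bracket \<B> X' Y) q + 0 \<in> residue_class (Eperp_bundle A H \<B> q) (bracket \<B> X (bracket \<B> X' Y) q)"
    unfolding residue_class_def using subspace_0[OF subspace_Eperp_bundle[OF q(2)]] by (rule imageI)
  ultimately show ?thesis by simp
qed

text \<open>With \<open>\<alpha>\<close> for \<open>line_form\<close>: on sections \<open>Y\<close> of \<open>U\<close>, \<open>d\<alpha>(Y, X)\<close> pairs a vector of \<open>L\<^sup>\<bottom>\<close> with one of \<open>L\<close>; on
  sections of \<open>W\<close> use skew symmetry; on \<open>[Y, X']\<close> the value is \<open>- \<alpha>([X, [Y, X']])\<close>, the contact torsion.\<close>

lemma contraction_annihilates_bracket_span:
  assumes q: "q \<in> T" "q \<in> domain" and T: "T \<subseteq> N" and X: "section_of \<B> T W X"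
    and W: "W q = span {X q}" and d: "d \<in> bracket_bundle A H \<B> N W q"
  shows "ext_deriv \<B> line_form q (X q) d = 0"
proof -
  note u = domain_base[OF q(2)]
  have qN: "q \<in> N" using q T by auto
  have Xt: "X q \<in> tangent \<B> q" by (rule P.vector_field_tangent[OF P.section_of_field[OF X] q(1)])
  have oR: "P.opens (T \<inter> domain)" using P.section_of_opens[OF X] P.opens_domain by auto
  let ?Q = "{v \<in> tangent \<B> q. ext_deriv \<B> line_form q (X q) v = 0}"
  have Q: "subspace ?Q" by (rule P.subspace_ext_deriv_kernel[OF one_form_line q(2) Xt])
  obtain c where c: "fst (P.components (X q)) = c *\<^sub>R line_rep (\<psi> q)"
    using E_bundleD[OF q(2) W_le_E[OF qN P.section_of_mem[OF X q(1)]]] by blast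
  have "bracket_bundle A H \<B> N W q \<subseteq> ?Q"
  proof (rule P.bracket_span_minimal[OF oR _ Q])
    show "q \<in> T \<inter> domain" using q by simp
  next
    fix R Y assume R: "q \<in> R" "R \<subseteq> N \<inter> (T \<inter> domain)" and Y: "section_of \<B> R (U_bundle A H \<B>) Y"
    have Yq: "Y q \<in> tangent \<B> q" "fst (P.components (Y q)) = 0"
      "\<Omega> (fst (\<psi> q)) (line_rep (\<psi> q)) (frame_part (fst (\<psi> q)) (snd (P.components (Y q)))) = 0"
      using P.section_of_mem[OF Y R(1)] U_bundle_iff[OF q(2)] by auto
    have "ext_deriv \<B> line_form q (Y q) (X q) = 0"
      unfolding ext_deriv_line_form_vertical[OF q(2) Yq(1,2) Xt] c \<Omega>_scale_right[OF u]
      using Yq(3) \<Omega>_swap[of "fst (\<psi> q)" "line_rep (\<psi> q)"] by simp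
    then show "Y q \<in> ?Q" using P.ext_deriv_swap[OF one_form_line q(2) Xt Yq(1)] Yq(1) by simp
  next
    fix R X' assume R: "q \<in> R" "R \<subseteq> N \<inter> (T \<inter> domain)" and X': "section_of \<B> R W X'"
    obtain c' where c': "X' q = c' *\<^sub>R X q"
      using P.section_of_mem[OF X' R(1)] W by (auto simp: span_singleton)
    have "X q \<in> ?Q" using P.ext_deriv_self[OF one_form_line q(2) Xt] Xt by simp
    then show "X' q \<in> ?Q" unfolding c' by (rule subspace_scale[OF Q])
  next
    fix R X' Y assume R: "q \<in> R" "R \<subseteq> N \<inter> (T \<inter> domain)" and Y: "section_of \<B> R (U_bundle A H \<B>) Y" and X': "section_of \<B> R W X'"
    have o: "P.opens R" by (rule P.section_of_opens[OF Y])
    have XR: "section_of \<B> R W X" by (rule P.section_of_subset[OF X o]) (use R in auto)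
    note f = P.section_of_field[OF XR] P.section_of_field[OF Y] P.section_of_field[OF X']
    have RN: "R \<subseteq> N" "R \<subseteq> domain" using R by auto
    have "ext_deriv \<B> line_form q (X q) (bracket \<B> Y X' q) = - line_form q (bracket \<B> X (bracket \<B> Y X') q)"
    proof (rule P.ext_deriv_annihilated[OF P.one_form_subset[OF one_form_line o RN(2)] f(1) P.bracket_vector_field[OF f(2,3)] R(1)])
      fix p assume p: "p \<in> R"
      show "line_form p (X p) = 0"
        by (rule forms_annihilate_bracket_span(3)[OF _ _ P.bracket_span_right[OF p RN(1) XR]]) (use p RN in auto)
      show "line_form p (bracket \<B> Y X' p) = 0"
        by (rule forms_annihilate_bracket_span(3)[OF _ _ P.bracket_span_bracket[OF p RN(1) Y X']]) (use p RN in auto)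
    qed
    also have "bracket \<B> X (bracket \<B> Y X') q \<in> Eperp_bundle A H \<B> q"
      unfolding P.bracket_swap_inner[OF f(1,3,2) R(1)]
      by (rule subspace_neg[OF subspace_Eperp_bundle[OF q(2)] double_bracket_Eperp[OF R(1) q(2) RN(1) XR X' Y]])
    then have "line_form q (bracket \<B> X (bracket \<B> Y X') q) = 0" using Eperp_bundle_eq_kernel[OF q(2)] by blast
    finally show "bracket \<B> Y X' q \<in> ?Q" using P.bracket_tangent[OF f(2,3) R(1)] by simp
  qed
  then show ?thesis using d by auto
qed

text \<open>The test vectors for the nondegeneracy arguments: brackets realise all of \<open>L\<^sup>\<bottom>/L\<close>.\<close>

lemma adapted_bracket:
  assumes q: "q \<in> T" "q \<in> domain" and T: "T \<subseteq> N" and X: "section_of \<B> T W X"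
    and c: "fst (P.components (X q)) = c *\<^sub>R line_rep (\<psi> q)"
    and k: "\<Omega> (fst (\<psi> q)) (line_rep (\<psi> q)) (frame_part (fst (\<psi> q)) k) = 0"
  obtains d \<mu> where "d \<in> bracket_bundle A H \<B> N W q" "fst (P.components d) = c *\<^sub>R frame_part (fst (\<psi> q)) k + \<mu> *\<^sub>R line_rep (\<psi> q)"
proof -
  have "P.tangent_of q (0, k) \<in> U_bundle A H \<B> q"
    using q k by (simp add: U_bundle_iff P.tangent_of_tangent)
  then obtain R Y where R: "q \<in> R" "R \<subseteq> T" and Y: "section_of \<B> R (U_bundle A H \<B>) Y" "Y q = P.tangent_of q (0, k)"
    by (rule U_bundle_extension[OF q(2,1) P.section_of_opens[OF X]])
  have XR: "section_of \<B> R W X" by (rule P.section_of_subset[OF X P.section_of_opens[OF Y(1)] R(2)])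
  have RN: "R \<subseteq> N" using R T by auto
  obtain \<mu> where "fst (P.components (bracket \<B> Y X q)) =
      c *\<^sub>R frame_part (fst (\<psi> q)) (snd (P.components (Y q))) + \<mu> *\<^sub>R line_rep (\<psi> q)"
    by (rule bracket_U_W_components[OF R(1) q(2) RN Y(1) XR c])
  then have "fst (P.components (bracket \<B> Y X q)) = c *\<^sub>R frame_part (fst (\<psi> q)) k + \<mu> *\<^sub>R line_rep (\<psi> q)"
    using Y(2) q(2) by simp
  then show ?thesis by (rule that[OF P.bracket_span_bracket[OF R(1) RN Y(1) XR]])
qed

text \<open>Testing against the pullback of the contact form shows that the projection of a characteristic vector lies in \<open>L\<close>,
  so that subtracting a multiple of \<open>X\<close> leaves a vertical vector. The multiple of \<open>X\<close> does not contribute to \<open>d\<alpha>\<close> on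
  \<open>D\<close>, and testing the vertical vector against \<open>\<alpha>\<close> shows that it is zero.\<close>

lemma characteristic_le_W:
  assumes q: "q \<in> domain" "q \<in> N"
  shows "characteristic \<B> N (bracket_bundle A H \<B> N W) q \<subseteq> W q"
proof
  fix v assume v: "v \<in> characteristic \<B> N (bracket_bundle A H \<B> N W) q"
  let ?u = "fst (\<psi> q)" and ?l = "line_rep (\<psi> q)"
  note u = domain_base[OF q(1)]
  have vD: "v \<in> bracket_bundle A H \<B> N W q" using v by (simp add: characteristic_def)
  note vt = forms_annihilate_bracket_span[OF q vD]
  have oR: "P.opens (N \<inter> domain)" using opens_N P.opens_domain by auto
  have ann: "ext_deriv \<B> \<omega> q v d = 0"
    if "one_form \<B> domain \<omega>" "\<And>p d. p \<in> domain \<Longrightarrow> p \<in> N \<Longrightarrow> d \<in> bracket_bundle A H \<B> N W p \<Longrightarrow> \<omega> p d = 0" "d \<in> bracket_bundle A H \<B> N W q" for \<omega> d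
    by (rule characteristicD[OF v P.one_form_subset[OF that(1) oR] _ _ _ that(3)]) (use q that(2) in auto)
  have ann_base: "\<Omega> ?u (fst (P.components v)) (fst (P.components d)) = 0" if d: "d \<in> bracket_bundle A H \<B> N W q" for d
    using ann[OF one_form_base forms_annihilate_bracket_span(2) d]
      ext_deriv_base_form[OF q(1) vt(1) forms_annihilate_bracket_span(1)[OF q d]] by simp
  have ann_line: "ext_deriv \<B> line_form q v d = 0" if d: "d \<in> bracket_bundle A H \<B> N W q" for d
    by (rule ann[OF one_form_line forms_annihilate_bracket_span(3) d])
  obtain T X where T: "q \<in> T" "T \<subseteq> N" and X: "section_of \<B> T W X" and XW: "\<forall>p\<in>T. W p = span {X p} \<and> X p \<noteq> 0"
    using P.line_bundle_frame[OF line_bundle_W q(2)] .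
  have W: "W p = span {X p}" "X p \<noteq> 0" if "p \<in> T" for p using XW that by auto
  obtain c where c: "c \<noteq> 0" "fst (P.components (X q)) = c *\<^sub>R ?l"
    by (rule W_nonvertical[OF q P.section_of_mem[OF X T(1)] W(2)[OF T(1)]])
  have Xt: "X q \<in> tangent \<B> q" by (rule P.vector_field_tangent[OF P.section_of_field[OF X] T(1)])
  have XD: "X q \<in> bracket_bundle A H \<B> N W q" by (rule P.bracket_span_right[OF T X])
  have perp: "contact_rep ?u \<bullet> fst (P.components v) = 0" "\<Omega> ?u (line_rep (?u, snd (\<psi> q))) (fst (P.components v)) = 0"
    using vt(2,3) by (auto simp: base_form_eq line_form_eq[OF q(1)])
  have "\<Omega> ?u (fst (P.components v)) (frame_part ?u k) = 0" if k: "\<Omega> ?u (line_rep (?u, snd (\<psi> q))) (frame_part ?u k) = 0" for k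
  proof -
    obtain d \<mu> where "d \<in> bracket_bundle A H \<B> N W q" "fst (P.components d) = c *\<^sub>R frame_part ?u k + \<mu> *\<^sub>R ?l"
      using adapted_bracket[OF T(1) q(1) T(2) X c(2)] k by auto
    then show ?thesis
      using ann_base[of d] perp(2) c(1) \<Omega>_swap[of ?u "fst (P.components v)" ?l]
      by (simp add: \<Omega>_add_right[OF u] \<Omega>_scale_right[OF u])
  qed
  then obtain r where r: "fst (P.components v) = r *\<^sub>R ?l"
    using proportional_line_rep[OF u perp] by auto
  let ?v = "v - (r / c) *\<^sub>R X q"
  have vt': "?v \<in> tangent \<B> q" using vt(1) Xt by (intro subspace_diff subspace_scale P.subspace_tangent)
  have v0: "fst (P.components ?v) = 0" using r c by (simp add: P.components_diff P.components_scaleR)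
  let ?m = "snd (P.components ?v)"
  have ann': "\<Omega> ?u (frame_part ?u ?m) (fst (P.components d)) = 0" if d: "d \<in> bracket_bundle A H \<B> N W q" for d
  proof -
    have dt: "d \<in> tangent \<B> q" by (rule forms_annihilate_bracket_span(1)[OF q d])
    have "ext_deriv \<B> line_form q d (1 *\<^sub>R v + (- (r / c)) *\<^sub>R X q) = 0"
      using P.ext_deriv_linear[OF one_form_line q(1) dt vt(1) Xt, of 1 "- (r / c)"]
        P.ext_deriv_swap[OF one_form_line q(1) vt(1) dt] ann_line[OF d]
        P.ext_deriv_swap[OF one_form_line q(1) Xt dt]
        contraction_annihilates_bracket_span[OF T(1) q(1) T(2) X W(1)[OF T(1)] d] by simp
    then have "ext_deriv \<B> line_form q d ?v = 0" by (simp add: scaleR_minus_left)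
    then have "ext_deriv \<B> line_form q ?v d = 0" using P.ext_deriv_swap[OF one_form_line q(1) dt vt'] by simp
    then show ?thesis using ext_deriv_line_form_vertical[OF q(1) vt' v0 dt] by simp
  qed
  have "\<Omega> ?u (frame_part ?u ?m) ?l = 0"
    using ann'[OF XD] c \<Omega>_scale_right[OF u] by simp
  then have m: "\<Omega> ?u (line_rep (?u, snd (\<psi> q))) (frame_part ?u ?m) = 0" using \<Omega>_swap[of ?u ?l] by simp
  have "\<Omega> ?u (frame_part ?u ?m) (frame_part ?u k) = 0" if k: "\<Omega> ?u (line_rep (?u, snd (\<psi> q))) (frame_part ?u k) = 0" for k
  proof -
    obtain d \<mu> where "d \<in> bracket_bundle A H \<B> N W q" "fst (P.components d) = c *\<^sub>R frame_part ?u k + \<mu> *\<^sub>R ?l"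
      using adapted_bracket[OF T(1) q(1) T(2) X c(2)] k by auto
    then show ?thesis
      using ann'[of d] m c(1) \<Omega>_swap[of ?u "frame_part ?u ?m" ?l]
      by (simp add: \<Omega>_add_right[OF u] \<Omega>_scale_right[OF u])
  qed
  then obtain s where s: "frame_part ?u ?m = s *\<^sub>R line_rep (?u, snd (\<psi> q))"
    using proportional_line_rep[OF u contact_frame[OF u] m] by blast
  have "(- s) *\<^sub>R line_rep (?u, snd (\<psi> q)) + frame_part ?u ?m = 0" unfolding s by simp
  then have "?m = 0" by (rule frame_rep_combination_zero(2)[OF u])
  then have "P.components ?v = 0" using v0 by (simp add: prod_eq_iff)
  then have "?v = 0"
    using P.components_eq_iff[OF q(1) vt' subspace_0[OF P.subspace_tangent]] by simp
  then have "v = (r / c) *\<^sub>R X q" by simp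
  then show "v \<in> W q" unfolding W(1)[OF T(1)] by (simp add: span_base span_scale)
qed

text \<open>A bracket and a multiple of \<open>X\<close> match the projection of \<open>v\<close>, leaving a vertical vector still in the kernel. On
  vertical vectors the contraction of \<open>d\<alpha>\<close> with \<open>X\<close> is the pairing with \<open>L\<close>, whose kernel is \<open>U\<close>.\<close>

lemma contraction_kernel_le_bracket_span:
  assumes q: "q \<in> T" "q \<in> domain" and T: "T \<subseteq> N" and X: "section_of \<B> T W X"
    and W: "W q = span {X q}" "X q \<noteq> 0" and v: "v \<in> Eperp_bundle A H \<B> q"
    and zero: "ext_deriv \<B> line_form q (X q) v = 0"
  shows "v \<in> bracket_bundle A H \<B> N W q"
proof -
  let ?u = "fst (\<psi> q)" and ?l = "line_rep (\<psi> q)"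
  note u = domain_base[OF q(2)]
  have qN: "q \<in> N" using q T by auto
  obtain c where c: "c \<noteq> 0" "fst (P.components (X q)) = c *\<^sub>R ?l"
    by (rule W_nonvertical[OF q(2) qN P.section_of_mem[OF X q(1)] W(2)])
  have Xt: "X q \<in> tangent \<B> q" by (rule P.vector_field_tangent[OF P.section_of_field[OF X] q(1)])
  have XD: "X q \<in> bracket_bundle A H \<B> N W q" by (rule P.bracket_span_right[OF q(1) T X])
  have vE: "v \<in> tangent \<B> q" "contact_rep ?u \<bullet> fst (P.components v) = 0" "\<Omega> ?u ?l (fst (P.components v)) = 0"
    using v by (auto simp: Eperp_bundle_iff[OF q(2)])
  obtain r k where "fst (P.components v) = r *\<^sub>R line_rep (?u, snd (\<psi> q)) + frame_part ?u k"
    by (rule contact_hyperplane_decomposition[OF u vE(2)])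
  then have rk: "fst (P.components v) = r *\<^sub>R ?l + frame_part ?u k" by simp
  have "\<Omega> ?u ?l (frame_part ?u k) = 0"
    using vE(3) unfolding rk by (simp add: \<Omega>_add_right[OF u] \<Omega>_scale_right[OF u] \<Omega>_self)
  \<comment> \<open>\<open>\<pi>\<^sub>*X\<close> is \<open>c\<close> times the normalized generator\<close>
  then have "\<Omega> ?u ?l (frame_part ?u ((1 / c) *\<^sub>R k)) = 0"
    by (simp add: linear_cmul[OF linear_frame_part] \<Omega>_scale_right[OF u])
  then obtain d \<mu> where d: "d \<in> bracket_bundle A H \<B> N W q" "fst (P.components d) = c *\<^sub>R frame_part ?u ((1 / c) *\<^sub>R k) + \<mu> *\<^sub>R ?l"
    by (rule adapted_bracket[OF q T X c(2)])
  have d2: "fst (P.components d) = frame_part ?u k + \<mu> *\<^sub>R ?l"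
    using d(2) c(1) by (simp add: linear_cmul[OF linear_frame_part])
  define z where "z = d + ((r - \<mu>) / c) *\<^sub>R X q"
  have zD: "z \<in> bracket_bundle A H \<B> N W q"
    unfolding z_def by (intro subspace_add subspace_scale P.subspace_bracket_span d(1) XD)
  have zt: "z \<in> tangent \<B> q" by (rule forms_annihilate_bracket_span(1)[OF q(2) qN zD])
  have w: "v - z \<in> tangent \<B> q" using vE(1) zt by (intro subspace_diff P.subspace_tangent)
  have "fst (P.components z) = fst (P.components v)"
    using c by (simp add: z_def P.components_add P.components_scaleR d2 rk scaleR_diff_left)
  then have w0: "fst (P.components (v - z)) = 0" by (simp add: P.components_diff)
  let ?m = "snd (P.components (v - z))"
  have "ext_deriv \<B> line_form q (X q) (1 *\<^sub>R v + (-1) *\<^sub>R z) = 0"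
    using P.ext_deriv_linear[OF one_form_line q(2) Xt vE(1) zt, of 1 "-1"] zero
      contraction_annihilates_bracket_span[OF q T X W(1) zD] by simp
  then have "ext_deriv \<B> line_form q (X q) (v - z) = 0" by (simp add: scaleR_minus_left)
  then have "ext_deriv \<B> line_form q (v - z) (X q) = 0"
    using P.ext_deriv_swap[OF one_form_line q(2) Xt w] by simp
  then have "\<Omega> ?u (frame_part ?u ?m) ?l = 0"
    using c unfolding ext_deriv_line_form_vertical[OF q(2) w w0 Xt] by (simp add: \<Omega>_scale_right[OF u])
  then have "\<Omega> ?u ?l (frame_part ?u ?m) = 0" using \<Omega>_swap[of ?u ?l] by simp
  then have "v - z \<in> U_bundle A H \<B> q" using w w0 by (simp add: U_bundle_iff[OF q(2)])
  then obtain R Y where "q \<in> R" "R \<subseteq> N" "section_of \<B> R (U_bundle A H \<B>) Y" "Y q = v - z"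
    by (rule U_bundle_extension[OF q(2) qN opens_N])
  then have "v - z \<in> bracket_bundle A H \<B> N W q" using P.bracket_span_left by metis
  then have "(v - z) + z \<in> bracket_bundle A H \<B> N W q" using zD by (intro subspace_add P.subspace_bracket_span)
  then show ?thesis by simp
qed

text \<open>Apply the definition of the characteristic system to \<open>\<beta>\<close>, the contraction of \<open>d\<alpha>\<close> with a frame of \<open>W\<close>:
  the double bracket is in the kernel of \<open>\<beta>\<close>.\<close>

lemma double_bracket_in_bracket_span:
  assumes ch: "W q \<subseteq> characteristic \<B> N (bracket_bundle A H \<B> N W) q"
    and q: "q \<in> R" "q \<in> domain" and R: "R \<subseteq> N"
    and X1: "section_of \<B> R W X1" and X2: "section_of \<B> R W X2" and Y: "section_of \<B> R (U_bundle A H \<B>) Y"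
  shows "bracket \<B> X1 (bracket \<B> X2 Y) q \<in> bracket_bundle A H \<B> N W q"
proof -
  have qN: "q \<in> N" using q R by auto
  obtain T X where T: "q \<in> T" "T \<subseteq> N" and X: "section_of \<B> T W X" and XW: "\<forall>p\<in>T. W p = span {X p} \<and> X p \<noteq> 0"
    using P.line_bundle_frame[OF line_bundle_W qN] .
  have W: "W p = span {X p}" "X p \<noteq> 0" if "p \<in> T" for p using XW that by auto
  let ?T = "R \<inter> T \<inter> domain"
  have o: "P.opens ?T" using P.section_of_opens[OF X1] P.section_of_opens[OF X] P.opens_domain by auto
  have TN: "?T \<subseteq> N" "q \<in> ?T" using q R T by auto
  have X': "section_of \<B> ?T W X" by (rule P.section_of_subset[OF X o]) auto
  have X1': "section_of \<B> ?T W X1" by (rule P.section_of_subset[OF X1 o]) auto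
  have X2': "section_of \<B> ?T W X2" by (rule P.section_of_subset[OF X2 o]) auto
  have Y': "section_of \<B> ?T (U_bundle A H \<B>) Y" by (rule P.section_of_subset[OF Y o]) auto
  note f = P.section_of_field[OF X'] P.section_of_field[OF X1'] P.section_of_field[OF X2'] P.section_of_field[OF Y']
  define \<beta> where "\<beta> p = ext_deriv \<B> line_form p (X p)" for p
  have \<beta>: "one_form \<B> ?T \<beta>"
    unfolding \<beta>_def[abs_def] by (rule P.contraction_one_form[OF P.one_form_subset[OF one_form_line o] f(1)]) simp
  have \<beta>D: "\<beta> p d = 0" if "p \<in> ?T" "d \<in> bracket_bundle A H \<B> N W p" for p d
    unfolding \<beta>_def using that W by (intro contraction_annihilates_bracket_span[OF that(1) _ TN(1) X']) auto
  have D1: "X1 p \<in> bracket_bundle A H \<B> N W p" and D2: "bracket \<B> X2 Y p \<in> bracket_bundle A H \<B> N W p" if "p \<in> ?T" for p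
    using P.bracket_span_right[OF that TN(1) X1'] P.bracket_span_bracket'[OF that TN(1) Y' X2'] by auto
  have "ext_deriv \<B> \<beta> q (X1 q) (bracket \<B> X2 Y q) = - \<beta> q (bracket \<B> X1 (bracket \<B> X2 Y) q)"
    by (rule P.ext_deriv_annihilated[OF \<beta> f(2) P.bracket_vector_field[OF f(3,4)] TN(2)])
       (use \<beta>D D1 D2 in blast)+
  moreover have "ext_deriv \<B> \<beta> q (X1 q) (bracket \<B> X2 Y q) = 0"
    by (rule characteristicD[OF subsetD[OF ch P.section_of_mem[OF X1' TN(2)]] \<beta> TN(2,1) \<beta>D D2[OF TN(2)]])
  ultimately have "ext_deriv \<B> line_form q (X q) (bracket \<B> X1 (bracket \<B> X2 Y) q) = 0" by (simp add: \<beta>_def)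
  moreover have "bracket \<B> X1 (bracket \<B> X2 Y) q \<in> Eperp_bundle A H \<B> q"
    by (rule double_bracket_Eperp[OF q R X1 X2 Y])
  ultimately show ?thesis
    by (intro contraction_kernel_le_bracket_span[OF T(1) q(2) T(2) X W(1)[OF T(1)] W(2)[OF T(1)]])
qed

end

lemma smooth_atlas_contact_manifold: "contact_manifold n A H \<Longrightarrow> smooth_atlas A"
  unfolding contact_manifold_def smooth_manifold_def by unfold_locales blast+

text \<open>Shrink an affine chart to where a contact form is defined.\<close>

lemma torsion_free_chart_exists:
  fixes A :: "('a, 'e::euclidean_space) chart set" and N :: "'a lpoint set"
  assumes M: "contact_manifold n A H"
    and geom: "contact_path_geometry A H (proj_atlas A H :: ('a lpoint, 'e \<times> 'f::euclidean_space) chart set) N W"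
    and tors: "contact_torsion_vanishes A H (proj_atlas A H :: ('a lpoint, 'e \<times> 'f) chart set) N W"
    and p: "p \<in> N"
  obtains U \<phi> e S \<theta> where "torsion_free_chart A U \<phi> H (e :: 'f option \<Rightarrow> 'a \<Rightarrow> 'a tvec) S \<theta> N W"
    "p \<in> affine_chart.domain U \<phi> e S"
proof -
  let ?B = "proj_atlas A H :: ('a lpoint, 'e \<times> 'f) chart set"
  interpret M: smooth_atlas A by (rule smooth_atlas_contact_manifold[OF M])
  interpret B: smooth_atlas ?B by (rule M.smooth_atlas_proj_atlas)
  have N: "B.opens N" "N \<subseteq> proj_space A H" using geom by (auto simp: contact_path_geometry_def)
  obtain P \<xi> where P: "(P, \<xi>) \<in> ?B" "p \<in> P" by (rule B.opens_point_chart[OF N(1) p])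
  obtain U \<phi> e S where a: "affine_chart A U \<phi> H (e :: 'f option \<Rightarrow> 'a \<Rightarrow> 'a tvec) S"
    "P = affine_chart.domain U \<phi> e S"
    by (rule M.proj_atlas_affine_chart[OF P(1)])
  interpret a: affine_chart A U \<phi> H e S by (rule a(1))
  have pd: "p \<in> a.domain" using P(2) a(2) by simp
  then obtain z where z: "fst p \<in> S" "p = (fst p, span {a.generator (fst p) z})" by (auto simp: a.domain_iff)
  have "fst p \<in> carrier_of A" using p N(2) by (auto simp: proj_space_def)
  then obtain S0 \<theta> where S0: "fst p \<in> S0" "contact_form A H S0 \<theta>"
    using M unfolding contact_manifold_def by blast
  have "one_form A S0 \<theta>" using S0(2) by (simp add: contact_form_def)
  then have o: "M.opens (S \<inter> S0)" using M.one_form_opens a.S(1) by auto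
  interpret b: affine_chart A U \<phi> H e "S \<inter> S0"
  proof
    show "local_frame A (S \<inter> S0) H frame_indices e"
      by (rule M.local_frame_subset[OF a.frame o]) simp
  qed (use o a.S in auto)
  have \<theta>: "contact_form A H (S \<inter> S0) \<theta>"
    by (rule M.contact_form_subset[OF S0(2) o]) simp
  have "torsion_free_chart A U \<phi> H e (S \<inter> S0) \<theta> N W"
    by unfold_locales (use \<theta> geom tors in auto)
  moreover have "p \<in> b.domain"
    unfolding b.domain_iff using z S0(1) by (auto simp: a.generator_def b.generator_def)
  ultimately show ?thesis by (rule that)
qed

theorem proposition3p4:
  fixes n :: nat
    and A :: "('a, 'e::euclidean_space) chart set"
    and H :: "'a \<Rightarrow> 'a tvec set"
    and B :: "('a lpoint, 'e \<times> 'f::euclidean_space) chart set"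
    and N :: "'a lpoint set"
    and W :: "'a lpoint \<Rightarrow> 'a lpoint tvec set"
  assumes "n \<ge> 3"
    and "contact_manifold n A H"
    and "DIM('f) = 2 * n - 3"
    and "B = proj_atlas A H"
    and "contact_path_geometry A H B N W"
    and "contact_torsion_vanishes A H B N W"
  shows "secondary_contact_torsion_vanishes A H B N W \<longleftrightarrow>
    (\<forall>p\<in>N. W p = characteristic B N (bracket_span B N (U_bundle A H B) W) p)"
proof -
  let ?D = "bracket_span B N (U_bundle A H B) W"
  interpret M: smooth_atlas A by (rule smooth_atlas_contact_manifold[OF assms(2)])
  interpret B: smooth_atlas B unfolding assms(4) by (rule M.smooth_atlas_proj_atlas)
  note chart_exists = torsion_free_chart_exists[OF assms(2) assms(5,6)[unfolded assms(4)]]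
  have W: "subbundle B N W 1" using assms(5) by (simp add: contact_path_geometry_def)
  show ?thesis
  proof
    assume sec: "secondary_contact_torsion_vanishes A H B N W"
    show "\<forall>p\<in>N. W p = characteristic B N ?D p"
    proof (intro ballI equalityI)
      fix p assume p: "p \<in> N"
      show "W p \<subseteq> characteristic B N ?D p"
        using B.line_bundle_le_characteristic[OF W _ p] sec unfolding secondary_contact_torsion_vanishes_def by blast
      obtain U \<phi> e S \<theta> where c: "torsion_free_chart A U \<phi> H (e :: 'f option \<Rightarrow> 'a \<Rightarrow> 'a tvec) S \<theta> N W"
        "p \<in> affine_chart.domain U \<phi> e S" by (rule chart_exists[OF p])
      show "characteristic B N ?D p \<subseteq> W p"
        unfolding assms(4) by (rule torsion_free_chart.characteristic_le_W[OF c p])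
    qed
  next
    assume ch: "\<forall>p\<in>N. W p = characteristic B N ?D p"
    show "secondary_contact_torsion_vanishes A H B N W"
      unfolding secondary_contact_torsion_vanishes_def double_bracket_vanishes_def double_bracket_mod_def
    proof (intro allI impI ballI)
      fix R X X' Y p
      assume s: "R \<subseteq> N" "section_of B R W X" "section_of B R W X'" "section_of B R (U_bundle A H B) Y" and p: "p \<in> R"
      obtain U \<phi> e S \<theta> where c: "torsion_free_chart A U \<phi> H (e :: 'f option \<Rightarrow> 'a \<Rightarrow> 'a tvec) S \<theta> N W"
        "p \<in> affine_chart.domain U \<phi> e S" using chart_exists s(1) p by blast
      have "W p \<subseteq> characteristic B N ?D p" using ch s(1) p by blast
      from torsion_free_chart.double_bracket_in_bracket_span[OF c(1) this[unfolded assms(4)] p c(2) s[unfolded assms(4)]]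
      have v: "bracket B X (bracket B X' Y) p \<in> ?D p" unfolding assms(4) .
      show "residue_class (?D p) (bracket B X (bracket B X' Y) p) = ?D p"
        unfolding residue_class_def
      proof (intro equalityI subsetI)
        fix d assume "d \<in> (\<lambda>c. bracket B X (bracket B X' Y) p + c) ` ?D p"
        then show "d \<in> ?D p" using v subspace_add[OF B.subspace_bracket_span] by blast
      next
        fix d assume "d \<in> ?D p"
        then have "d - bracket B X (bracket B X' Y) p \<in> ?D p" using v by (intro subspace_diff B.subspace_bracket_span)
        then show "d \<in> (\<lambda>c. bracket B X (bracket B X' Y) p + c) ` ?D p"
          by (rule rev_image_eqI) simp
      qed
    qed
  qed
qed

end
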